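(* For any virtual-knot diagram $D$, there exists a virtual-knot diagram $D'$ representing the same virtual-knot as $D$ such that any finite sequence of generalized Reidemeister moves between $D$ and $D'$ includes at least one Reidemeister move of type II (RII-move).
   Context: A virtual-knot diagram is an oriented generic closed curve in $\mathbb R^2$ (an immersed circle whose only multiple points are finitely many transverse double points), where each double point is either a real-crossing (equipped with over/under information) or a virtual-crossing (no over/under information). Generalized Reidemeister moves are the following local changes of diagrams inside a disk (in both directions, with all possible orientations of the strands), plane isotopies being allowed freely. RI: adding or removing a kink with one real-crossing (of any kind). RII: adding or removing a bigon formed by two strands with two real-crossings, one strand being over at both. RIII: moving one strand across the crossing of two others, where the three strands cross pairwise in three real-crossings, one strand being over both others, one under both others. VRI, VRII, VRIII: the analogues of the underlying planar moves with all crossings involved virtual. VRIV: moving a strand across a real-crossing of two other strands, where the moving strand meets each of the other two in a virtual-crossing. Two diagrams represent the same virtual-knot if they are related by a finite sequence of generalized Reidemeister moves. *)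

theory Defs
  imports "HOL-Analysis.Analysis"
begin

section \<open>Virtual-knot diagrams\<close>

text \<open>
  The plane is \<^typ>\<open>complex\<close>. An oriented closed curve is a 1-periodic map
  from the reals, so parameters count modulo the integers. Each parameter carries a mark;
  \<open>Plain\<close> marks the parameters that are not at a double point.
\<close>

datatype mark = Plain | Over | Under | Virtual

record vdiag =
  curve :: "real \<Rightarrow> complex"
  mark :: "real \<Rightarrow> mark"

definition cross2 :: "complex \<Rightarrow> complex \<Rightarrow> real" where
  "cross2 v w = Re v * Im w - Im v * Re w"

definition closed_immersion :: "(real \<Rightarrow> complex) \<Rightarrow> bool" where
  "closed_immersion c \<longleftrightarrow>
     (\<forall>t. c (t + 1) = c t) \<and> c C1_differentiable_on UNIV \<and>
     (\<forall>t. vector_derivative c (at t) \<noteq> 0)"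

definition double_point :: "(real \<Rightarrow> complex) \<Rightarrow> real \<Rightarrow> real \<Rightarrow> bool" where
  "double_point c s t \<longleftrightarrow> s - t \<notin> \<int> \<and> c s = c t"

definition generic_curve :: "(real \<Rightarrow> complex) \<Rightarrow> bool" where
  "generic_curve c \<longleftrightarrow>
     closed_immersion c \<and>
     finite {s \<in> {0..<1}. \<exists>t. double_point c s t} \<and>
     (\<forall>s t. double_point c s t \<longrightarrow>
        cross2 (vector_derivative c (at s)) (vector_derivative c (at t)) \<noteq> 0) \<and>
     (\<forall>s t u. double_point c s t \<and> double_point c s u \<longrightarrow> t - u \<in> \<int>)"

definition virtual_diagram :: "vdiag \<Rightarrow> bool" where
  "virtual_diagram D \<longleftrightarrow>
     generic_curve (curve D) \<and>
     (\<forall>t. mark D (t + 1) = mark D t) \<and>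
     (\<forall>s. mark D s = Plain \<longleftrightarrow> \<not> (\<exists>t. double_point (curve D) s t)) \<and>
     (\<forall>s t. double_point (curve D) s t \<longrightarrow>
        (mark D s, mark D t) \<in> {(Over, Under), (Under, Over), (Virtual, Virtual)})"


section \<open>Plane isotopy\<close>

text \<open>An ambient \<open>C\<^sup>1\<close> isotopy of the plane: a path of diffeomorphisms starting at the identity.\<close>

definition plane_isotopy :: "(real \<Rightarrow> complex \<Rightarrow> complex) \<Rightarrow> bool" where
  "plane_isotopy H \<longleftrightarrow>
     H 0 = id \<and>
     continuous_on ({0..1} \<times> UNIV) (\<lambda>(t, z). H t z) \<and>
     (\<forall>t\<in>{0..1}. bij (H t)) \<and>
     (\<exists>H'. (\<forall>t\<in>{0..1}. \<forall>z. (H t has_derivative H' t z) (at z) \<and> bij (H' t z)) \<and>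
           (\<forall>v. continuous_on ({0..1} \<times> UNIV) (\<lambda>(t, z). H' t z v)))"

text \<open>Orientation-preserving \<open>C\<^sup>1\<close> change of parameter of the circle.\<close>

definition circle_reparam :: "(real \<Rightarrow> real) \<Rightarrow> bool" where
  "circle_reparam \<rho> \<longleftrightarrow>
     (\<forall>t. \<rho> (t + 1) = \<rho> t + 1) \<and> \<rho> C1_differentiable_on UNIV \<and>
     (\<forall>t. vector_derivative \<rho> (at t) > 0)"

definition isotopic :: "vdiag \<Rightarrow> vdiag \<Rightarrow> bool" where
  "isotopic D E \<longleftrightarrow>
     (\<exists>H \<rho>. plane_isotopy H \<and> circle_reparam \<rho> \<and>
        curve E = H 1 \<circ> curve D \<circ> \<rho> \<and> mark E = mark D \<circ> \<rho>)"


section \<open>Generalized Reidemeister moves\<close>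

text \<open>
  The disk in which a move takes place is put in standard position as the closed unit disk:
  any disk in the plane is carried there by a plane isotopy, and plane isotopies are
  free steps between moves.

  \<open>tangle D Is\<close> says that the part of \<open>D\<close> in the disk consists of the
  pairwise disjoint parameter arcs \<open>Is\<close>, each properly embedded as far as the boundary is
  concerned: its endpoints are on the circle, and all its other points are in the open disk.
\<close>

definition closed_strand :: "real \<times> real \<Rightarrow> real set" where
  "closed_strand I = {t. \<exists>n::int. t + of_int n \<in> {fst I..snd I}}"

definition open_strand :: "real \<times> real \<Rightarrow> real set" where
  "open_strand I = {t. \<exists>n::int. t + of_int n \<in> {fst I<..<snd I}}"

definition tangle :: "vdiag \<Rightarrow> (real \<times> real) list \<Rightarrow> bool" where
  "tangle D Is \<longleftrightarrow>
     (\<forall>(a, b) \<in> set Is. a < b \<and> b < a + 1) \<and>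
     (\<forall>i < length Is. \<forall>j < length Is. i \<noteq> j \<longrightarrow>
        closed_strand (Is ! i) \<inter> closed_strand (Is ! j) = {}) \<and>
     curve D -` cball 0 1 = (\<Union>I \<in> set Is. closed_strand I) \<and>
     curve D -` ball 0 1 = (\<Union>I \<in> set Is. open_strand I)"

definition local_change :: "(real \<times> real) list \<Rightarrow> vdiag \<Rightarrow> vdiag \<Rightarrow> bool" where
  "local_change Is D E \<longleftrightarrow>
     tangle D Is \<and> tangle E Is \<and>
     (\<forall>t. t \<notin> (\<Union>I \<in> set Is. open_strand I) \<longrightarrow> curve E t = curve D t \<and> mark E t = mark D t)"

definition plain_on :: "vdiag \<Rightarrow> real set \<Rightarrow> bool" where
  "plain_on D T \<longleftrightarrow> (\<forall>t \<in> T. mark D t = Plain)"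

text \<open>
  Type I: an arc without double points is replaced by an arc in the disk with exactly
  one double point, that is, by a kink. The parameter \<open>K\<close> is the set of marks allowed at
  the new crossing.
\<close>

definition kink_added :: "mark set \<Rightarrow> vdiag \<Rightarrow> vdiag \<Rightarrow> bool" where
  "kink_added K D E \<longleftrightarrow>
     (\<exists>a b. local_change [(a, b)] D E \<and>
        plain_on D {a..b} \<and>
        (\<exists>s t. a < s \<and> s < t \<and> t < b \<and> curve E s = curve E t \<and> mark E s \<in> K \<and>
           plain_on E ({a..b} - {s, t})))"

text \<open>
  Type II: two disjoint simple arcs are replaced by two simple arcs meeting in exactly two
  points, hence bounding a bigon. The second strand may run through the two crossings in
  either order. With \<open>m = Over\<close> the first strand is over at both.
\<close>

definition bigon_added :: "mark \<Rightarrow> vdiag \<Rightarrow> vdiag \<Rightarrow> bool" where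
  "bigon_added m D E \<longleftrightarrow>
     (\<exists>a b c d. local_change [(a, b), (c, d)] D E \<and>
        plain_on D ({a..b} \<union> {c..d}) \<and>
        (\<exists>s1 s2 t1 t2.
           a < s1 \<and> s1 < s2 \<and> s2 < b \<and> t1 \<in> {c<..<d} \<and> t2 \<in> {c<..<d} \<and> t1 \<noteq> t2 \<and>
           curve E s1 = curve E t1 \<and> curve E s2 = curve E t2 \<and>
           mark E s1 = m \<and> mark E s2 = m \<and>
           plain_on E (({a..b} \<union> {c..d}) - {s1, s2, t1, t2})))"

text \<open>
  Type III: strands 1 and 2 cross pairwise at parameters \<open>p1, p2\<close>; the moving strand 3 crosses
  strand 1 at \<open>q1, r1\<close> and strand 2 at \<open>q2, r2\<close> (\<open>r1, r2\<close> being parameters on strand 3),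
  and there are no other crossings in the disk.
\<close>

definition triple_crossing ::
  "vdiag \<Rightarrow> real \<times> real \<Rightarrow> real \<times> real \<Rightarrow> real \<times> real \<Rightarrow>
   real \<Rightarrow> real \<Rightarrow> real \<Rightarrow> real \<Rightarrow> real \<Rightarrow> real \<Rightarrow> bool" where
  "triple_crossing D I1 I2 I3 p1 p2 q1 q2 r1 r2 \<longleftrightarrow>
     p1 \<in> {fst I1<..<snd I1} \<and> q1 \<in> {fst I1<..<snd I1} \<and>
     p2 \<in> {fst I2<..<snd I2} \<and> q2 \<in> {fst I2<..<snd I2} \<and>
     r1 \<in> {fst I3<..<snd I3} \<and> r2 \<in> {fst I3<..<snd I3} \<and>
     curve D p1 = curve D p2 \<and> curve D q1 = curve D r1 \<and> curve D q2 = curve D r2 \<and>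
     plain_on D (({fst I1..snd I1} \<union> {fst I2..snd I2} \<union> {fst I3..snd I3})
                 - {p1, p2, q1, q2, r1, r2})"

text \<open>
  Strands 1 and 2 lie on the diagonals and are not changed; strand 3 joins \<open>-1\<close> and \<open>1\<close> (in
  either direction), passing above the centre in one diagram and below it in the other. Each
  crossing keeps its marks. The parameter \<open>K\<close> is the condition on the marks of
  \<open>p1, p2, q1, q2, r1, r2\<close>.
\<close>

definition strand_moved_across ::
  "(mark \<Rightarrow> mark \<Rightarrow> mark \<Rightarrow> mark \<Rightarrow> mark \<Rightarrow> mark \<Rightarrow> bool) \<Rightarrow> vdiag \<Rightarrow> vdiag \<Rightarrow> bool" where
  "strand_moved_across K D E \<longleftrightarrow>
     (\<exists>I1 I2 I3 p1 p2 q1 q2 r1 r2 q1' q2' r1' r2'.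
        local_change [I1, I2, I3] D E \<and>
        (\<forall>t \<in> {fst I1..snd I1}. curve E t = curve D t \<and> Im (curve D t) = Re (curve D t)) \<and>
        (\<forall>t \<in> {fst I2..snd I2}. curve E t = curve D t \<and> Im (curve D t) = - Re (curve D t)) \<and>
        {curve D (fst I3), curve D (snd I3)} = {-1, 1} \<and>
        triple_crossing D I1 I2 I3 p1 p2 q1 q2 r1 r2 \<and>
        triple_crossing E I1 I2 I3 p1 p2 q1' q2' r1' r2' \<and>
        Im (curve D q1) > 0 \<and> Im (curve D q2) > 0 \<and>
        Im (curve E q1') < 0 \<and> Im (curve E q2') < 0 \<and>
        mark E p1 = mark D p1 \<and> mark E p2 = mark D p2 \<and>
        mark E q1' = mark D q1 \<and> mark E q2' = mark D q2 \<and>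
        mark E r1' = mark D r1 \<and> mark E r2' = mark D r2 \<and>
        K (mark D p1) (mark D p2) (mark D q1) (mark D q2) (mark D r1) (mark D r2))"

text \<open>
  Strand 1 has the crossings \<open>p1, q1\<close>, strand 2 has \<open>p2, q2\<close>, and strand 3 has \<open>r1, r2\<close>.
\<close>

definition real_layered ::
  "mark \<Rightarrow> mark \<Rightarrow> mark \<Rightarrow> mark \<Rightarrow> mark \<Rightarrow> mark \<Rightarrow> bool" where
  "real_layered p1 p2 q1 q2 r1 r2 \<longleftrightarrow>
     {p1, p2, q1, q2, r1, r2} \<subseteq> {Over, Under} \<and>
     ((p1 = Over \<and> q1 = Over) \<or> (p2 = Over \<and> q2 = Over) \<or> (r1 = Over \<and> r2 = Over)) \<and>
     ((p1 = Under \<and> q1 = Under) \<or> (p2 = Under \<and> q2 = Under) \<or> (r1 = Under \<and> r2 = Under))"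

definition all_virtual ::
  "mark \<Rightarrow> mark \<Rightarrow> mark \<Rightarrow> mark \<Rightarrow> mark \<Rightarrow> mark \<Rightarrow> bool" where
  "all_virtual p1 p2 q1 q2 r1 r2 \<longleftrightarrow> {p1, p2, q1, q2, r1, r2} = {Virtual}"

definition virtual_over_real ::
  "mark \<Rightarrow> mark \<Rightarrow> mark \<Rightarrow> mark \<Rightarrow> mark \<Rightarrow> mark \<Rightarrow> bool" where
  "virtual_over_real p1 p2 q1 q2 r1 r2 \<longleftrightarrow>
     {p1, p2} = {Over, Under} \<and> {q1, q2, r1, r2} = {Virtual}"

datatype move = RI | RII | RIII | VRI | VRII | VRIII | VRIV

fun elementary_move :: "move \<Rightarrow> vdiag \<Rightarrow> vdiag \<Rightarrow> bool" where
  "elementary_move RI = kink_added {Over, Under}"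
| "elementary_move RII = bigon_added Over"
| "elementary_move RIII = strand_moved_across real_layered"
| "elementary_move VRI = kink_added {Virtual}"
| "elementary_move VRII = bigon_added Virtual"
| "elementary_move VRIII = strand_moved_across all_virtual"
| "elementary_move VRIV = strand_moved_across virtual_over_real"

definition reidemeister_move :: "move \<Rightarrow> vdiag \<Rightarrow> vdiag \<Rightarrow> bool" where
  "reidemeister_move m D E \<longleftrightarrow> elementary_move m D E \<or> elementary_move m E D"

text \<open>
  \<open>move_sequence D ms E\<close>: some finite sequence of plane isotopies and generalized Reidemeister
  moves leads from \<open>D\<close> to \<open>E\<close>, the types of its moves being, in order, \<open>ms\<close>.
\<close>

inductive move_sequence :: "vdiag \<Rightarrow> move list \<Rightarrow> vdiag \<Rightarrow> bool" where
  start: "virtual_diagram D \<Longrightarrow> move_sequence D [] D"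
| isotopy: "move_sequence D ms E \<Longrightarrow> isotopic E F \<Longrightarrow> virtual_diagram F \<Longrightarrow> move_sequence D ms F"
| move: "move_sequence D ms E \<Longrightarrow> reidemeister_move m E F \<Longrightarrow> virtual_diagram F \<Longrightarrow>
    move_sequence D (ms @ [m]) F"

definition same_virtual_knot :: "vdiag \<Rightarrow> vdiag \<Rightarrow> bool" where
  "same_virtual_knot D E \<longleftrightarrow> (\<exists>ms. move_sequence D ms E)"

end

(*
  Call a real crossing odd if its two parameters are separated by an odd number of parameters of
  real crossings. Plane isotopies and virtual moves do not change the Gauss diagram of the real
  crossings. A type I move adds a crossing that is not odd, and leaves the parity of the others unchanged.
  A type III move exchanges two neighbouring parameters on each of its three strands, so each crossing
  has both of its ends moved past one other end and keeps its parity. So only type II moves can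
  change the number of odd crossings.

  Conversely, first add a virtual kink to the diagram and then push two strands of the
  kink over each other that run in the same direction. The two new crossings have parameters
  s1 < s2 < t1 < t2 with no parameter of a real crossing in between, so they pair as (s1, t1), (s2, t2)
  and both are odd.
*)
theory Submission
  imports Defs
begin

text \<open>Parity is counted on the circle without cutting it: \<open>height\<close> sums ceilings
  over any transversal of the real parameters modulo the integers. Shifting a parameter by an
  integer \<open>n\<close> changes its height by \<open>n\<close> times the number of real
  parameters up to a common constant. That number is even, each real crossing having two ends, so no
  base point has to be followed through isotopies and moves.

  The direction of the two strands decides the example. Running in the same direction, they give
  interleaved chords; in opposite directions they would give nested chords with an even number of
  ends in between. An arbitrary diagram need not offer two neighbouring parallel strands joined by a
  piece of the curve free of real crossings; the virtual kink creates them without odd crossings.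

  Moves concern actual C1 curves in a round disk, so the crossings and the parameters inside the
  disk must be known exactly. Hence the use of quadratic splines with rational data, inserted into
  an arc that magnification has made almost straight.\<close>

section \<open>Periodicity and double points\<close>

lemma periodic_int:
  fixes f :: "real \<Rightarrow> 'a"
  assumes "\<forall>t. f (t + 1) = f t"
  shows "f (t + of_int n) = f t"
proof (induction n rule: int_induct[where k=0])
  case base then show ?case by simp
next
  case (step1 i)
  then show ?case using assms[rule_format, of "t + of_int i"] by (simp add: add.assoc)
next
  case (step2 i)
  then show ?case using assms[rule_format, of "t + of_int (i - 1)"] by (simp add: algebra_simps)
qed

lemma periodic_Ints:
  fixes f :: "real \<Rightarrow> 'a"
  assumes "\<forall>t. f (t + 1) = f t" and "s - t \<in> \<int>"
  shows "f s = f t"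
proof -
  obtain n where "s - t = of_int n" using assms(2) by (auto elim: Ints_cases)
  then have "s = t + of_int n" by simp
  then show ?thesis using periodic_int[OF assms(1)] by simp
qed

lemma Ints_trans: "(x::real) - y \<in> \<int> \<Longrightarrow> y - z \<in> \<int> \<Longrightarrow> x - z \<in> \<int>"
  using Ints_add by fastforce

lemma Ints_sym: "(x::real) - y \<in> \<int> \<Longrightarrow> y - x \<in> \<int>"
  by (metis Ints_minus minus_diff_eq)

lemma Ints_abs_less_1: "(x::real) \<in> \<int> \<Longrightarrow> \<bar>x\<bar> < 1 \<Longrightarrow> x = 0"
  using Ints_nonzero_abs_less1 by blast

lemma double_point_sym: "double_point c s t \<Longrightarrow> double_point c t s"
  by (auto simp: double_point_def dest: Ints_sym)

lemma curve_Ints: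
  assumes "virtual_diagram D" "s - t \<in> \<int>"
  shows "curve D s = curve D t"
proof -
  have "\<forall>t. curve D (t + 1) = curve D t"
    using assms(1) unfolding virtual_diagram_def generic_curve_def closed_immersion_def by blast
  then show ?thesis using assms(2) by (rule periodic_Ints)
qed

lemma mark_Ints:
  assumes "virtual_diagram D" "s - t \<in> \<int>"
  shows "mark D s = mark D t"
proof -
  have "\<forall>t. mark D (t + 1) = mark D t"
    using assms(1) unfolding virtual_diagram_def by blast
  then show ?thesis using assms(2) by (rule periodic_Ints)
qed

lemma double_point_Ints:
  assumes "virtual_diagram D" "s - s' \<in> \<int>" "t - t' \<in> \<int>"
  shows "double_point (curve D) s t \<longleftrightarrow> double_point (curve D) s' t'"
proof -
  have "s - t \<in> \<int> \<longleftrightarrow> s' - t' \<in> \<int>"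
    by (meson assms(2,3) Ints_trans Ints_sym)
  then show ?thesis using curve_Ints[OF assms(1,2)] curve_Ints[OF assms(1,3)]
    by (simp add: double_point_def)
qed

lemma double_point_unique:
  assumes "virtual_diagram D" "double_point (curve D) s t" "double_point (curve D) s u"
  shows "t - u \<in> \<int>"
  using assms by (auto simp: virtual_diagram_def generic_curve_def)

lemma mark_double_point:
  assumes "virtual_diagram D" "double_point (curve D) s t"
  shows "(mark D s, mark D t) \<in> {(Over, Under), (Under, Over), (Virtual, Virtual)}"
  using assms by (auto simp: virtual_diagram_def)

lemma plain_iff:
  assumes "virtual_diagram D"
  shows "mark D s = Plain \<longleftrightarrow> \<not> (\<exists>t. double_point (curve D) s t)"
  using assms by (auto simp: virtual_diagram_def)


section \<open>Representatives of the real parameters, heights and odd ends\<close>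

definition real_points :: "vdiag \<Rightarrow> real set" where
  "real_points D = {t. mark D t = Over \<or> mark D t = Under}"

definition reps :: "real set \<Rightarrow> real set \<Rightarrow> bool" where
  "reps R X \<longleftrightarrow> finite X \<and> X \<subseteq> R \<and> (\<forall>r\<in>R. \<exists>x\<in>X. r - x \<in> \<int>) \<and>
     (\<forall>x\<in>X. \<forall>y\<in>X. x - y \<in> \<int> \<longrightarrow> x = y)"

text \<open>
  Up to an additive constant, \<open>height X u\<close> is the number of points of \<open>X + \<int>\<close> below \<open>u\<close>. Two of these
  points therefore have heights of the same parity iff an odd number of them lies strictly
  in between: \<open>odd_points\<close> collects the ends of the odd chords of the Gauss diagram.
\<close>

definition height :: "real set \<Rightarrow> real \<Rightarrow> int" where
  "height X u = (\<Sum>x\<in>X. \<lceil>u - x\<rceil>)"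

definition odd_points :: "vdiag \<Rightarrow> real set \<Rightarrow> real set" where
  "odd_points D X =
     {x \<in> X. \<exists>y\<in>X. double_point (curve D) x y \<and> even (height X x - height X y)}"

text \<open>Ends are counted, so each odd crossing contributes 2.\<close>

definition odd_number :: "vdiag \<Rightarrow> nat" where
  "odd_number D = card (odd_points D (real_points D \<inter> {0..<1}))"

lemma repsI:
  assumes "finite X" "X \<subseteq> R" "\<And>r. r \<in> R \<Longrightarrow> \<exists>x\<in>X. r - x \<in> \<int>"
    "\<And>x y. x \<in> X \<Longrightarrow> y \<in> X \<Longrightarrow> x - y \<in> \<int> \<Longrightarrow> x = y"
  shows "reps R X"
  using assms by (auto simp: reps_def)

lemma real_points_Ints:
  assumes "virtual_diagram D" "s - t \<in> \<int>"
  shows "s \<in> real_points D \<longleftrightarrow> t \<in> real_points D"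
  using mark_Ints[OF assms] by (simp add: real_points_def)

lemma real_points_partner:
  assumes "virtual_diagram D" "double_point (curve D) s t"
  shows "s \<in> real_points D \<longleftrightarrow> t \<in> real_points D"
  using mark_double_point[OF assms] by (auto simp: real_points_def)

lemma ex_Ints_unit: "\<exists>x\<in>{0..<1}. (r::real) - x \<in> \<int>"
proof (rule bexI)
  show "r - frac r \<in> \<int>" by (simp add: frac_def)
  show "frac r \<in> {0..<1}" by (simp add: frac_lt_1)
qed

text \<open>Invariance of \<open>S\<close> under integer translations keeps the representative in
  the unit interval inside \<open>S\<close>. Finiteness is inherited from the double points, as a
  real mark is not \<open>Plain\<close>.\<close>

lemma reps_unit:
  assumes "virtual_diagram D" "\<And>s t. s \<in> S \<Longrightarrow> s - t \<in> \<int> \<Longrightarrow> t \<in> S"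
  shows "reps (real_points D \<inter> S) (real_points D \<inter> S \<inter> {0..<1})"
proof -
  have "real_points D \<inter> {0..<1} \<subseteq> {s \<in> {0..<1}. \<exists>t. double_point (curve D) s t}"
  proof
    fix s assume "s \<in> real_points D \<inter> {0..<1}"
    then have "mark D s \<noteq> Plain" "s \<in> {0..<1}" by (auto simp: real_points_def)
    then show "s \<in> {s \<in> {0..<1}. \<exists>t. double_point (curve D) s t}"
      using plain_iff[OF assms(1)] by blast
  qed
  moreover have "finite {s \<in> {0..<1}. \<exists>t. double_point (curve D) s t}"
    using assms(1) by (auto simp: virtual_diagram_def generic_curve_def)
  ultimately have "finite (real_points D \<inter> {0..<1})" by (rule finite_subset)
  then have "finite (real_points D \<inter> S \<inter> {0..<1})" by (rule rev_finite_subset) auto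
  moreover have "\<exists>x\<in>real_points D \<inter> S \<inter> {0..<1}. r - x \<in> \<int>" if r: "r \<in> real_points D \<inter> S" for r
  proof -
    obtain x where x: "x \<in> {0..<1}" "r - x \<in> \<int>" using ex_Ints_unit by blast
    then have "x \<in> real_points D \<inter> S"
      using r real_points_Ints[OF assms(1) x(2)] assms(2)[OF _ x(2)] by auto
    then show ?thesis using x by blast
  qed
  moreover have "x = y" if "x \<in> {0..<1}" "y \<in> {0..<1}" "x - y \<in> \<int>" for x y :: real
    using that Ints_abs_less_1[of "x - y"] by auto
  ultimately show ?thesis unfolding reps_def by fastforce
qed

lemma reps_Un:
  assumes "reps A X" "reps B Y" "\<And>a b. a \<in> A \<Longrightarrow> b \<in> B \<Longrightarrow> a - b \<notin> \<int>"
  shows "reps (A \<union> B) (X \<union> Y)"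
  unfolding reps_def
proof (intro conjI ballI impI)
  show "finite (X \<union> Y)" "X \<union> Y \<subseteq> A \<union> B" using assms by (auto simp: reps_def)
  show "\<exists>x\<in>X \<union> Y. r - x \<in> \<int>" if "r \<in> A \<union> B" for r
    using that assms(1,2) unfolding reps_def by blast
  fix x y assume xy: "x \<in> X \<union> Y" "y \<in> X \<union> Y" "x - y \<in> \<int>"
  have "y - x \<in> \<int>" using xy(3) by (rule Ints_sym)
  then show "x = y" using xy assms unfolding reps_def by blast
qed

text \<open>Passing to the partner is injective and exchanges \<open>Over\<close> and
  \<open>Under\<close> ends, so there are equally many of both. This evenness makes parities of
  height differences independent of the chosen representatives.\<close>

lemma even_card_reps:
  assumes D: "virtual_diagram D" and X: "reps (real_points D) X"
  shows "even (card X)"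
proof -
  define O' where "O' = {x \<in> X. mark D x = Over}"
  define U' where "U' = {x \<in> X. mark D x = Under}"
  have fin: "finite X" using X by (simp add: reps_def)
  have "\<exists>y\<in>X. double_point (curve D) x y" if "x \<in> X" for x
  proof -
    have xr: "x \<in> real_points D" using that X by (auto simp: reps_def)
    then have "mark D x \<noteq> Plain" by (auto simp: real_points_def)
    then obtain t where t: "double_point (curve D) x t" using plain_iff[OF D] by blast
    then have "t \<in> real_points D" using real_points_partner[OF D t] xr by simp
    then obtain y where y: "y \<in> X" "t - y \<in> \<int>" using X by (auto simp: reps_def)
    then show ?thesis using double_point_Ints[OF D _ y(2), of x x] t by auto
  qed
  then obtain g where g: "\<And>x. x \<in> X \<Longrightarrow> g x \<in> X \<and> double_point (curve D) x (g x)" by metis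
  have inj: "inj_on g X"
  proof (rule inj_onI)
    fix x y assume xy: "x \<in> X" "y \<in> X" "g x = g y"
    then have "x - y \<in> \<int>"
      using g double_point_unique[OF D double_point_sym double_point_sym] by metis
    then show "x = y" using xy X by (auto simp: reps_def)
  qed
  have "g ` O' \<subseteq> U'" "g ` U' \<subseteq> O'"
    using g mark_double_point[OF D] by (fastforce simp: O'_def U'_def)+
  moreover have "inj_on g O'" "inj_on g U'" using inj by (auto simp: O'_def U'_def intro: inj_on_subset)
  moreover have "finite O'" "finite U'" using fin by (auto simp: O'_def U'_def)
  ultimately have "card O' = card U'" by (meson card_inj_on_le le_antisym)
  moreover have "X = O' \<union> U'" "O' \<inter> U' = {}"
    using X by (auto simp: O'_def U'_def reps_def real_points_def)
  ultimately show ?thesis using \<open>finite O'\<close> \<open>finite U'\<close> by (simp add: card_Un_disjoint)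
qed

text \<open>The form in which two diagrams or two transversals are compared. Only the difference of
  heights across a chord has to keep its parity; single heights may change, as they do in a type III
  move.\<close>

lemma odd_points_transport:
  assumes bij: "bij_betw f X Y"
    and dp: "\<And>x y. x \<in> X \<Longrightarrow> y \<in> X \<Longrightarrow>
      double_point (curve E) (f x) (f y) \<longleftrightarrow> double_point (curve D) x y"
    and ht: "\<And>x y. x \<in> X \<Longrightarrow> y \<in> X \<Longrightarrow> double_point (curve D) x y \<Longrightarrow>
      even (height Y (f x) - height Y (f y)) \<longleftrightarrow> even (height X x - height X y)"
  shows "card (odd_points E Y) = card (odd_points D X)"
proof -
  have Y: "Y = f ` X" using bij by (simp add: bij_betw_def)
  have "odd_points E Y = f ` odd_points D X"
  proof (rule set_eqI)
    fix z
    have "z \<in> odd_points E Y \<longleftrightarrow> (\<exists>x\<in>X. z = f x \<and> (\<exists>y\<in>X. double_point (curve E) (f x) (f y) \<and>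
        even (height Y (f x) - height Y (f y))))"
      unfolding odd_points_def using Y by blast
    also have "\<dots> \<longleftrightarrow> z \<in> f ` odd_points D X"
      unfolding odd_points_def using dp ht by blast
    finally show "z \<in> odd_points E Y \<longleftrightarrow> z \<in> f ` odd_points D X" .
  qed
  moreover have "inj_on f (odd_points D X)"
    using bij by (auto simp: bij_betw_def odd_points_def intro: inj_on_subset)
  ultimately show ?thesis by (simp add: card_image)
qed

lemma height_int: "height X (u + of_int n) = height X u + n * int (card X)"
proof -
  have "\<lceil>u + of_int n - x\<rceil> = \<lceil>u - x\<rceil> + n" for x
    by (metis add_diff_eq ceiling_add_of_int diff_add_eq)
  then show ?thesis by (simp add: height_def sum.distrib)
qed

text \<open>Replacing each representative \<open>x\<close> by \<open>x + n x\<close> lowers all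
  heights by one constant, which cancels in differences, and changes the height at the moved point
  by a multiple of the even number \<open>card X\<close>.\<close>

lemma odd_number_reps:
  assumes D: "virtual_diagram D" and X: "reps (real_points D) X"
  shows "card (odd_points D X) = odd_number D"
proof -
  define Y where "Y = real_points D \<inter> {0..<1}"
  have Y: "reps (real_points D) Y" using reps_unit[OF D, of UNIV] by (simp add: Y_def)
  have "\<exists>y\<in>X. y - x \<in> \<int>" if "x \<in> Y" for x
    using that X Y Ints_sym unfolding reps_def by blast
  then obtain f where f: "\<And>x. x \<in> Y \<Longrightarrow> f x \<in> X \<and> f x - x \<in> \<int>" by metis
  have inj: "inj_on f Y"
  proof (rule inj_onI)
    fix x y assume xy: "x \<in> Y" "y \<in> Y" "f x = f y"
    then have "x - y \<in> \<int>" using f[of x] f[of y] by (metis Ints_sym Ints_trans)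
    then show "x = y" using xy Y by (auto simp: reps_def)
  qed
  have "X \<subseteq> f ` Y"
  proof
    fix x assume x: "x \<in> X"
    then have "x \<in> real_points D" using X by (auto simp: reps_def)
    then obtain y where y: "y \<in> Y" "x - y \<in> \<int>" using Y by (auto simp: reps_def)
    then have "f y - x \<in> \<int>" using f[of y] by (metis Ints_sym Ints_trans)
    then have "f y = x" using x f[OF y(1)] X by (auto simp: reps_def)
    then show "x \<in> f ` Y" using y by blast
  qed
  then have img: "f ` Y = X" using f by auto
  have bij: "bij_betw f Y X" using inj img by (simp add: bij_betw_def)
  define n where "n x = \<lfloor>f x - x\<rfloor>" for x
  have n: "f x = x + of_int (n x)" if "x \<in> Y" for x
    using f[OF that] by (auto simp: n_def elim: Ints_cases)
  have hX: "height X u = height Y u - (\<Sum>x\<in>Y. n x)" for u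
  proof -
    have "height X u = (\<Sum>x\<in>Y. \<lceil>u - f x\<rceil>)"
      unfolding height_def using sum.reindex_bij_betw[OF bij, of "\<lambda>x. \<lceil>u - x\<rceil>"] by simp
    also have "\<dots> = (\<Sum>x\<in>Y. \<lceil>u - x\<rceil> - n x)"
    proof (rule sum.cong)
      fix x assume "x \<in> Y"
      then have "u - f x = (u - x) - of_int (n x)" using n by simp
      then show "\<lceil>u - f x\<rceil> = \<lceil>u - x\<rceil> - n x" using ceiling_diff_of_int by metis
    qed simp
    also have "\<dots> = height Y u - (\<Sum>x\<in>Y. n x)" by (simp add: height_def sum_subtractf)
    finally show ?thesis .
  qed
  have ev: "even (card X)" using even_card_reps[OF D X] .
  have "card (odd_points D X) = card (odd_points D Y)"
  proof (rule odd_points_transport[OF bij])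
    fix x y assume xy: "x \<in> Y" "y \<in> Y"
    show "double_point (curve D) (f x) (f y) \<longleftrightarrow> double_point (curve D) x y"
      using double_point_Ints[OF D, of "f x" x "f y" y] f xy by blast
    show "even (height X (f x) - height X (f y)) \<longleftrightarrow> even (height Y x - height Y y)"
      using ev xy by (simp add: hX n height_int)
  qed
  then show ?thesis by (simp add: odd_number_def Y_def)
qed

section \<open>Invariance of the number of odd crossings\<close>

lemma odd_number_same_real_points:
  assumes D: "virtual_diagram D" and E: "virtual_diagram E"
    and R: "real_points E = real_points D"
    and c: "\<And>t. t \<in> real_points D \<Longrightarrow> curve E t = curve D t"
  shows "odd_number E = odd_number D"
proof -
  have "card (odd_points E (real_points E \<inter> {0..<1})) = card (odd_points D (real_points D \<inter> {0..<1}))"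
    unfolding R by (rule odd_points_transport[where f="\<lambda>x. x"])
      (auto simp: bij_betw_def double_point_def c)
  then show ?thesis by (simp add: odd_number_def)
qed

section \<open>Strands and the ceilings of parameter differences\<close>

lemma closed_strand_Ints:
  assumes "t \<in> closed_strand I" "t - s \<in> \<int>"
  shows "s \<in> closed_strand I"
proof -
  obtain n m where "t + of_int n \<in> {fst I..snd I}" "t - s = of_int m"
    using assms by (auto simp: closed_strand_def elim: Ints_cases)
  then have "s + of_int (m + n) \<in> {fst I..snd I}" by (simp add: algebra_simps)
  then show ?thesis unfolding closed_strand_def by blast
qed

lemma closed_strandI: "a \<le> t \<Longrightarrow> t \<le> b \<Longrightarrow> t \<in> closed_strand (a, b)"
  unfolding closed_strand_def by (auto intro!: exI[of _ 0])

lemma closed_strandI': "t \<in> {fst I..snd I} \<Longrightarrow> t \<in> closed_strand I"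
  using closed_strandI[of "fst I" t "snd I"] by simp

lemma closed_strandE:
  assumes "t \<in> closed_strand I"
  obtains s where "s \<in> {fst I..snd I}" "t - s \<in> \<int>"
proof -
  obtain n :: int where "t + of_int n \<in> {fst I..snd I}"
    using assms by (auto simp: closed_strand_def)
  then show ?thesis using that[of "t + of_int n"] by simp
qed

lemma open_strand_subset: "open_strand I \<subseteq> closed_strand I"
  unfolding open_strand_def closed_strand_def by (auto intro: less_imp_le)

text \<open>As \<open>x\<close> and \<open>y\<close> vary over two intervals, the ceiling can change
  only if \<open>x - y\<close> meets an integer, and then the two strands share a point of the
  circle. So the ends on one of two disjoint strands contribute constants to the heights along the
  other.\<close>

lemma ceiling_diff_const:
  assumes disj: "closed_strand (a, b) \<inter> closed_strand (c, d) = {}"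
    and "x \<in> {a..b}" "x' \<in> {a..b}" "y \<in> {c..d}" "y' \<in> {c..d}"
  shows "\<lceil>x - y\<rceil> = \<lceil>x' - y'\<rceil>"
proof (rule ccontr)
  have no_int: False if "a - d \<le> of_int n" "of_int n \<le> b - c" "a \<le> b" "c \<le> d" for n
  proof -
    \<comment> \<open>The left end of the overlap of \<open>{a..b}\<close> with the translate of
      \<open>{c..d}\<close> by \<open>n\<close>.\<close>
    define u where "u = max a (c + of_int n)"
    have u: "a \<le> u" "u \<le> b" "c \<le> u - of_int n" "u - of_int n \<le> d"
      using that by (auto simp: u_def)
    then have "u \<in> closed_strand (a, b)" "u - of_int n \<in> closed_strand (c, d)"
      by (auto intro: closed_strandI)
    then have "u \<in> closed_strand (a, b) \<inter> closed_strand (c, d)"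
      using closed_strand_Ints[of "u - of_int n" _ u] by simp
    then show False using disj by blast
  qed
  assume "\<lceil>x - y\<rceil> \<noteq> \<lceil>x' - y'\<rceil>"
  then consider "\<lceil>x - y\<rceil> < \<lceil>x' - y'\<rceil>" | "\<lceil>x' - y'\<rceil> < \<lceil>x - y\<rceil>" by linarith
  then show False
  proof cases
    case 1
    \<comment> \<open>The smaller ceiling is an integer between the two differences, hence between
      \<open>a - d\<close> and \<open>b - c\<close>.\<close>
    then have "of_int \<lceil>x - y\<rceil> < x' - y'" by (auto simp: less_ceiling_iff)
    then show False using no_int[of "\<lceil>x - y\<rceil>"] le_of_int_ceiling[of "x - y"] assms(2-5)
      unfolding atLeastAtMost_iff by linarith
  next
    case 2
    then have "of_int \<lceil>x' - y'\<rceil> < x - y" by (auto simp: less_ceiling_iff)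
    then show False using no_int[of "\<lceil>x' - y'\<rceil>"] le_of_int_ceiling[of "x' - y'"] assms(2-5)
      unfolding atLeastAtMost_iff by linarith
  qed
qed

lemma closed_strand_point: "y \<in> closed_strand (x, x) \<longleftrightarrow> y - x \<in> \<int>"
proof
  assume "y \<in> closed_strand (x, x)"
  then obtain s where "s \<in> {x..x}" "y - s \<in> \<int>" by (auto elim: closed_strandE)
  then show "y - x \<in> \<int>" by simp
next
  assume "y - x \<in> \<int>"
  then show "y \<in> closed_strand (x, x)"
    using closed_strand_Ints[OF closed_strandI[of x x x]] Ints_sym by blast
qed

text \<open>A point is the strand of an interval of length zero, so this is a case of two disjoint
  strands.\<close>

lemma ceiling_diff_const_point:
  assumes "x \<notin> closed_strand (a, b)" "y \<in> {a..b}" "y' \<in> {a..b}"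
  shows "\<lceil>x - y\<rceil> = \<lceil>x - y'\<rceil>" "\<lceil>y - x\<rceil> = \<lceil>y' - x\<rceil>"
proof -
  have "closed_strand (x, x) \<inter> closed_strand (a, b) = {}"
    using assms(1) closed_strand_Ints by (auto simp: closed_strand_point)
  then show "\<lceil>x - y\<rceil> = \<lceil>x - y'\<rceil>" "\<lceil>y - x\<rceil> = \<lceil>y' - x\<rceil>"
    using ceiling_diff_const[of x x a b x x y y'] ceiling_diff_const[of a b x x y y' x x] assms
    by auto
qed

lemma height_Un: "finite X \<Longrightarrow> finite Y \<Longrightarrow> X \<inter> Y = {} \<Longrightarrow> height (X \<union> Y) u = height X u + height Y u"
  by (simp add: height_def sum.union_disjoint)

text \<open>Seen from outside the arc, all points of \<open>Z\<close> contribute the same ceiling,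
  and their number is even; seen from \<open>Z\<close>, each outer point contributes a constant.
  Chords do not connect \<open>Z\<close> with the rest, so the outer odd ends are unaffected and
  those of \<open>Z\<close> are found from \<open>Z\<close> alone. The arc may contain several
  strands of a move together with the parts between them.\<close>

lemma odd_number_insert:
  assumes D: "virtual_diagram D" and E: "virtual_diagram E"
    and free: "real_points D \<inter> closed_strand (a, b) = {}"
    and same: "\<And>t. t \<notin> closed_strand (a, b) \<Longrightarrow> curve E t = curve D t \<and> mark E t = mark D t"
    and Z: "Z \<subseteq> {a..b}" "even (card Z)" "reps (real_points E \<inter> closed_strand (a, b)) Z"
    and partner: "\<And>z. z \<in> Z \<Longrightarrow> \<exists>z'\<in>Z. double_point (curve E) z z'"
  shows "odd_number E = odd_number D + card (odd_points E Z)"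
proof -
  define S where "S = closed_strand (a, b)"
  define X where "X = real_points D \<inter> - S \<inter> {0..<1}"
  have inv: "t \<in> - S" if "s \<in> - S" "s - t \<in> \<int>" for s t
    using that closed_strand_Ints[of t _ s] Ints_sym unfolding S_def by blast
  have "reps (real_points D \<inter> - S) X"
    unfolding X_def by (rule reps_unit[OF D inv])
  moreover have "real_points D \<inter> - S = real_points D" using free by (auto simp: S_def)
  ultimately have X: "reps (real_points D) X" by simp
  have "t \<in> real_points E \<longleftrightarrow> t \<in> real_points D" if "t \<notin> S" for t
    using same[of t] that by (simp add: S_def real_points_def)
  then have RE: "real_points E \<inter> - S = real_points D"
    using free unfolding S_def by blast
  have "reps (real_points D \<union> (real_points E \<inter> S)) (X \<union> Z)"
    using X Z(3) unfolding S_def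
  proof (rule reps_Un)
    fix u v assume "u \<in> real_points D" "v \<in> real_points E \<inter> closed_strand (a, b)"
    then show "u - v \<notin> \<int>"
      using free closed_strand_Ints[of v "(a,b)" u] Ints_sym by blast
  qed
  moreover have "real_points D \<union> (real_points E \<inter> S) = real_points E" using RE by blast
  ultimately have XZ: "reps (real_points E) (X \<union> Z)" by simp
  have ZS: "Z \<subseteq> S" using Z(1) closed_strandI[of a _ b] unfolding S_def by fastforce
  have XS: "X \<inter> S = {}" by (auto simp: X_def)
  have fin: "finite X" "finite Z" using X Z(3) by (auto simp: reps_def)
  have disj: "X \<inter> Z = {}" using ZS XS by blast
  note hU = height_Un[OF fin disj]
  have hZ: "even (height Z x)" if "x \<in> X" for x
  proof (cases "Z = {}")
    case False
    then obtain z0 where z0: "z0 \<in> Z" by blast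
    have "height Z x = (\<Sum>z\<in>Z. \<lceil>x - z0\<rceil>)"
      unfolding height_def
    proof (rule sum.cong)
      fix z assume "z \<in> Z"
      then show "\<lceil>x - z\<rceil> = \<lceil>x - z0\<rceil>"
        using ceiling_diff_const_point(1)[of x a b z z0] z0 Z(1) XS that unfolding S_def by blast
    qed simp
    then show ?thesis using Z(2) by simp
  qed (simp add: height_def)
  have hX: "height X z = height X z'" if "z \<in> Z" "z' \<in> Z" for z z'
    unfolding height_def
  proof (rule sum.cong)
    fix x assume "x \<in> X"
    then show "\<lceil>z - x\<rceil> = \<lceil>z' - x\<rceil>"
      using ceiling_diff_const_point(2)[of x a b z z'] that Z(1) XS unfolding S_def by blast
  qed simp
  \<comment> \<open>The partner of \<open>z\<close> is unique modulo the integers and already lies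
    in \<open>Z\<close>.\<close>
  have mix: "\<not> double_point (curve E) z x" if "z \<in> Z" "x \<in> X" for x z
  proof
    assume dp: "double_point (curve E) z x"
    have "\<exists>z'\<in>Z. double_point (curve E) z z'" using partner that(1) .
    then obtain z' where "z' \<in> Z" "double_point (curve E) z z'" by blast
    then have "z' - x \<in> \<int>" "z' \<in> S" using double_point_unique[OF E _ dp] ZS by auto
    then have "x \<in> S" unfolding S_def using closed_strand_Ints by blast
    then show False using XS that(2) by blast
  qed
  have curveX: "curve E x = curve D x" if "x \<in> X" for x
    using same that XS unfolding S_def by blast
  have "odd_points E (X \<union> Z) = odd_points D X \<union> odd_points E Z"
  proof (rule set_eqI)
    fix u
    show "u \<in> odd_points E (X \<union> Z) \<longleftrightarrow> u \<in> odd_points D X \<union> odd_points E Z"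
    proof (cases "u \<in> Z")
      case True
      then have "u \<notin> X" using disj by blast
      have *: "y \<in> Z" if "y \<in> X \<union> Z" "double_point (curve E) u y" for y
        using mix[OF True] that by blast
      have "even (height (X \<union> Z) u - height (X \<union> Z) y) \<longleftrightarrow> even (height Z u - height Z y)"
        if "y \<in> Z" for y
        using hX[OF True that] by (simp add: hU)
      then show ?thesis using True \<open>u \<notin> X\<close> * unfolding odd_points_def by blast
    next
      case False
      have dp: "double_point (curve E) u y \<longleftrightarrow> double_point (curve D) u y" if "u \<in> X" "y \<in> X" for y
        using curveX that by (simp add: double_point_def)
      have *: "y \<in> X" if "u \<in> X" "y \<in> X \<union> Z" "double_point (curve E) u y" for y
        using mix[of y u] that double_point_sym by blast
      have "even (height (X \<union> Z) u - height (X \<union> Z) y) \<longleftrightarrow> even (height X u - height X y)"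
        if "u \<in> X" "y \<in> X" for y
        using hZ[OF that(1)] hZ[OF that(2)] by (simp add: hU)
      then show ?thesis using False dp * unfolding odd_points_def by blast
    qed
  qed
  moreover have "odd_points D X \<inter> odd_points E Z = {}" using disj by (auto simp: odd_points_def)
  moreover have "finite (odd_points D X)" "finite (odd_points E Z)"
    using fin by (auto simp: odd_points_def)
  ultimately have "card (odd_points E (X \<union> Z)) = card (odd_points D X) + card (odd_points E Z)"
    by (simp add: card_Un_disjoint)
  then show ?thesis using odd_number_reps[OF E XZ] odd_number_reps[OF D X] by simp
qed

text \<open>Made for real crossings that slide inside a disk. No chord joins \<open>S\<close> to its
  complement, so three effects are left to control: of the moved ends on outer heights
  (\<open>h1\<close>), of outer ends on inner heights (\<open>h2\<close>), and of the inner ends on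
  each other along a chord (\<open>h3\<close>).\<close>

lemma odd_number_replace:
  assumes D: "virtual_diagram D" and E: "virtual_diagram E"
    and inv: "\<And>s t. s \<in> S \<Longrightarrow> s - t \<in> \<int> \<Longrightarrow> t \<in> S"
    and same: "\<And>t. t \<notin> S \<Longrightarrow> curve E t = curve D t \<and> mark E t = mark D t"
    and sepD: "\<And>s t. s \<in> S \<Longrightarrow> t \<notin> S \<Longrightarrow> curve D s \<noteq> curve D t"
    and sepE: "\<And>s t. s \<in> S \<Longrightarrow> t \<notin> S \<Longrightarrow> curve E s \<noteq> curve E t"
    and Z: "reps (real_points D \<inter> S) Z" and fZ: "reps (real_points E \<inter> S) (f ` Z)"
    and inj: "inj_on f Z"
    and dp: "\<And>x y. x \<in> Z \<Longrightarrow> y \<in> Z \<Longrightarrow>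
      double_point (curve E) (f x) (f y) \<longleftrightarrow> double_point (curve D) x y"
    and h1: "\<And>x. x \<notin> S \<Longrightarrow> even (height (f ` Z) x - height Z x)"
    and h2: "\<And>x z. x \<notin> S \<Longrightarrow> z \<in> Z \<Longrightarrow> \<lceil>f z - x\<rceil> = \<lceil>z - x\<rceil>"
    and h3: "\<And>x y. x \<in> Z \<Longrightarrow> y \<in> Z \<Longrightarrow> double_point (curve D) x y \<Longrightarrow>
      even (height (f ` Z) (f x) - height (f ` Z) (f y)) \<longleftrightarrow> even (height Z x - height Z y)"
  shows "odd_number E = odd_number D"
proof -
  define X where "X = real_points D \<inter> - S \<inter> {0..<1}"
  have inv': "t \<in> - S" if "s \<in> - S" "s - t \<in> \<int>" for s t
    using that inv[of t s] Ints_sym by blast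
  have X: "reps (real_points D \<inter> - S) X"
    unfolding X_def by (rule reps_unit[OF D inv'])
  have RE: "real_points E \<inter> - S = real_points D \<inter> - S"
    using same by (auto simp: real_points_def)
  have "reps ((real_points D \<inter> - S) \<union> (real_points D \<inter> S)) (X \<union> Z)"
    using X Z by (rule reps_Un) (use inv' in blast)
  moreover have "(real_points D \<inter> - S) \<union> (real_points D \<inter> S) = real_points D" by blast
  ultimately have XZ: "reps (real_points D) (X \<union> Z)" by simp
  have "reps ((real_points E \<inter> - S) \<union> (real_points E \<inter> S)) (X \<union> f ` Z)"
    using X[folded RE] fZ by (rule reps_Un) (use inv' in blast)
  moreover have "(real_points E \<inter> - S) \<union> (real_points E \<inter> S) = real_points E" by blast
  ultimately have XfZ: "reps (real_points E) (X \<union> f ` Z)" by simp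
  have ZS: "Z \<subseteq> S" "f ` Z \<subseteq> S" "X \<inter> S = {}" using Z fZ by (auto simp: reps_def X_def)
  have fin: "finite X" "finite Z" using X Z by (auto simp: reps_def)
  have disj: "X \<inter> Z = {}" "X \<inter> f ` Z = {}" using ZS by blast+
  have hZ: "height (X \<union> Z) u = height X u + height Z u" for u
    using fin disj by (simp add: height_Un)
  have hfZ: "height (X \<union> f ` Z) u = height X u + height (f ` Z) u" for u
    using fin disj by (simp add: height_Un)
  define g where "g x = (if x \<in> Z then f x else x)" for x
  have gX: "g x = x" if "x \<in> X" for x using that disj by (auto simp: g_def)
  have gZ: "g x = f x" if "x \<in> Z" for x using that by (auto simp: g_def)
  have gim: "g ` X = X" "g ` Z = f ` Z" using gX gZ by auto
  have "inj_on g (X \<union> Z)"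
  proof (rule inj_onI)
    fix x y assume xy: "x \<in> X \<union> Z" "y \<in> X \<union> Z" "g x = g y"
    have "g u \<in> X \<longleftrightarrow> u \<in> X" if "u \<in> X \<union> Z" for u
      using that gX gZ disj by fastforce
    then show "x = y" using xy gX gZ inj unfolding inj_on_def by (metis UnE)
  qed
  then have bij: "bij_betw g (X \<union> Z) (X \<union> f ` Z)"
    using gim by (simp add: bij_betw_def image_Un)
  have hXf: "height X (f z) = height X z" if "z \<in> Z" for z
    unfolding height_def
  proof (rule sum.cong)
    fix x assume "x \<in> X"
    then have "x \<notin> S" using ZS by blast
    then show "\<lceil>f z - x\<rceil> = \<lceil>z - x\<rceil>" using that by (rule h2)
  qed simp
  have ncurve: "curve D x \<noteq> curve D z" "curve D z \<noteq> curve D x"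
      "curve E x \<noteq> curve E (f z)" "curve E (f z) \<noteq> curve E x" if "x \<in> X" "z \<in> Z" for x z
    using sepD[of z x] sepE[of "f z" x] ZS that by fastforce+
  have curveX: "curve E x = curve D x" if "x \<in> X" for x
    using same that ZS(3) by blast
  have "card (odd_points E (X \<union> f ` Z)) = card (odd_points D (X \<union> Z))"
  proof (rule odd_points_transport[OF bij])
    fix x y assume xy: "x \<in> X \<union> Z" "y \<in> X \<union> Z"
    show "double_point (curve E) (g x) (g y) \<longleftrightarrow> double_point (curve D) x y"
    proof -
      consider "x \<in> X" "y \<in> X" | "x \<in> Z" "y \<in> Z" | "x \<in> X" "y \<in> Z" | "x \<in> Z" "y \<in> X"
        using xy by blast
      then show ?thesis
      proof cases
        case 1
        then show ?thesis by (simp add: gX curveX double_point_def)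
      next
        case 2
        then show ?thesis by (simp add: gZ dp)
      next
        case 3
        then show ?thesis using ncurve[of x y] by (simp add: gX gZ double_point_def)
      next
        case 4
        then show ?thesis using ncurve[of y x] by (simp add: gX gZ double_point_def)
      qed
    qed
    assume dpxy: "double_point (curve D) x y"
    consider "x \<in> X" "y \<in> X" | "x \<in> Z" "y \<in> Z"
      using xy ncurve dpxy by (auto simp: double_point_def)
    then show "even (height (X \<union> f ` Z) (g x) - height (X \<union> f ` Z) (g y)) \<longleftrightarrow>
        even (height (X \<union> Z) x - height (X \<union> Z) y)"
    proof cases
      case 1
      then show ?thesis using h1[of x] h1[of y] ZS(3) by (auto simp: gX hZ hfZ)
    next
      case 2
      have "height (X \<union> f ` Z) (g x) - height (X \<union> f ` Z) (g y) =
          (height X x - height X y) + (height (f ` Z) (f x) - height (f ` Z) (f y))"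
        using 2 by (simp add: gZ hfZ hXf)
      moreover have "height (X \<union> Z) x - height (X \<union> Z) y =
          (height X x - height X y) + (height Z x - height Z y)"
        by (simp add: hZ)
      ultimately show ?thesis using h3[OF 2 dpxy] by (simp only: even_add)
    qed
  qed
  then show ?thesis using odd_number_reps[OF E XfZ] odd_number_reps[OF D XZ] by simp
qed

section \<open>Plane isotopies\<close>

text \<open>\<open>H 1\<close> is injective, so double points correspond under \<open>r\<close>.
  Heights agree exactly: \<open>r\<close> is increasing and commutes with integer translations, so
  it preserves the comparison of \<open>t\<close> with \<open>s x + n\<close> for every integer
  \<open>n\<close>, which is all that a ceiling records.\<close>

lemma isotopic_odd_number:
  assumes D: "virtual_diagram D" and E: "virtual_diagram E" and iso: "isotopic D E"
  shows "odd_number E = odd_number D"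
proof -
  obtain H r where H: "plane_isotopy H" and r: "circle_reparam r"
    and cE: "curve E = H 1 \<circ> curve D \<circ> r" and mE: "mark E = mark D \<circ> r"
    using iso by (auto simp: isotopic_def)
  have inj: "inj (H 1)" using H by (auto simp: plane_isotopy_def bij_def)
  have r1: "r (t + of_int n) = r t + of_int n" for t n
    using periodic_int[of "\<lambda>t. r t - t" t n] r by (simp add: circle_reparam_def)
  obtain r' where r': "\<And>t. (r has_vector_derivative r' t) (at t)"
    using r by (auto simp: circle_reparam_def C1_differentiable_on_def)
  have cont: "continuous_on UNIV r"
    using r' by (meson has_vector_derivative_continuous continuous_at_imp_continuous_on)
  have mono: "strict_mono r"
  proof (rule strict_monoI)
    fix x y :: real assume "x < y"
    then show "r x < r y"
    proof (rule DERIV_pos_imp_increasing)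
      fix z
      have "vector_derivative r (at z) = r' z" using r' by (rule vector_derivative_at)
      then have "0 < r' z" using r by (metis circle_reparam_def)
      then show "\<exists>y. (r has_real_derivative y) (at z) \<and> 0 < y"
        using r' by (auto simp: has_real_derivative_iff_has_vector_derivative)
    qed
  qed
  have "\<exists>t. r t = y" for y
  proof -
    \<comment> \<open>As \<open>r\<close> advances by one per period, its values at two consecutive
      integers enclose \<open>y\<close>.\<close>
    define n where "n = \<lfloor>y - r 0\<rfloor>"
    have "r (of_int n) \<le> y" "y \<le> r (of_int (n + 1))"
      using r1[of 0 n] r1[of 0 "n + 1"] unfolding n_def by (simp, linarith)+
    then show ?thesis
      using IVT'[of r "of_int n" y "of_int (n + 1)"] continuous_on_subset[OF cont] by auto
  qed
  then have bij: "bij r" using mono by (metis bijI strict_mono_imp_inj_on surjI)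
  define s where "s = inv r"
  have rs: "r (s y) = y" for y using bij by (simp add: s_def bij_is_surj surj_f_inv_f)
  have sr: "s (r t) = t" for t using bij by (simp add: s_def bij_is_inj)
  have Ints: "r t - r u \<in> \<int> \<longleftrightarrow> t - u \<in> \<int>" for t u
  proof
    assume "t - u \<in> \<int>"
    then obtain n where "t - u = of_int n" by (auto elim: Ints_cases)
    then have "t = u + of_int n" by simp
    then show "r t - r u \<in> \<int>" by (simp add: r1)
  next
    assume "r t - r u \<in> \<int>"
    then obtain n where "r t - r u = of_int n" by (auto elim: Ints_cases)
    then have "r t = r (u + of_int n)" by (simp add: r1)
    then have "t = u + of_int n" using sr by metis
    then show "t - u \<in> \<int>" by simp
  qed
  have dp: "double_point (curve E) t u \<longleftrightarrow> double_point (curve D) (r t) (r u)" for t u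
    using inj by (auto simp: double_point_def cE Ints inj_eq)
  define X where "X = real_points D \<inter> {0..<1}"
  have X: "reps (real_points D) X" using reps_unit[OF D, of UNIV] by (simp add: X_def)
  have RE: "t \<in> real_points E \<longleftrightarrow> r t \<in> real_points D" for t
    by (simp add: real_points_def mE)
  have injs: "inj s" using rs by (metis injI)
  have sX: "reps (real_points E) (s ` X)"
    unfolding reps_def
  proof (intro conjI ballI impI)
    show "finite (s ` X)" "s ` X \<subseteq> real_points E" using X by (auto simp: reps_def RE rs)
    fix t assume "t \<in> real_points E"
    then obtain x where "x \<in> X" "r t - x \<in> \<int>" using X by (auto simp: reps_def RE)
    then show "\<exists>x\<in>s ` X. t - x \<in> \<int>" using Ints[of t "s x"] by (auto simp: rs)
  next
    fix x y assume "x \<in> s ` X" "y \<in> s ` X" "x - y \<in> \<int>"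
    then obtain u v where "u \<in> X" "v \<in> X" "x = s u" "y = s v" "u - v \<in> \<int>"
      using Ints[of x y] by (auto simp: rs)
    then show "x = y" using X unfolding reps_def by blast
  qed
  have ht: "height (s ` X) t = height X (r t)" for t
  proof -
    have "height (s ` X) t = (\<Sum>x\<in>X. \<lceil>t - s x\<rceil>)"
      unfolding height_def using injs by (subst sum.reindex) (auto intro: inj_on_subset)
    also have "\<dots> = (\<Sum>x\<in>X. \<lceil>r t - x\<rceil>)"
    proof (rule sum.cong)
      fix x
      have "\<lceil>t - s x\<rceil> \<le> n \<longleftrightarrow> \<lceil>r t - x\<rceil> \<le> n" for n
      proof -
        have "t - s x \<le> of_int n \<longleftrightarrow> r t \<le> r (s x + of_int n)"
          unfolding strict_mono_less_eq[OF mono] by linarith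
        also have "\<dots> \<longleftrightarrow> r t - x \<le> of_int n" unfolding r1 rs by linarith
        finally show ?thesis by (simp add: ceiling_le_iff)
      qed
      then show "\<lceil>t - s x\<rceil> = \<lceil>r t - x\<rceil>" by (meson order_antisym order_refl)
    qed simp
    finally show ?thesis by (simp add: height_def)
  qed
  have "card (odd_points E (s ` X)) = card (odd_points D X)"
    by (rule odd_points_transport[of s])
      (use injs in \<open>auto simp: bij_betw_def dp rs ht intro: inj_on_subset\<close>)
  then show ?thesis using odd_number_reps[OF E sX] odd_number_reps[OF D X] by simp
qed

section \<open>Tangles, kinks and virtual bigons\<close>

lemma local_change_outside:
  assumes "local_change Is D E" "t \<notin> (\<Union>I\<in>set Is. closed_strand I)"
  shows "curve E t = curve D t" "mark E t = mark D t"
  using assms open_strand_subset unfolding local_change_def by blast+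

lemma local_change_tangle:
  assumes "local_change Is D E" shows "tangle D Is" "tangle E Is"
  using assms by (auto simp: local_change_def)

lemma tangle_cball:
  assumes "tangle D Is"
  shows "curve D t \<in> cball 0 1 \<longleftrightarrow> t \<in> (\<Union>I\<in>set Is. closed_strand I)"
  using assms unfolding tangle_def by blast

lemma tangle_bounds:
  assumes "tangle D Is" "I \<in> set Is"
  shows "fst I < snd I" "snd I < fst I + 1"
  using assms unfolding tangle_def by (auto split: prod.splits)

lemma tangle_disjoint:
  assumes "tangle D Is" "i < length Is" "j < length Is" "i \<noteq> j"
  shows "closed_strand (Is ! i) \<inter> closed_strand (Is ! j) = {}"
  using assms by (simp add: tangle_def)

lemma plain_on_closed_strand:
  assumes "virtual_diagram D" "plain_on D {fst I..snd I}" "t \<in> closed_strand I"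
  shows "mark D t = Plain"
  using assms mark_Ints[OF assms(1)] by (metis closed_strandE plain_on_def)

lemma double_point_close: "c s = c t \<Longrightarrow> s < t \<Longrightarrow> t < s + 1 \<Longrightarrow> double_point c s t"
  using Ints_abs_less_1[of "s - t"] by (auto simp: double_point_def)

text \<open>The rule for marks makes the second end of the new crossing \<open>Virtual\<close> too,
  so the strand carries no real ends before or after the move.\<close>

lemma virtual_kink_odd_number:
  assumes D: "virtual_diagram D" and E: "virtual_diagram E" and k: "kink_added {Virtual} D E"
  shows "odd_number E = odd_number D"
proof -
  obtain a b s t where lc: "local_change [(a, b)] D E" and pD: "plain_on D {a..b}"
    and st: "a < s" "s < t" "t < b" "curve E s = curve E t" "mark E s = Virtual"
    and pE: "plain_on E ({a..b} - {s, t})"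
    using k by (auto simp: kink_added_def)
  have b: "b < a + 1" using tangle_bounds[OF local_change_tangle(1)[OF lc]] by auto
  have "double_point (curve E) s t" using st b by (intro double_point_close) auto
  then have mt: "mark E t = Virtual" using mark_double_point[OF E] st(5) by fastforce
  have out: "t \<notin> closed_strand (a, b) \<Longrightarrow> curve E t = curve D t \<and> mark E t = mark D t" for t
    using local_change_outside[OF lc] by auto
  have D1: "u \<notin> real_points D" if "u \<in> closed_strand (a, b)" for u
    using plain_on_closed_strand[OF D _ that] pD by (simp add: real_points_def)
  have E1: "u \<notin> real_points E" if u: "u \<in> closed_strand (a, b)" for u
  proof -
    obtain v where v: "v \<in> {a..b}" "u - v \<in> \<int>" using u by (auto elim: closed_strandE)
    have "mark E v \<in> {Plain, Virtual}"
      using pE v(1) st(5) mt unfolding plain_on_def by fastforce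
    then show ?thesis using mark_Ints[OF E v(2)] by (auto simp: real_points_def)
  qed
  have "u \<in> real_points E \<longleftrightarrow> u \<in> real_points D" for u
  proof (cases "u \<in> closed_strand (a, b)")
    case True
    then show ?thesis using D1 E1 by simp
  next
    case False
    then show ?thesis using out[OF False] by (simp add: real_points_def)
  qed
  then have "real_points E = real_points D" by blast
  then show ?thesis using out D1
    by (intro odd_number_same_real_points[OF D E]) blast+
qed

lemma virtual_bigon_odd_number:
  assumes D: "virtual_diagram D" and E: "virtual_diagram E" and k: "bigon_added Virtual D E"
  shows "odd_number E = odd_number D"
proof -
  obtain a b c d s1 s2 t1 t2 where lc: "local_change [(a, b), (c, d)] D E"
    and pD: "plain_on D ({a..b} \<union> {c..d})"
    and st: "a < s1" "s1 < s2" "s2 < b" "t1 \<in> {c<..<d}" "t2 \<in> {c<..<d}"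
      "curve E s1 = curve E t1" "curve E s2 = curve E t2"
      "mark E s1 = Virtual" "mark E s2 = Virtual"
    and pE: "plain_on E (({a..b} \<union> {c..d}) - {s1, s2, t1, t2})"
    using k unfolding bigon_added_def by blast
  define S where "S = closed_strand (a, b) \<union> closed_strand (c, d)"
  have disj: "closed_strand (a, b) \<inter> closed_strand (c, d) = {}"
    using local_change_tangle(1)[OF lc] unfolding tangle_def by fastforce
  have dp: "double_point (curve E) s t" if "s \<in> {a..b}" "t \<in> {c..d}" "curve E s = curve E t" for s t
  proof -
    have "s \<in> closed_strand (a, b)" "t \<in> closed_strand (c, d)"
      using that by (auto intro: closed_strandI)
    then show ?thesis
      using disj closed_strand_Ints[of s "(a, b)" t] that(3) by (auto simp: double_point_def)
  qed
  have "double_point (curve E) s1 t1" "double_point (curve E) s2 t2" using st by (auto intro!: dp)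
  then have mt: "mark E t1 = Virtual" "mark E t2 = Virtual"
    using mark_double_point[OF E] st by fastforce+
  have out: "t \<notin> S \<Longrightarrow> curve E t = curve D t \<and> mark E t = mark D t" for t
    using local_change_outside[OF lc] by (auto simp: S_def)
  have D1: "u \<notin> real_points D" if "u \<in> S" for u
    using plain_on_closed_strand[OF D, of "(a,b)" u] plain_on_closed_strand[OF D, of "(c,d)" u] pD that
    by (auto simp: real_points_def S_def plain_on_def)
  have E1: "u \<notin> real_points E" if u: "u \<in> S" for u
  proof -
    obtain v where v: "v \<in> {a..b} \<union> {c..d}" "u - v \<in> \<int>"
      using u unfolding S_def by (metis Un_iff closed_strandE fst_conv snd_conv)
    have "mark E v \<in> {Plain, Virtual}"
      using pE v(1) st mt unfolding plain_on_def by fastforce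
    then show ?thesis using mark_Ints[OF E v(2)] by (auto simp: real_points_def)
  qed
  have "u \<in> real_points E \<longleftrightarrow> u \<in> real_points D" for u
  proof (cases "u \<in> S")
    case True
    then show ?thesis using D1 E1 by simp
  next
    case False
    then show ?thesis using out[OF False] by (simp add: real_points_def)
  qed
  then have "real_points E = real_points D" by blast
  then show ?thesis using out D1
    by (intro odd_number_same_real_points[OF D E]) blast+
qed

lemma real_kink_odd_number:
  assumes D: "virtual_diagram D" and E: "virtual_diagram E" and k: "kink_added {Over, Under} D E"
  shows "odd_number E = odd_number D"
proof -
  obtain a b s t where lc: "local_change [(a, b)] D E" and pD: "plain_on D {a..b}"
    and st: "a < s" "s < t" "t < b" "curve E s = curve E t" "mark E s \<in> {Over, Under}"
    and pE: "plain_on E ({a..b} - {s, t})"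
    using k by (auto simp: kink_added_def)
  have b: "b < a + 1" using tangle_bounds[OF local_change_tangle(1)[OF lc]] by auto
  have dp: "double_point (curve E) s t" using st b by (intro double_point_close) auto
  have real: "s \<in> real_points E" "t \<in> real_points E"
    using st(5) real_points_partner[OF E dp] by (auto simp: real_points_def)
  have out: "t \<notin> closed_strand (a, b) \<Longrightarrow> curve E t = curve D t \<and> mark E t = mark D t" for t
    using local_change_outside[OF lc] by auto
  have free: "real_points D \<inter> closed_strand (a, b) = {}"
    using plain_on_closed_strand[OF D, of "(a, b)"] pD by (auto simp: real_points_def)
  have nint: "s - t \<notin> \<int>" "t - s \<notin> \<int>" using dp double_point_sym[OF dp] by (auto simp: double_point_def)
  have "reps (real_points E \<inter> closed_strand (a, b)) {s, t}"
  proof (rule repsI)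
    show "{s, t} \<subseteq> real_points E \<inter> closed_strand (a, b)"
      using st real by (auto intro: closed_strandI)
    show "\<exists>z\<in>{s, t}. u - z \<in> \<int>" if u: "u \<in> real_points E \<inter> closed_strand (a, b)" for u
    proof -
      obtain v where v: "v \<in> {a..b}" "u - v \<in> \<int>" using u by (auto elim: closed_strandE)
      then have "v \<in> real_points E" using u real_points_Ints[OF E v(2)] by blast
      then have "mark E v \<noteq> Plain" by (auto simp: real_points_def)
      then have "v \<in> {s, t}" using pE v(1) unfolding plain_on_def by blast
      then show ?thesis using v(2) by blast
    qed
    show "x = y" if "x \<in> {s, t}" "y \<in> {s, t}" "x - y \<in> \<int>" for x y
      using that nint by blast
  qed auto
  moreover have "\<exists>z'\<in>{s, t}. double_point (curve E) z z'" if "z \<in> {s, t}" for z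
    using that dp double_point_sym[OF dp] by blast
  ultimately have "odd_number E = odd_number D + card (odd_points E {s, t})"
    using st by (intro odd_number_insert[OF D E free out]) auto
  moreover have "odd_points E {s, t} = {}"
  proof -
    \<comment> \<open>The two ends are less than one period apart, so among themselves they have
      heights 0 and 1, of different parity: the chord is even.\<close>
    have "\<lceil>s - t\<rceil> = 0" "\<lceil>t - s\<rceil> = 1" using st b by (auto simp: ceiling_unique ceiling_eq_iff)
    then have "height {s, t} s = 0" "height {s, t} t = 1"
      using st(2) by (auto simp: height_def)
    then show ?thesis by (auto simp: odd_points_def double_point_def)
  qed
  ultimately show ?thesis by simp
qed

section \<open>The order of the crossings on the strands of a type III move\<close>

lemma no_zero_same_sign:
  fixes g :: "real \<Rightarrow> real"
  assumes "continuous_on {a..b} g" "a \<le> b" "\<forall>t\<in>{a..b}. g t \<noteq> 0"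
  shows "g a * g b > 0"
proof (rule ccontr)
  assume "\<not> g a * g b > 0"
  moreover have "g a \<noteq> 0" "g b \<noteq> 0" using assms by auto
  ultimately have "g a * g b < 0" by (simp add: not_less order_less_le)
  then have "(g a \<le> 0 \<and> 0 \<le> g b) \<or> (g b \<le> 0 \<and> 0 \<le> g a)" by (auto simp: mult_less_0_iff)
  then show False
    using IVT'[of g a 0 b] IVT2'[of g b 0 a] assms by auto
qed

text \<open>With opposite signs at the ends and \<open>p\<close> as the only possible zero,
  \<open>g\<close> keeps the sign of \<open>g a\<close> before \<open>p\<close> and that of
  \<open>g b\<close> after it. This turns the order of two crossings on a strand into a
  sign.\<close>

lemma sign_before_zero:
  fixes g :: "real \<Rightarrow> real"
  assumes cont: "continuous_on {a..b} g" and ab: "g a * g b < 0" and t: "t \<in> {a..b}" "g t \<noteq> 0"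
    and zero: "\<And>u. u \<in> {a..b} \<Longrightarrow> g u = 0 \<Longrightarrow> u = p"
  shows "t < p \<longleftrightarrow> g t * g a > 0"
proof
  assume "t < p"
  then have "g a * g t > 0"
    using t zero by (intro no_zero_same_sign continuous_on_subset[OF cont]) fastforce+
  then show "g t * g a > 0" by (simp add: mult.commute)
next
  assume pos: "g t * g a > 0"
  show "t < p"
  proof (rule ccontr)
    assume "\<not> t < p"
    have "g u \<noteq> 0" if "u \<in> {t..b}" for u
    proof
      assume "g u = 0"
      then have "u = p" using zero[of u] that t by auto
      then have "u = t" using \<open>\<not> t < p\<close> that by auto
      then show False using t \<open>g u = 0\<close> by blast
    qed
    then have "g t * g b > 0"
      using t by (intro no_zero_same_sign continuous_on_subset[OF cont]) auto
    then show False using pos ab by (auto simp: zero_less_mult_iff mult_less_0_iff)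
  qed
qed

lemma virtual_diagram_continuous:
  assumes "virtual_diagram D" shows "continuous_on A (curve D)"
proof -
  have "curve D C1_differentiable_on UNIV"
    using assms unfolding virtual_diagram_def generic_curve_def closed_immersion_def by blast
  then show ?thesis
    by (meson C1_differentiable_imp_continuous_on continuous_on_subset subset_UNIV)
qed

text \<open>An end lies in its closed strand, so its image is in the closed disk. It lies in no open
  strand: the other strands are disjoint from it, and a nonzero integer translation would leave an
  interval shorter than one. So the image is not in the open disk.\<close>

lemma tangle_endpoint_norm:
  assumes T: "tangle D Is" and I: "I \<in> set Is" and t: "t = fst I \<or> t = snd I"
  shows "norm (curve D t) = 1"
proof -
  note b = tangle_bounds[OF T I]
  have tc: "t \<in> closed_strand I" using t b by (intro closed_strandI') auto
  then have "curve D t \<in> cball 0 1" using tangle_cball[OF T] I by blast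
  moreover have "curve D t \<notin> ball 0 1"
  proof
    assume "curve D t \<in> ball 0 1"
    then obtain J where J: "J \<in> set Is" "t \<in> open_strand J"
      using T unfolding tangle_def by blast
    have "J = I"
    proof (rule ccontr)
      assume "J \<noteq> I"
      then obtain i j where "i < length Is" "j < length Is" "i \<noteq> j" "Is ! i = I" "Is ! j = J"
        using I J(1) by (metis in_set_conv_nth)
      then have "closed_strand I \<inter> closed_strand J = {}" using tangle_disjoint[OF T] by metis
      then show False using tc J(2) open_strand_subset by blast
    qed
    then obtain n :: int where n: "fst I < t + of_int n" "t + of_int n < snd I"
      using J(2) by (auto simp: open_strand_def)
    then have "\<bar>real_of_int n\<bar> < 1" using t b by linarith
    then have "n = 0" by linarith
    then show False using n t by auto
  qed
  ultimately show ?thesis by auto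
qed

lemma tangle_endpoints_distinct:
  assumes D: "virtual_diagram D" and T: "tangle D Is" and I: "I \<in> set Is"
    and plain: "mark D (fst I) = Plain"
  shows "curve D (fst I) \<noteq> curve D (snd I)"
proof
  assume "curve D (fst I) = curve D (snd I)"
  then have "double_point (curve D) (fst I) (snd I)"
    using tangle_bounds[OF T I] by (intro double_point_close) auto
  then show False using plain plain_iff[OF D] by blast
qed

text \<open>
  The moving strand meets a diagonal only at its crossing with the strand on that diagonal,
  which fills the diagonal. So the intermediate value theorem determines the order of the two crossings
  on each strand from the signs of their imaginary parts.
\<close>

lemma diagonal_ends:
  assumes D: "virtual_diagram D" and T: "tangle D Is" and I: "I \<in> set Is"
    and plain: "mark D (fst I) = Plain" and k: "k = 1 \<or> k = -1"
    and diag: "\<And>t. t \<in> {fst I..snd I} \<Longrightarrow> Im (curve D t) = k * Re (curve D t)"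
  shows "Im (curve D (fst I)) * Im (curve D (snd I)) < 0"
    and "\<And>z. norm z \<le> 1 \<Longrightarrow> Im z = k * Re z \<Longrightarrow> \<exists>t\<in>{fst I..snd I}. curve D t = z"
proof -
  let ?a = "fst I" and ?b = "snd I" and ?c = "curve D"
  have ab: "?a < ?b" using tangle_bounds[OF T I] by blast
  \<comment> \<open>On both diagonals the coordinates have equal squares. So the two ends, of norm
    1, have imaginary parts of equal square, and being distinct points of one diagonal they are
    opposite.\<close>
  have half: "2 * (Im z)\<^sup>2 = (norm z)\<^sup>2" if "Im z = k * Re z" for z
    using that k by (auto simp: cmod_power2)
  have ga: "2 * (Im (?c ?a))\<^sup>2 = 1" and gb: "2 * (Im (?c ?b))\<^sup>2 = 1"
    using half[of "?c ?a"] half[of "?c ?b"] diag ab tangle_endpoint_norm[OF T I] by auto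
  have ne: "Im (?c ?a) \<noteq> Im (?c ?b)"
  proof
    assume "Im (?c ?a) = Im (?c ?b)"
    then have "?c ?a = ?c ?b" using diag[of ?a] diag[of ?b] k ab by (auto simp: complex_eq_iff)
    then show False using tangle_endpoints_distinct[OF D T I plain] by blast
  qed
  have "(Im (?c ?a))\<^sup>2 = (Im (?c ?b))\<^sup>2" using ga gb by simp
  then have opp: "Im (?c ?b) = - Im (?c ?a)" using ne by (auto simp: power2_eq_iff)
  have nz: "Im (?c ?a) \<noteq> 0" using ga by auto
  then show "Im (?c ?a) * Im (?c ?b) < 0" 
    unfolding opp by (metis mult_minus_right neg_less_0_iff_less not_real_square_gt_zero)
  fix z assume z: "norm z \<le> 1" "Im z = k * Re z"
  have "2 * (Im z)\<^sup>2 \<le> 1" using half[OF z(2)] z(1) by (simp add: power_le_one)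
  then have "(Im z)\<^sup>2 \<le> (Im (?c ?a))\<^sup>2" using ga by linarith
  then have bound: "\<bar>Im z\<bar> \<le> \<bar>Im (?c ?a)\<bar>" by (simp add: abs_le_square_iff)
  have cont: "continuous_on {?a..?b} (\<lambda>t. Im (?c t))"
    by (intro continuous_intros virtual_diagram_continuous[OF D])
  have "\<exists>t. ?a \<le> t \<and> t \<le> ?b \<and> Im (?c t) = Im z"
  proof (cases "Im (?c ?a) > 0")
    case True
    then show ?thesis using bound opp ab by (intro IVT2' cont) auto
  next
    case False
    then show ?thesis using bound opp ab by (intro IVT' cont) auto
  qed
  then obtain t where t: "t \<in> {?a..?b}" "Im (?c t) = Im z" by auto
  then have "?c t = z" using diag[OF t(1)] z(2) k by (auto simp: complex_eq_iff)
  then show "\<exists>t\<in>{?a..?b}. ?c t = z" using t(1) by blast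
qed

text \<open>Each order is expressed by the sign of an imaginary part at a crossing and by data at
  the end of a strand. Only the former differs between the two sides of a type III move. On strand 3
  the function \<open>Im - Re\<close> is used: it vanishes on the diagonal of strand 1, hence at
  \<open>r1\<close>, and is twice the imaginary part on the other diagonal, hence at
  \<open>r2\<close>.\<close>

lemma crossing_orders:
  assumes D: "virtual_diagram D" and T: "tangle D [I1, I2, I3]"
    and tc: "triple_crossing D I1 I2 I3 p1 p2 q1 q2 r1 r2"
    and d1: "\<And>t. t \<in> {fst I1..snd I1} \<Longrightarrow> Im (curve D t) = Re (curve D t)"
    and d2: "\<And>t. t \<in> {fst I2..snd I2} \<Longrightarrow> Im (curve D t) = - Re (curve D t)"
    and ends: "{curve D (fst I3), curve D (snd I3)} = {-1, 1}"
    and nz: "Im (curve D q1) \<noteq> 0" "Im (curve D q2) \<noteq> 0"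
  shows "q1 \<noteq> p1" "q1 < p1 \<longleftrightarrow> Im (curve D q1) * Im (curve D (fst I1)) > 0"
    and "q2 \<noteq> p2" "q2 < p2 \<longleftrightarrow> Im (curve D q2) * Im (curve D (fst I2)) > 0"
    and "r2 \<noteq> r1" "r2 < r1 \<longleftrightarrow> Im (curve D q2) * - Re (curve D (fst I3)) > 0"
    and "Im (curve D (fst I1)) \<noteq> 0" "Im (curve D (fst I2)) \<noteq> 0" "Re (curve D (fst I3)) \<noteq> 0"
proof -
  let ?c = "curve D"
  have pts: "p1 \<in> {fst I1<..<snd I1}" "q1 \<in> {fst I1<..<snd I1}"
     "p2 \<in> {fst I2<..<snd I2}" "q2 \<in> {fst I2<..<snd I2}"
     "r1 \<in> {fst I3<..<snd I3}" "r2 \<in> {fst I3<..<snd I3}"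
    and eq: "?c p1 = ?c p2" "?c q1 = ?c r1" "?c q2 = ?c r2"
    and plain: "plain_on D (({fst I1..snd I1} \<union> {fst I2..snd I2} \<union> {fst I3..snd I3})
                 - {p1, p2, q1, q2, r1, r2})"
    using tc unfolding triple_crossing_def by blast+
  have disj: "closed_strand I1 \<inter> closed_strand I2 = {}" "closed_strand I1 \<inter> closed_strand I3 = {}"
    "closed_strand I2 \<inter> closed_strand I3 = {}"
    using tangle_disjoint[OF T, of 0 1] tangle_disjoint[OF T, of 0 2] tangle_disjoint[OF T, of 1 2]
    by simp_all
  have bounds: "fst I < snd I" "snd I < fst I + 1" if "I \<in> {I1, I2, I3}" for I
    using tangle_bounds[OF T, of I] that by auto
  have in1: "u \<in> closed_strand I1" if "u \<in> {fst I1..snd I1}" for u using that by (rule closed_strandI')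
  have in2: "u \<in> closed_strand I2" if "u \<in> {fst I2..snd I2}" for u using that by (rule closed_strandI')
  have in3: "u \<in> closed_strand I3" if "u \<in> {fst I3..snd I3}" for u using that by (rule closed_strandI')
  have dpair: "double_point ?c u v" if "u \<in> closed_strand I" "v \<in> closed_strand J"
    "closed_strand I \<inter> closed_strand J = {}" "?c u = ?c v" for u v I J
    using that closed_strand_Ints[of u I v] by (auto simp: double_point_def)
  \<comment> \<open>\<open>p\<close> has the partner \<open>v\<close> away from this strand. Another
    parameter of the strand at the same point would be a second partner, which is impossible modulo
    the integers.\<close>
  have same: "u = p" if u: "u \<in> {fst I..snd I}" "p \<in> {fst I..snd I}" "I \<in> {I1, I2, I3}"
    "double_point ?c p v" "v \<notin> closed_strand I" "?c u = ?c p" for u p v I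
  proof (rule ccontr)
    assume "u \<noteq> p"
    then have "\<bar>p - u\<bar> < 1" "p - u \<noteq> 0" using u(1,2) bounds(2)[OF u(3)] by auto
    then have "p - u \<notin> \<int>" using Ints_abs_less_1[of "p - u"] by blast
    then have "double_point ?c p u" using u(6) by (simp add: double_point_def)
    then have "u - v \<in> \<int>" using double_point_unique[OF D _ u(4)] by blast
    then show False using closed_strand_Ints[OF closed_strandI'[OF u(1)]] u(5) by blast
  qed
  have P: "?c p1 = 0"
    using d1[of p1] d2[of p2] pts eq by (auto simp: complex_eq_iff)
  have dpp: "double_point ?c p1 p2"
    using pts eq(1) disj(1) by (intro dpair[of p1 I1 p2 I2] in1 in2) auto
  have b1: "fst I1 \<in> {fst I1..snd I1}" and b2: "fst I2 \<in> {fst I2..snd I2}"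
    using bounds(1)[of I1] bounds(1)[of I2] by auto
  have mem: "p1 \<in> closed_strand I1" "q1 \<in> closed_strand I1" "p2 \<in> closed_strand I2"
    "q2 \<in> closed_strand I2" "r1 \<in> closed_strand I3" "r2 \<in> closed_strand I3"
    using pts by (auto intro!: closed_strandI')
  have "fst I1 \<notin> {p1, p2, q1, q2, r1, r2}"
    using mem disj in1[OF b1] pts(1,2) by auto
  then have pl1: "mark D (fst I1) = Plain" using plain b1 unfolding plain_on_def by blast
  have "fst I2 \<notin> {p1, p2, q1, q2, r1, r2}"
    using mem disj in2[OF b2] pts(3,4) by auto
  then have pl2: "mark D (fst I2) = Plain" using plain b2 unfolding plain_on_def by blast
  note ends1 = diagonal_ends[OF D T _ pl1, of 1, simplified, OF d1]
  note ends2 = diagonal_ends[OF D T _ pl2, of "-1", simplified, OF d2]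
  have cont: "continuous_on A (\<lambda>t. Im (?c t))" "continuous_on A (\<lambda>t. Im (?c t) - Re (?c t))" for A
    by (intro continuous_intros virtual_diagram_continuous[OF D])+
  show "q1 \<noteq> p1" "q2 \<noteq> p2" using nz P eq(1) by auto
  show "q1 < p1 \<longleftrightarrow> Im (?c q1) * Im (?c (fst I1)) > 0"
  proof (rule sign_before_zero[OF cont(1)])
    show "Im (?c (fst I1)) * Im (?c (snd I1)) < 0" using ends1 by auto
    show "q1 \<in> {fst I1..snd I1}" using pts by auto
    show "Im (?c q1) \<noteq> 0" by (fact nz)
    fix u assume u: "u \<in> {fst I1..snd I1}" "Im (?c u) = 0"
    then have "?c u = ?c p1" using P d1[OF u(1)] by (auto simp: complex_eq_iff)
    then show "u = p1"
      using same[OF u(1) _ _ dpp] pts(1) mem(3) disj(1) by auto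
  qed
  show "q2 < p2 \<longleftrightarrow> Im (?c q2) * Im (?c (fst I2)) > 0"
  proof (rule sign_before_zero[OF cont(1)])
    show "Im (?c (fst I2)) * Im (?c (snd I2)) < 0" using ends2 by auto
    show "q2 \<in> {fst I2..snd I2}" using pts by auto
    show "Im (?c q2) \<noteq> 0" by (fact nz)
    fix u assume u: "u \<in> {fst I2..snd I2}" "Im (?c u) = 0"
    then have "?c u = ?c p2" using P eq(1) d2[OF u(1)] by (auto simp: complex_eq_iff)
    then show "u = p2"
      using same[OF u(1) _ _ double_point_sym[OF dpp]] pts(3) mem(1) disj(1) by auto
  qed
  let ?g = "\<lambda>t. Im (?c t) - Re (?c t)"
  have gr1: "?g r1 = 0" using d1[of q1] pts(2) eq(2) by auto
  have gr2: "?g r2 = 2 * Im (?c q2)" using d2[of q2] pts(4) eq(3) by auto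
  show "r2 \<noteq> r1" using gr1 gr2 nz(2) by auto
  have e3: "(?c (fst I3) = -1 \<and> ?c (snd I3) = 1) \<or> (?c (fst I3) = 1 \<and> ?c (snd I3) = -1)"
    using ends by (auto simp: doubleton_eq_iff)
  show "Im (?c (fst I1)) \<noteq> 0" "Im (?c (fst I2)) \<noteq> 0" "Re (?c (fst I3)) \<noteq> 0"
    using ends1(1) ends2(1) e3 by auto
  have ga: "?g (fst I3) = - Re (?c (fst I3))" using e3 by auto
  have "r2 < r1 \<longleftrightarrow> ?g r2 * ?g (fst I3) > 0"
  proof (rule sign_before_zero[OF cont(2)])
    show "?g (fst I3) * ?g (snd I3) < 0" using e3 by auto
    show "r2 \<in> {fst I3..snd I3}" using pts by auto
    show "?g r2 \<noteq> 0" using gr2 nz by simp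
    \<comment> \<open>A zero lies on the diagonal, which strand 1 fills inside the disk. So it is a
      crossing of strands 3 and 1, and in the list of crossings only \<open>r1\<close>
      remains.\<close>
    fix u assume u: "u \<in> {fst I3..snd I3}" "?g u = 0"
    have u3: "u \<in> closed_strand I3" using u(1) by (rule in3)
    then have "norm (?c u) \<le> 1" using tangle_cball[OF T, of u] by auto
    then have "\<exists>t\<in>{fst I1..snd I1}. ?c t = ?c u" using ends1(2)[of "?c u"] u(2) by auto
    then obtain t where t: "t \<in> {fst I1..snd I1}" "?c u = ?c t" by auto
    have "double_point ?c u t" using u3 in1[OF t(1)] disj(2) t(2) by (intro dpair[of u I3 t I1]) auto
    then have "mark D u \<noteq> Plain" using plain_iff[OF D] by blast
    then have "u \<in> {p1, p2, q1, q2, r1, r2}" using plain u(1) unfolding plain_on_def by blast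
    moreover have "u \<noteq> p1" "u \<noteq> p2" "u \<noteq> q1" "u \<noteq> q2" using u3 mem disj by blast+
    moreover have "u \<noteq> r2" using u(2) gr2 nz by auto
    ultimately show "u = r1" by blast
  qed
  also have "?g r2 * ?g (fst I3) = 2 * (Im (?c q2) * - Re (?c (fst I3)))"
    unfolding gr2 ga by simp
  finally show "r2 < r1 \<longleftrightarrow> Im (?c q2) * - Re (?c (fst I3)) > 0" by simp
qed

section \<open>Type III moves, real and virtual\<close>

text \<open>The crossings of the moving strand are virtual, so the only possible real ends in the
  disk are \<open>p1\<close> and \<open>p2\<close>, which lie on the unchanged diagonals. This
  treats VRIII and VRIV together.\<close>

lemma strand_move_virtual_odd_number:
  assumes D: "virtual_diagram D" and E: "virtual_diagram E"
    and K: "\<And>p1 p2 q1 q2 r1 r2. K p1 p2 q1 q2 r1 r2 \<Longrightarrow> {q1, q2, r1, r2} = {Virtual}"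
    and m: "strand_moved_across K D E"
  shows "odd_number E = odd_number D"
proof -
  obtain I1 I2 I3 p1 p2 q1 q2 r1 r2 q1' q2' r1' r2' where
    lc: "local_change [I1, I2, I3] D E"
    and d1: "\<forall>t \<in> {fst I1..snd I1}. curve E t = curve D t \<and> Im (curve D t) = Re (curve D t)"
    and d2: "\<forall>t \<in> {fst I2..snd I2}. curve E t = curve D t \<and> Im (curve D t) = - Re (curve D t)"
    and tD: "triple_crossing D I1 I2 I3 p1 p2 q1 q2 r1 r2"
    and tE: "triple_crossing E I1 I2 I3 p1 p2 q1' q2' r1' r2'"
    and mk: "mark E p1 = mark D p1" "mark E p2 = mark D p2"
      "mark E q1' = mark D q1" "mark E q2' = mark D q2"
      "mark E r1' = mark D r1" "mark E r2' = mark D r2"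
    and KD: "K (mark D p1) (mark D p2) (mark D q1) (mark D q2) (mark D r1) (mark D r2)"
    using m unfolding strand_moved_across_def by metis
  have virt: "mark D q1 = Virtual" "mark D q2 = Virtual" "mark D r1 = Virtual" "mark D r2 = Virtual"
    using K[OF KD] by blast+
  have virtE: "mark E q1' = Virtual" "mark E q2' = Virtual" "mark E r1' = Virtual" "mark E r2' = Virtual"
    using virt mk by simp_all
  let ?A = "{fst I1..snd I1} \<union> {fst I2..snd I2} \<union> {fst I3..snd I3}"
  define S where "S = closed_strand I1 \<union> closed_strand I2 \<union> closed_strand I3"
  have out: "t \<notin> S \<Longrightarrow> curve E t = curve D t \<and> mark E t = mark D t" for t
    using local_change_outside[OF lc] by (auto simp: S_def)
  have Dv: "v \<in> {p1, p2}" if "v \<in> ?A" "v \<in> real_points D" for v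
  proof -
    have "mark D v \<noteq> Plain" "mark D v \<noteq> Virtual" using that(2) by (auto simp: real_points_def)
    then have "v \<in> {p1, p2, q1, q2, r1, r2}" "v \<noteq> q1" "v \<noteq> q2" "v \<noteq> r1" "v \<noteq> r2"
      using tD that(1) virt unfolding triple_crossing_def plain_on_def by blast+
    then show ?thesis by blast
  qed
  have Ev: "v \<in> {p1, p2}" if "v \<in> ?A" "v \<in> real_points E" for v
  proof -
    have "mark E v \<noteq> Plain" "mark E v \<noteq> Virtual" using that(2) by (auto simp: real_points_def)
    then have "v \<in> {p1, p2, q1', q2', r1', r2'}" "v \<noteq> q1'" "v \<noteq> q2'" "v \<noteq> r1'" "v \<noteq> r2'"
      using tE that(1) virtE unfolding triple_crossing_def plain_on_def by blast+
    then show ?thesis by blast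
  qed
  have cp: "curve E p1 = curve D p1" "curve E p2 = curve D p2"
    using d1 d2 tD unfolding triple_crossing_def by auto
  have inS: "(u \<in> real_points E \<longleftrightarrow> u \<in> real_points D) \<and>
      (u \<in> real_points D \<longrightarrow> curve E u = curve D u)" if u: "u \<in> S" for u
  proof -
    obtain v where v: "v \<in> ?A" "u - v \<in> \<int>"
      using u unfolding S_def by (metis UnE UnI1 UnI2 closed_strandE)
    have "v \<in> real_points E \<longleftrightarrow> v \<in> real_points D"
      using Dv[OF v(1)] Ev[OF v(1)] mk unfolding real_points_def by auto
    moreover have "v \<in> real_points D \<Longrightarrow> curve E v = curve D v"
      using Dv[OF v(1)] cp by auto
    ultimately show ?thesis
      using real_points_Ints[OF D v(2)] real_points_Ints[OF E v(2)]
        curve_Ints[OF D v(2)] curve_Ints[OF E v(2)] by simp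
  qed
  have "u \<in> real_points E \<longleftrightarrow> u \<in> real_points D" for u
  proof (cases "u \<in> S")
    case False
    then show ?thesis using out[OF False] by (simp add: real_points_def)
  qed (use inS in blast)
  then have "real_points E = real_points D" by blast
  then show ?thesis using out inS
    by (intro odd_number_same_real_points[OF D E]) blast+
qed

text \<open>Ends on different strands are incongruent because the strands are disjoint, ends on one
  strand because it is shorter than a period. Uniqueness of partners excludes all pairs except the
  three crossings.\<close>

lemma triple_crossing_reps:
  assumes D: "virtual_diagram D" and T: "tangle D [I1, I2, I3]"
    and tc: "triple_crossing D I1 I2 I3 p1 p2 q1 q2 r1 r2"
    and ne: "q1 \<noteq> p1" "q2 \<noteq> p2" "r2 \<noteq> r1"
    and real: "{mark D p1, mark D p2, mark D q1, mark D q2, mark D r1, mark D r2} \<subseteq> {Over, Under}"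
  defines "Z \<equiv> {p1, p2, q1, q2, r1, r2}"
    and "S \<equiv> closed_strand I1 \<union> closed_strand I2 \<union> closed_strand I3"
  shows "reps (real_points D \<inter> S) Z" "distinct [p1, p2, q1, q2, r1, r2]"
    and "\<And>x y. x \<in> Z \<Longrightarrow> y \<in> Z \<Longrightarrow> double_point (curve D) x y \<longleftrightarrow>
      (x, y) \<in> {(p1, p2), (p2, p1), (q1, r1), (r1, q1), (q2, r2), (r2, q2)}"
proof -
  let ?c = "curve D"
  have pts: "p1 \<in> {fst I1<..<snd I1}" "q1 \<in> {fst I1<..<snd I1}"
     "p2 \<in> {fst I2<..<snd I2}" "q2 \<in> {fst I2<..<snd I2}"
     "r1 \<in> {fst I3<..<snd I3}" "r2 \<in> {fst I3<..<snd I3}"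
    and eq: "?c p1 = ?c p2" "?c q1 = ?c r1" "?c q2 = ?c r2"
    and plain: "plain_on D (({fst I1..snd I1} \<union> {fst I2..snd I2} \<union> {fst I3..snd I3})
                 - {p1, p2, q1, q2, r1, r2})"
    using tc unfolding triple_crossing_def by blast+
  have disj: "closed_strand I1 \<inter> closed_strand I2 = {}" "closed_strand I1 \<inter> closed_strand I3 = {}"
    "closed_strand I2 \<inter> closed_strand I3 = {}"
    using tangle_disjoint[OF T, of 0 1] tangle_disjoint[OF T, of 0 2] tangle_disjoint[OF T, of 1 2]
    by simp_all
  have mem: "p1 \<in> closed_strand I1" "q1 \<in> closed_strand I1" "p2 \<in> closed_strand I2"
    "q2 \<in> closed_strand I2" "r1 \<in> closed_strand I3" "r2 \<in> closed_strand I3"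
    using pts by (auto intro!: closed_strandI')
  have far: "u - v \<notin> \<int>" "v - u \<notin> \<int>" if "u \<in> closed_strand I" "v \<in> closed_strand J"
    "closed_strand I \<inter> closed_strand J = {}" for u v I J
    using that closed_strand_Ints[of u I v] closed_strand_Ints[of v J u] by auto
  have near: "u - v \<notin> \<int>" "v - u \<notin> \<int>"
    if "u \<in> {fst I<..<snd I}" "v \<in> {fst I<..<snd I}" "I \<in> {I1, I2, I3}" "u \<noteq> v" for u v I
  proof -
    have "\<bar>u - v\<bar> < 1" "\<bar>v - u\<bar> < 1" using that tangle_bounds[OF T, of I] by auto
    then show "u - v \<notin> \<int>" "v - u \<notin> \<int>"
      using Ints_abs_less_1[of "u - v"] Ints_abs_less_1[of "v - u"] that(4) by auto
  qed
  note nint = far[OF mem(1) mem(3) disj(1)] far[OF mem(1) mem(4) disj(1)]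
    far[OF mem(2) mem(3) disj(1)] far[OF mem(2) mem(4) disj(1)]
    far[OF mem(1) mem(5) disj(2)] far[OF mem(1) mem(6) disj(2)]
    far[OF mem(2) mem(5) disj(2)] far[OF mem(2) mem(6) disj(2)]
    far[OF mem(3) mem(5) disj(3)] far[OF mem(3) mem(6) disj(3)]
    far[OF mem(4) mem(5) disj(3)] far[OF mem(4) mem(6) disj(3)]
    near[OF pts(2) pts(1) _ ne(1), simplified] near[OF pts(4) pts(3) _ ne(2), simplified]
    near[OF pts(6) pts(5) _ ne(3), simplified]
  show dist: "distinct [p1, p2, q1, q2, r1, r2]"
    using nint by auto
  have inj: "x = y" if "x \<in> Z" "y \<in> Z" "x - y \<in> \<int>" for x y
    using that nint unfolding Z_def by auto
  show "reps (real_points D \<inter> S) Z"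
  proof (rule repsI[OF _ _ _ inj])
    show "finite Z" by (simp add: Z_def)
    show "Z \<subseteq> real_points D \<inter> S"
      using mem real by (auto simp: Z_def S_def real_points_def)
    fix u assume u: "u \<in> real_points D \<inter> S"
    then obtain v where v: "v \<in> {fst I1..snd I1} \<union> {fst I2..snd I2} \<union> {fst I3..snd I3}" "u - v \<in> \<int>"
      unfolding S_def by (metis IntE UnE UnI1 UnI2 closed_strandE)
    then have "v \<in> real_points D" using u real_points_Ints[OF D v(2)] by blast
    then have "mark D v \<noteq> Plain" by (auto simp: real_points_def)
    then have "v \<in> Z" using plain v(1) unfolding plain_on_def Z_def by blast
    then show "\<exists>z\<in>Z. u - z \<in> \<int>" using v(2) by blast
  qed
  fix x y assume xy: "x \<in> Z" "y \<in> Z"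
  let ?P = "{(p1, p2), (p2, p1), (q1, r1), (r1, q1), (q2, r2), (r2, q2)}"
  have P: "double_point ?c u v" if "(u, v) \<in> ?P" for u v
    using that eq nint by (auto simp: double_point_def)
  have "\<exists>v\<in>Z. (x, v) \<in> ?P" using xy(1) unfolding Z_def by blast
  then obtain v where v: "v \<in> Z" "(x, v) \<in> ?P" by blast
  show "double_point ?c x y \<longleftrightarrow> (x, y) \<in> ?P"
  proof
    assume "double_point ?c x y"
    then have "y - v \<in> \<int>" using P[OF v(2)] double_point_unique[OF D] by blast
    then show "(x, y) \<in> ?P" using inj[OF xy(2) v(1)] v(2) by simp
  qed (rule P)
qed

lemma ceiling_close: "\<bar>x - y\<bar> < 1 \<Longrightarrow> x \<noteq> y \<Longrightarrow> \<lceil>x - y\<rceil> = (if x < y then 0 else 1)"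
  for x y :: real
  by (auto simp: ceiling_eq_iff)

text \<open>Every one of the six ends changes its height by an odd number, from the reversal on its
  own strand, while all other contributions are constant. Along a chord the two odd changes cancel
  modulo 2.\<close>

lemma real_strand_move_odd_number:
  assumes D: "virtual_diagram D" and E: "virtual_diagram E"
    and m: "strand_moved_across real_layered D E"
  shows "odd_number E = odd_number D"
proof -
  obtain I1 I2 I3 p1 p2 q1 q2 r1 r2 q1' q2' r1' r2' where
    lc: "local_change [I1, I2, I3] D E"
    and d1: "\<forall>t \<in> {fst I1..snd I1}. curve E t = curve D t \<and> Im (curve D t) = Re (curve D t)"
    and d2: "\<forall>t \<in> {fst I2..snd I2}. curve E t = curve D t \<and> Im (curve D t) = - Re (curve D t)"
    and ends: "{curve D (fst I3), curve D (snd I3)} = {-1, 1}"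
    and tD: "triple_crossing D I1 I2 I3 p1 p2 q1 q2 r1 r2"
    and tE: "triple_crossing E I1 I2 I3 p1 p2 q1' q2' r1' r2'"
    and im: "Im (curve D q1) > 0" "Im (curve D q2) > 0" "Im (curve E q1') < 0" "Im (curve E q2') < 0"
    and mk: "mark E p1 = mark D p1" "mark E p2 = mark D p2"
      "mark E q1' = mark D q1" "mark E q2' = mark D q2"
      "mark E r1' = mark D r1" "mark E r2' = mark D r2"
    and KD: "real_layered (mark D p1) (mark D p2) (mark D q1) (mark D q2) (mark D r1) (mark D r2)"
    using m unfolding strand_moved_across_def by metis
  note TD = local_change_tangle(1)[OF lc] and TE = local_change_tangle(2)[OF lc]
  define S where "S = closed_strand I1 \<union> closed_strand I2 \<union> closed_strand I3"
  define Z where "Z = {p1, p2, q1, q2, r1, r2}"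
  define f where "f = id(q1 := q1', q2 := q2', r1 := r1', r2 := r2')"
  have UN: "(\<Union>I\<in>set [I1, I2, I3]. closed_strand I) = S" by (auto simp: S_def)
  have bounds: "fst I < snd I" "snd I < fst I + 1" if "I \<in> {I1, I2, I3}" for I
    using tangle_bounds[OF TD, of I] that by auto
  \<comment> \<open>The ends of strand 3 are on the circle, hence in no open strand, and are
    therefore common to \<open>D\<close> and \<open>E\<close>.\<close>
  have "t \<notin> open_strand I" if "t = fst I3 \<or> t = snd I3" "I \<in> {I1, I2, I3}" for t I
  proof
    assume "t \<in> open_strand I"
    then have "curve D t \<in> ball 0 1" using TD that(2) unfolding tangle_def by auto
    then show False using tangle_endpoint_norm[OF TD, of I3 t] that(1) by auto
  qed
  then have same3: "curve E (fst I3) = curve D (fst I3)" "curve E (snd I3) = curve D (snd I3)"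
    using lc unfolding local_change_def by auto
  have same12: "curve E (fst I1) = curve D (fst I1)" "curve E (fst I2) = curve D (fst I2)"
    using d1 d2 bounds[of I1] bounds[of I2] by auto
  note oD = crossing_orders[OF D TD tD _ _ ends]
  have endsE: "{curve E (fst I3), curve E (snd I3)} = {-1, 1}" using ends same3 by simp
  note oE = crossing_orders[OF E TE tE _ _ endsE]
  have oD: "q1 \<noteq> p1" "q1 < p1 \<longleftrightarrow> Im (curve D q1) * Im (curve D (fst I1)) > 0"
    "q2 \<noteq> p2" "q2 < p2 \<longleftrightarrow> Im (curve D q2) * Im (curve D (fst I2)) > 0"
    "r2 \<noteq> r1" "r2 < r1 \<longleftrightarrow> Im (curve D q2) * - Re (curve D (fst I3)) > 0"
    "Im (curve D (fst I1)) \<noteq> 0" "Im (curve D (fst I2)) \<noteq> 0" "Re (curve D (fst I3)) \<noteq> 0"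
    using im d1 d2 by (intro oD; simp)+
  have oE: "q1' \<noteq> p1" "q1' < p1 \<longleftrightarrow> Im (curve E q1') * Im (curve D (fst I1)) > 0"
    "q2' \<noteq> p2" "q2' < p2 \<longleftrightarrow> Im (curve E q2') * Im (curve D (fst I2)) > 0"
    "r2' \<noteq> r1'" "r2' < r1' \<longleftrightarrow> Im (curve E q2') * - Re (curve D (fst I3)) > 0"
    unfolding same12[symmetric] same3[symmetric] using im d1 d2 by (intro oE; simp)+
  \<comment> \<open>The imaginary part at the crossing changes sign while the ends of the strands
    stay, so each order is reversed.\<close>
  have flip1: "q1' < p1 \<longleftrightarrow> p1 < q1"
    using oD(1,2,7) oE(2) im(1,3) by (auto simp: zero_less_mult_iff not_less)
  have flip2: "q2' < p2 \<longleftrightarrow> p2 < q2"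
    using oD(3,4,8) oE(4) im(2,4) by (auto simp: zero_less_mult_iff not_less)
  have flip3: "r2' < r1' \<longleftrightarrow> r1 < r2"
    using oD(5,6,9) oE(6) im(2,4) by (auto simp: zero_less_mult_iff mult_less_0_iff not_less)
  have realD: "{mark D p1, mark D p2, mark D q1, mark D q2, mark D r1, mark D r2} \<subseteq> {Over, Under}"
    using KD unfolding real_layered_def by blast
  then have realE: "{mark E p1, mark E p2, mark E q1', mark E q2', mark E r1', mark E r2'} \<subseteq> {Over, Under}"
    unfolding mk .
  note rD = triple_crossing_reps[OF D TD tD oD(1,3,5) realD, folded S_def Z_def]
  note rE = triple_crossing_reps[OF E TE tE oE(1,3,5) realE, folded S_def]
  have distD: "distinct [p1, p2, q1, q2, r1, r2]" and distE: "distinct [p1, p2, q1', q2', r1', r2']"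
    using rD(2) rE(2) by blast+
  have f: "f p1 = p1" "f p2 = p2" "f q1 = q1'" "f q2 = q2'" "f r1 = r1'" "f r2 = r2'"
    using distD by (auto simp: f_def)
  have fZ: "f ` Z = {p1, p2, q1', q2', r1', r2'}" unfolding Z_def by (simp add: f)
  have pts: "p1 \<in> {fst I1..snd I1}" "q1 \<in> {fst I1..snd I1}" "q1' \<in> {fst I1..snd I1}"
     "p2 \<in> {fst I2..snd I2}" "q2 \<in> {fst I2..snd I2}" "q2' \<in> {fst I2..snd I2}"
     "r1 \<in> {fst I3..snd I3}" "r2 \<in> {fst I3..snd I3}" "r1' \<in> {fst I3..snd I3}" "r2' \<in> {fst I3..snd I3}"
    using tD tE unfolding triple_crossing_def by auto
  have disj: "closed_strand I1 \<inter> closed_strand I2 = {}" "closed_strand I1 \<inter> closed_strand I3 = {}"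
    "closed_strand I2 \<inter> closed_strand I3 = {}"
    using tangle_disjoint[OF TD, of 0 1] tangle_disjoint[OF TD, of 0 2] tangle_disjoint[OF TD, of 1 2]
    by simp_all
  have cc: "\<lceil>x - y\<rceil> = \<lceil>x' - y'\<rceil>" if "closed_strand I \<inter> closed_strand J = {}"
    "x \<in> {fst I..snd I}" "x' \<in> {fst I..snd I}" "y \<in> {fst J..snd J}" "y' \<in> {fst J..snd J}"
    for x x' y y' I J
    using ceiling_diff_const[of "fst I" "snd I" "fst J" "snd J" x x' y y'] that by simp
  have disj': "closed_strand I2 \<inter> closed_strand I1 = {}" "closed_strand I3 \<inter> closed_strand I1 = {}"
    "closed_strand I3 \<inter> closed_strand I2 = {}"
    using disj by blast+
  have hD: "height Z u = \<lceil>u - p1\<rceil> + \<lceil>u - p2\<rceil> + \<lceil>u - q1\<rceil> + \<lceil>u - q2\<rceil> + \<lceil>u - r1\<rceil> + \<lceil>u - r2\<rceil>" for u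
    unfolding height_def Z_def using distD by simp
  have hE: "height (f ` Z) u =
      \<lceil>u - p1\<rceil> + \<lceil>u - p2\<rceil> + \<lceil>u - q1'\<rceil> + \<lceil>u - q2'\<rceil> + \<lceil>u - r1'\<rceil> + \<lceil>u - r2'\<rceil>" for u
    unfolding height_def fZ using distE by simp
  have cl: "\<lceil>x - y\<rceil> = (if x < y then 0 else 1)"
    if "I \<in> {I1, I2, I3}" "x \<in> {fst I..snd I}" "y \<in> {fst I..snd I}" "x \<noteq> y" for x y I
    using that bounds[OF that(1)] by (intro ceiling_close) auto
  have out: "curve E t = curve D t \<and> mark E t = mark D t" if "t \<notin> S" for t
    using local_change_outside[OF lc] that unfolding UN by blast
  show ?thesis
  proof (rule odd_number_replace[OF D E _ out _ _ rD(1)])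
    show "t \<in> S" if "s \<in> S" "s - t \<in> \<int>" for s t
      using that closed_strand_Ints[of s _ t] unfolding S_def by blast
    show "curve D s \<noteq> curve D t" if "s \<in> S" "t \<notin> S" for s t
      using that tangle_cball[OF TD, of s] tangle_cball[OF TD, of t] unfolding UN by auto
    show "curve E s \<noteq> curve E t" if "s \<in> S" "t \<notin> S" for s t
      using that tangle_cball[OF TE, of s] tangle_cball[OF TE, of t] unfolding UN by auto
    show "reps (real_points E \<inter> S) (f ` Z)" unfolding fZ by (rule rE(1))
    have inj: "inj_on f Z" unfolding Z_def inj_on_def using distD distE f by auto
    then show "inj_on f Z" .
    show "double_point (curve E) (f x) (f y) \<longleftrightarrow> double_point (curve D) x y" if xy: "x \<in> Z" "y \<in> Z" for x y
    proof -
      have f_xy: "f x \<in> {p1, p2, q1', q2', r1', r2'}" "f y \<in> {p1, p2, q1', q2', r1', r2'}"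
        using xy fZ by blast+
      let ?P = "{(p1, p2), (p2, p1), (q1, r1), (r1, q1), (q2, r2), (r2, q2)}"
      have "{(p1, p2), (p2, p1), (q1', r1'), (r1', q1'), (q2', r2'), (r2', q2')} = map_prod f f ` ?P"
        by (simp add: f)
      moreover have "?P \<subseteq> Z \<times> Z" by (simp add: Z_def)
      moreover have "inj_on (map_prod f f) (Z \<times> Z)" using inj inj by (rule map_prod_inj_on)
      moreover have "(x, y) \<in> Z \<times> Z" using xy by blast
      ultimately show ?thesis unfolding rD(3)[OF xy] rE(3)[OF f_xy]
        using inj_on_image_mem_iff[of "map_prod f f" "Z \<times> Z" "(x, y)" ?P] by simp
    qed
    show "even (height (f ` Z) x - height Z x)" if x: "x \<notin> S" for x
    proof -
      have "x \<notin> closed_strand (fst I1, snd I1)" "x \<notin> closed_strand (fst I2, snd I2)"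
        "x \<notin> closed_strand (fst I3, snd I3)" using x by (auto simp: S_def)
      then have "\<lceil>x - q1'\<rceil> = \<lceil>x - q1\<rceil>" "\<lceil>x - q2'\<rceil> = \<lceil>x - q2\<rceil>" "\<lceil>x - r1'\<rceil> = \<lceil>x - r1\<rceil>" "\<lceil>x - r2'\<rceil> = \<lceil>x - r2\<rceil>"
        by (blast intro: ceiling_diff_const_point(1) pts)+
      then show ?thesis unfolding hD hE by simp
    qed
    show "\<lceil>f z - x\<rceil> = \<lceil>z - x\<rceil>" if x: "x \<notin> S" and z: "z \<in> Z" for x z
    proof -
      have "x \<notin> closed_strand (fst I1, snd I1)" "x \<notin> closed_strand (fst I2, snd I2)"
        "x \<notin> closed_strand (fst I3, snd I3)" using x by (auto simp: S_def)
      then have "\<lceil>q1' - x\<rceil> = \<lceil>q1 - x\<rceil>" "\<lceil>q2' - x\<rceil> = \<lceil>q2 - x\<rceil>" "\<lceil>r1' - x\<rceil> = \<lceil>r1 - x\<rceil>" "\<lceil>r2' - x\<rceil> = \<lceil>r2 - x\<rceil>"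
        by (blast intro: ceiling_diff_const_point(2) pts)+
      then show ?thesis using z unfolding Z_def by (auto simp: f)
    qed
    have odd: "odd (height (f ` Z) (f z) - height Z z)" if z: "z \<in> Z" for z
    proof -
      \<comment> \<open>Seen from a point of one strand, the ends on the other two contribute
        constants, wherever they have moved on their strands.\<close>
      have e1: "\<lceil>x' - p2\<rceil> + \<lceil>x' - q2'\<rceil> + \<lceil>x' - r1'\<rceil> + \<lceil>x' - r2'\<rceil> =
          \<lceil>x - p2\<rceil> + \<lceil>x - q2\<rceil> + \<lceil>x - r1\<rceil> + \<lceil>x - r2\<rceil>"
        if "x \<in> {fst I1..snd I1}" "x' \<in> {fst I1..snd I1}" for x x'
        by (intro arg_cong2[where f="(+)"] cc[OF disj(1) that(2,1)] cc[OF disj(2) that(2,1)] pts)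
      have e2: "\<lceil>x' - p1\<rceil> + \<lceil>x' - q1'\<rceil> + \<lceil>x' - r1'\<rceil> + \<lceil>x' - r2'\<rceil> =
          \<lceil>x - p1\<rceil> + \<lceil>x - q1\<rceil> + \<lceil>x - r1\<rceil> + \<lceil>x - r2\<rceil>"
        if "x \<in> {fst I2..snd I2}" "x' \<in> {fst I2..snd I2}" for x x'
        by (intro arg_cong2[where f="(+)"] cc[OF disj'(1) that(2,1)] cc[OF disj(3) that(2,1)] pts)
      have e3: "\<lceil>x' - p1\<rceil> + \<lceil>x' - q1'\<rceil> + \<lceil>x' - p2\<rceil> + \<lceil>x' - q2'\<rceil> =
          \<lceil>x - p1\<rceil> + \<lceil>x - q1\<rceil> + \<lceil>x - p2\<rceil> + \<lceil>x - q2\<rceil>"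
        if "x \<in> {fst I3..snd I3}" "x' \<in> {fst I3..snd I3}" for x x'
        by (intro arg_cong2[where f="(+)"] cc[OF disj'(2) that(2,1)] cc[OF disj'(3) that(2,1)] pts)
      \<comment> \<open>The order is reversed, so exactly one of the old and the new ceiling is 1.
        Hence the height changes by \<open>1 - 2 * n\<close>, where \<open>n\<close> is the old
        ceiling.\<close>
      have P1: "\<lceil>p1 - q1'\<rceil> + \<lceil>p1 - q1\<rceil> = 1" "\<lceil>q1' - p1\<rceil> + \<lceil>q1 - p1\<rceil> = 1"
        using cl[of I1 p1 q1'] cl[of I1 p1 q1] cl[of I1 q1' p1] cl[of I1 q1 p1] pts(1-3) oD(1) oE(1) flip1
        by auto
      have P2: "\<lceil>p2 - q2'\<rceil> + \<lceil>p2 - q2\<rceil> = 1" "\<lceil>q2' - p2\<rceil> + \<lceil>q2 - p2\<rceil> = 1"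
        using cl[of I2 p2 q2'] cl[of I2 p2 q2] cl[of I2 q2' p2] cl[of I2 q2 p2] pts(4-6) oD(3) oE(3) flip2
        by auto
      have P3: "\<lceil>r1' - r2'\<rceil> + \<lceil>r1 - r2\<rceil> = 1" "\<lceil>r2' - r1'\<rceil> + \<lceil>r2 - r1\<rceil> = 1"
        using cl[of I3 r1' r2'] cl[of I3 r1 r2] cl[of I3 r2' r1'] cl[of I3 r2 r1] pts(7-10) oD(5) oE(5) flip3
        by auto
      consider "z = p1" | "z = q1" | "z = p2" | "z = q2" | "z = r1" | "z = r2"
        using z unfolding Z_def by blast
      then have "\<exists>n. height (f ` Z) (f z) - height Z z = 1 - 2 * n"
      proof cases
        case 1
        have "height (f ` Z) (f z) - height Z z = 1 - 2 * \<lceil>p1 - q1\<rceil>"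
          using e1[OF pts(1,1)] P1(1) unfolding hD hE 1 f by simp
        then show ?thesis by blast
      next
        case 2
        have "height (f ` Z) (f z) - height Z z = 1 - 2 * \<lceil>q1 - p1\<rceil>"
          using e1[OF pts(2,3)] P1(2) unfolding hD hE 2 f by simp
        then show ?thesis by blast
      next
        case 3
        have "height (f ` Z) (f z) - height Z z = 1 - 2 * \<lceil>p2 - q2\<rceil>"
          using e2[OF pts(4,4)] P2(1) unfolding hD hE 3 f by simp
        then show ?thesis by blast
      next
        case 4
        have "height (f ` Z) (f z) - height Z z = 1 - 2 * \<lceil>q2 - p2\<rceil>"
          using e2[OF pts(5,6)] P2(2) unfolding hD hE 4 f by simp
        then show ?thesis by blast
      next
        case 5
        have "height (f ` Z) (f z) - height Z z = 1 - 2 * \<lceil>r1 - r2\<rceil>"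
          using e3[OF pts(7,9)] P3(1) unfolding hD hE 5 f by simp
        then show ?thesis by blast
      next
        case 6
        have "height (f ` Z) (f z) - height Z z = 1 - 2 * \<lceil>r2 - r1\<rceil>"
          using e3[OF pts(8,10)] P3(2) unfolding hD hE 6 f by simp
        then show ?thesis by blast
      qed
      then obtain n where n: "height (f ` Z) (f z) - height Z z = 1 - 2 * n" by blast
      show ?thesis unfolding n by simp
    qed
    show "even (height (f ` Z) (f x) - height (f ` Z) (f y)) \<longleftrightarrow> even (height Z x - height Z y)"
      if "x \<in> Z" "y \<in> Z" for x y
    proof -
      have "height (f ` Z) (f x) - height (f ` Z) (f y) = (height Z x - height Z y) +
          ((height (f ` Z) (f x) - height Z x) - (height (f ` Z) (f y) - height Z y))" by simp
      moreover have "even ((height (f ` Z) (f x) - height Z x) - (height (f ` Z) (f y) - height Z y))"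
        using odd[OF that(1)] odd[OF that(2)] by (simp only: even_diff even_add)
      ultimately show ?thesis by (simp only: even_add simp_thms)
    qed
  qed
qed

lemma non_RII_odd_number:
  assumes D: "virtual_diagram D" and E: "virtual_diagram E"
    and m: "reidemeister_move m D E" "m \<noteq> RII"
  shows "odd_number E = odd_number D"
proof -
  have "odd_number E = odd_number D"
    if "virtual_diagram D" "virtual_diagram E" "elementary_move m D E" for D E
  proof (cases m)
    case VRIII
    then have "strand_moved_across all_virtual D E" using that(3) by simp
    then show ?thesis
      by (rule strand_move_virtual_odd_number[OF that(1,2), rotated]) (auto simp: all_virtual_def)
  next
    case VRIV
    then have "strand_moved_across virtual_over_real D E" using that(3) by simp
    then show ?thesis
      by (rule strand_move_virtual_odd_number[OF that(1,2), rotated]) (auto simp: virtual_over_real_def)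
  qed (use that m(2) real_kink_odd_number virtual_kink_odd_number virtual_bigon_odd_number
      real_strand_move_odd_number in auto)
  then show ?thesis using D E m(1) unfolding reidemeister_move_def by metis
qed

lemma move_sequence_virtual:
  assumes "move_sequence D ms E"
  shows "virtual_diagram D \<and> virtual_diagram E"
  using assms by induction auto

lemma move_sequence_odd_number:
  assumes "move_sequence D ms E" "RII \<notin> set ms"
  shows "odd_number E = odd_number D"
  using assms
proof induction
  case (isotopy D ms E F)
  then show ?case using isotopic_odd_number[of E F] move_sequence_virtual[of D ms E] by auto
next
  case (move D ms E m F)
  then show ?case using non_RII_odd_number[of E F m] move_sequence_virtual[of D ms E] by auto
qed simp

section \<open>Changing a diagram near an arc\<close>

lemma closed_immersion_derivative:
  assumes "closed_immersion c"
  obtains c' where "\<And>t. (c has_vector_derivative c' t) (at t)" "continuous_on UNIV c'" "\<And>t. c' t \<noteq> 0"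
proof -
  have c1: "c C1_differentiable_on UNIV" and nz: "\<forall>t. vector_derivative c (at t) \<noteq> 0"
    using assms unfolding closed_immersion_def by blast+
  obtain c' where c': "\<And>t. (c has_vector_derivative c' t) (at t)" "continuous_on UNIV c'"
    using c1 unfolding C1_differentiable_on_def by blast
  moreover have "c' t \<noteq> 0" for t using nz vector_derivative_at[OF c'(1)] by metis
  ultimately show ?thesis using that by blast
qed

lemma closed_immersionI:
  assumes "\<And>t. c (t + 1) = c t" "\<And>t. (c has_vector_derivative c' t) (at t)"
    "continuous_on UNIV c'" "\<And>t. c' t \<noteq> 0"
  shows "closed_immersion c"
proof -
  have "vector_derivative c (at t) = c' t" for t using assms(2) by (rule vector_derivative_at)
  then show ?thesis
    unfolding closed_immersion_def C1_differentiable_on_def using assms by auto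
qed

lemma has_vector_derivative_affine:
  fixes c :: "real \<Rightarrow> 'a::real_normed_vector"
  assumes "(c has_vector_derivative v) (at (k * t + b))"
  shows "((\<lambda>t. c (k * t + b)) has_vector_derivative k *\<^sub>R v) (at t)"
proof -
  have "((\<lambda>t. k * t + b) has_vector_derivative k) (at t)"
    unfolding has_real_derivative_iff_has_vector_derivative[symmetric]
    by (auto intro!: derivative_eq_intros)
  from vector_diff_chain_at[OF this assms] show ?thesis by (simp add: o_def)
qed

lemma closed_immersion_vector_derivative:
  assumes "closed_immersion c"
  shows "(c has_vector_derivative vector_derivative c (at t)) (at t)"
  using closed_immersion_derivative[OF assms] vector_derivative_at by metis

lemma vector_derivative_periodic:
  assumes c: "closed_immersion c" and st: "s - t \<in> \<int>"
  shows "vector_derivative c (at s) = vector_derivative c (at t)"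
proof -
  obtain n where n: "s - t = of_int n" using st by (auto elim: Ints_cases)
  then have s: "s = t + of_int n" by simp
  have per: "\<forall>t. c (t + 1) = c t" using c unfolding closed_immersion_def by blast
  have "((\<lambda>t. c (t + of_int n)) has_vector_derivative vector_derivative c (at s)) (at t)"
    using has_vector_derivative_affine[of c _ 1 t "of_int n"] closed_immersion_vector_derivative[OF c, of s]
    unfolding s by simp
  then have "(c has_vector_derivative vector_derivative c (at s)) (at t)"
    by (simp add: periodic_int[OF per])
  then show ?thesis by (simp add: vector_derivative_at)
qed

lemma virtual_diagram_immersion: "virtual_diagram D \<Longrightarrow> closed_immersion (curve D)"
  by (simp add: virtual_diagram_def generic_curve_def)

lemma virtual_diagram_periodic:
  assumes "virtual_diagram D" shows "curve D (t + 1) = curve D t"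
  using virtual_diagram_immersion[OF assms] by (simp add: closed_immersion_def)

text \<open>Before and after the change, the curve is in the closed disk exactly for the parameters
  in \<open>S\<close>. So no crossing joins \<open>S\<close> to the rest, and everything outside is
  inherited from \<open>D\<close>. Inside, \<open>P\<close> lists the crossings by representatives
  modulo the integers, each in both orders because \<open>double_point\<close> is symmetric.\<close>

lemma virtual_diagram_replace:
  assumes D: "virtual_diagram D" and TD: "tangle D Is" and TE: "tangle E Is"
  defines "S \<equiv> (\<Union>I\<in>set Is. closed_strand I)"
  assumes out: "\<And>t. t \<notin> S \<Longrightarrow> curve E t = curve D t \<and> mark E t = mark D t"
    and plain: "\<And>t. t \<in> S \<Longrightarrow> mark D t = Plain"
    and imm: "closed_immersion (curve E)" and per: "\<And>t. mark E (t + 1) = mark E t"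
    and P: "finite P" "\<And>p q. (p, q) \<in> P \<Longrightarrow> p \<in> S \<and> q \<in> S"
      "\<And>p q p' q'. (p, q) \<in> P \<Longrightarrow> (p', q') \<in> P \<Longrightarrow> p - p' \<in> \<int> \<Longrightarrow> q - q' \<in> \<int>"
    and dp: "\<And>s t. s \<in> S \<Longrightarrow> t \<in> S \<Longrightarrow>
      double_point (curve E) s t \<longleftrightarrow> (\<exists>(p, q)\<in>P. s - p \<in> \<int> \<and> t - q \<in> \<int>)"
    and transversal: "\<And>p q. (p, q) \<in> P \<Longrightarrow>
      cross2 (vector_derivative (curve E) (at p)) (vector_derivative (curve E) (at q)) \<noteq> 0"
    and mP: "\<And>t. t \<in> S \<Longrightarrow> mark E t = Plain \<longleftrightarrow> \<not> (\<exists>(p, q)\<in>P. t - p \<in> \<int>)"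
    and mark: "\<And>p q. (p, q) \<in> P \<Longrightarrow>
      (mark E p, mark E q) \<in> {(Over, Under), (Under, Over), (Virtual, Virtual)}"
  shows "virtual_diagram E"
proof -
  have mI: "mark E s = mark E t" if "s - t \<in> \<int>" for s t
    using periodic_Ints[of "mark E" s t] per that by blast
  have ballD: "curve D t \<in> cball 0 1 \<longleftrightarrow> t \<in> S" for t using tangle_cball[OF TD] unfolding S_def .
  have ballE: "curve E t \<in> cball 0 1 \<longleftrightarrow> t \<in> S" for t using tangle_cball[OF TE] unfolding S_def .
  have mixE: "s \<in> S \<longleftrightarrow> t \<in> S" if "double_point (curve E) s t" for s t
    using ballE[of s] ballE[of t] that by (simp add: double_point_def)
  have mixD: "s \<in> S \<longleftrightarrow> t \<in> S" if "double_point (curve D) s t" for s t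
    using ballD[of s] ballD[of t] that by (simp add: double_point_def)
  have dpout: "double_point (curve E) s t \<longleftrightarrow> double_point (curve D) s t" if "s \<notin> S" for s t
  proof (cases "t \<in> S")
    case True
    then show ?thesis using mixE mixD that by blast
  next
    case False
    then show ?thesis using out that by (simp add: double_point_def)
  qed
  have dpin: "\<exists>p q. (p, q) \<in> P \<and> s - p \<in> \<int> \<and> t - q \<in> \<int>" if "double_point (curve E) s t" "s \<in> S" for s t
    using dp[of s t] mixE[OF that(1)] that by blast
  \<comment> \<open>The complement of \<open>S\<close> is open, so the agreement of the curves there
    passes to their derivatives.\<close>
  have "closed S"
  proof -
    have "S = curve D -` cball 0 1" using ballD by blast
    moreover have "closed (curve D -` cball 0 1)"
      using virtual_diagram_continuous[OF D, of UNIV]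
      by (intro continuous_closed_vimage) (auto simp: continuous_on_eq_continuous_at)
    ultimately show ?thesis by simp
  qed
  have vd: "vector_derivative (curve E) (at s) = vector_derivative (curve D) (at s)" if "s \<notin> S" for s
  proof -
    have "(curve D has_vector_derivative vector_derivative (curve D) (at s)) (at s)"
      using closed_immersion_vector_derivative[OF virtual_diagram_immersion[OF D]] .
    then have "(curve E has_vector_derivative vector_derivative (curve D) (at s)) (at s)"
      by (rule has_vector_derivative_transform_within_open[of _ _ _ "- S"])
        (use \<open>closed S\<close> that out in auto)
    then show ?thesis by (rule vector_derivative_at)
  qed
  have D': "finite {s \<in> {0..<1}. \<exists>t. double_point (curve D) s t}"
    "\<And>s t. double_point (curve D) s t \<Longrightarrow>
        cross2 (vector_derivative (curve D) (at s)) (vector_derivative (curve D) (at t)) \<noteq> 0"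
    using D unfolding virtual_diagram_def generic_curve_def by blast+
  have "{s \<in> {0..<1}. \<exists>t. double_point (curve E) s t} \<subseteq>
      {s \<in> {0..<1}. \<exists>t. double_point (curve D) s t} \<union> (\<lambda>(p, q). frac p) ` P"
  proof
    fix s assume "s \<in> {s \<in> {0..<1}. \<exists>t. double_point (curve E) s t}"
    then obtain t where t: "double_point (curve E) s t" and s: "s \<in> {0..<1}" by blast
    show "s \<in> {s \<in> {0..<1}. \<exists>t. double_point (curve D) s t} \<union> (\<lambda>(p, q). frac p) ` P"
    proof (cases "s \<in> S")
      case True
      then obtain p q where pq: "(p, q) \<in> P" "s - p \<in> \<int>" using dpin[OF t] by blast
      then have "frac p = s"
        using s Ints_sym[OF pq(2)] by (auto simp: frac_unique_iff)
      then show ?thesis using pq(1) by force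
    next
      case False
      then show ?thesis using dpout t s by blast
    qed
  qed
  then have fin: "finite {s \<in> {0..<1}. \<exists>t. double_point (curve E) s t}"
    using D'(1) P(1) by (meson finite_Un finite_imageI finite_subset)
  have "cross2 (vector_derivative (curve E) (at s)) (vector_derivative (curve E) (at t)) \<noteq> 0"
    if st: "double_point (curve E) s t" for s t
  proof (cases "s \<in> S")
    case True
    then obtain p q where pq: "(p, q) \<in> P" "s - p \<in> \<int>" "t - q \<in> \<int>" using dpin[OF st] by blast
    show ?thesis
      using transversal[OF pq(1)] vector_derivative_periodic[OF imm pq(2)]
        vector_derivative_periodic[OF imm pq(3)] by simp
  next
    case False
    then show ?thesis using D'(2)[of s t] dpout[OF False] vd[OF False] vd[of t] mixE[OF st] st by simp
  qed
  moreover have "t - u \<in> \<int>" if st: "double_point (curve E) s t" and su: "double_point (curve E) s u" for s t u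
  proof (cases "s \<in> S")
    case True
    obtain p q where pq: "(p, q) \<in> P" "s - p \<in> \<int>" "t - q \<in> \<int>" using dpin[OF st True] by blast
    obtain p' q' where pq': "(p', q') \<in> P" "s - p' \<in> \<int>" "u - q' \<in> \<int>" using dpin[OF su True] by blast
    have "p - p' \<in> \<int>" using pq(2) pq'(2) by (meson Ints_sym Ints_trans)
    then have "q - q' \<in> \<int>" using P(3) pq(1) pq'(1) by blast
    then show ?thesis using pq(3) pq'(3) by (meson Ints_sym Ints_trans)
  next
    case False
    then show ?thesis using st su dpout double_point_unique[OF D] by blast
  qed
  moreover have "mark E s = Plain \<longleftrightarrow> \<not> (\<exists>t. double_point (curve E) s t)" for s
  proof (cases "s \<in> S")
    case True
    have "(\<exists>t. double_point (curve E) s t) \<longleftrightarrow> (\<exists>(p, q)\<in>P. s - p \<in> \<int>)"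
    proof
      assume "\<exists>t. double_point (curve E) s t"
      then show "\<exists>(p, q)\<in>P. s - p \<in> \<int>" using dpin[OF _ True] by blast
    next
      assume "\<exists>(p, q)\<in>P. s - p \<in> \<int>"
      then obtain p q where pq: "(p, q) \<in> P" "s - p \<in> \<int>" by blast
      have "q \<in> S" using P(2) pq(1) by blast
      then show "\<exists>t. double_point (curve E) s t"
        using dp[OF True] pq by (intro exI[of _ q]) force
    qed
    then show ?thesis using mP[OF True] by blast
  next
    case False
    then show ?thesis using out dpout plain_iff[OF D] by simp
  qed
  moreover have "(mark E s, mark E t) \<in> {(Over, Under), (Under, Over), (Virtual, Virtual)}"
    if st: "double_point (curve E) s t" for s t
  proof (cases "s \<in> S")
    case True
    then obtain p q where pq: "(p, q) \<in> P" "s - p \<in> \<int>" "t - q \<in> \<int>" using dpin[OF st] by blast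
    show ?thesis using mark[OF pq(1)] mI[OF pq(2)] mI[OF pq(3)] by simp
  next
    case False
    then show ?thesis using out[OF False] out[of t] mixE[OF st] mark_double_point[OF D, of s t] dpout[OF False] st
      by simp
  qed
  ultimately show ?thesis
    using imm fin per unfolding virtual_diagram_def generic_curve_def by blast
qed

section \<open>Similarities of the plane\<close>

text \<open>A similarity together with a shift of the parameter: it brings a chosen disk to the unit
  disk and a chosen parameter to 0.\<close>

definition rescale :: "complex \<Rightarrow> complex \<Rightarrow> real \<Rightarrow> vdiag \<Rightarrow> vdiag" where
  "rescale a b r D = \<lparr>curve = (\<lambda>t. a * curve D (t + r) + b), mark = (\<lambda>t. mark D (t + r))\<rparr>"

text \<open>A logarithm \<open>w\<close> of \<open>a\<close> gives the path
  \<open>exp (t * w)\<close> of nonzero factors from 1 to \<open>a\<close>, so all intermediate maps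
  are similarities.\<close>

lemma isotopic_rescale:
  assumes "a \<noteq> 0"
  shows "isotopic D (rescale a b r D)"
proof -
  obtain w where w: "exp w = a" using assms exp_Ln by blast
  define H where "H t z = exp (of_real t * w) * z + of_real t * b" for t :: real and z
  have "bij (H t)" for t
    by (rule o_bij[of "\<lambda>z. (z - of_real t * b) / exp (of_real t * w)"]) (auto simp: H_def o_def)
  moreover have "continuous_on ({0..1} \<times> UNIV) (\<lambda>(t, z). H t z)"
    unfolding H_def split_beta by (intro continuous_intros)
  moreover have "bij ((*) (exp (of_real t * w)))" for t :: real
    by (rule o_bij[of "\<lambda>z. z / exp (of_real t * w)"]) (auto simp: o_def)
  moreover have "(H t has_derivative (*) (exp (of_real t * w))) (at z)" for t z
    unfolding H_def by (auto intro!: derivative_eq_intros)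
  moreover have "continuous_on ({0..1} \<times> UNIV) (\<lambda>(t :: real, z :: complex). exp (of_real t * w) * v)" for v
    unfolding split_beta by (intro continuous_intros)
  moreover have "H 0 = id" by (auto simp: H_def)
  ultimately have "plane_isotopy H"
    unfolding plane_isotopy_def by (intro conjI exI[of _ "\<lambda>t z. (*) (exp (of_real t * w))"]) auto
  moreover have "circle_reparam (\<lambda>t. t + r)"
  proof -
    have d: "((\<lambda>t. t + r) has_vector_derivative 1) (at t)" for t
      unfolding has_real_derivative_iff_has_vector_derivative[symmetric]
      by (auto intro!: derivative_eq_intros)
    show ?thesis
      unfolding circle_reparam_def C1_differentiable_on_def
      using d vector_derivative_at[OF d] by (auto intro!: exI[of _ "\<lambda>_. 1"])
  qed
  moreover have "H 1 = (\<lambda>z. a * z + b)" by (auto simp: H_def w)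
  ultimately show ?thesis
    unfolding isotopic_def rescale_def by (intro exI[of _ H] exI[of _ "\<lambda>t. t + r"]) (auto simp: o_def)
qed

lemma rescale_derivative:
  assumes "(curve D has_vector_derivative v) (at (t + r))"
  shows "(curve (rescale a b r D) has_vector_derivative a * v) (at t)"
proof -
  have "((\<lambda>t. curve D (t + r)) has_vector_derivative v) (at t)"
    using has_vector_derivative_affine[of "curve D" v 1 t r] assms by simp
  then show ?thesis
    unfolding rescale_def by (auto intro!: derivative_eq_intros has_vector_derivative_mult_right
      simp: has_vector_derivative_add_const)
qed

text \<open>Multiplication by \<open>a\<close> is a rotation and a scaling by \<open>norm a\<close>,
  so it multiplies areas by the square of this factor; for \<open>a \<noteq> 0\<close>
  transversality is preserved.\<close>

lemma cross2_mult: "cross2 (a * v) (a * w) = (norm a)\<^sup>2 * cross2 v w"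
  unfolding cross2_def cmod_power2 by (simp add: algebra_simps power2_eq_square)

lemma virtual_diagram_rescale:
  assumes D: "virtual_diagram D" and a: "a \<noteq> 0"
  shows "virtual_diagram (rescale a b r D)"
proof -
  let ?E = "rescale a b r D"
  obtain c' where c': "\<And>t. (curve D has_vector_derivative c' t) (at t)" "continuous_on UNIV c'" "\<And>t. c' t \<noteq> 0"
    using closed_immersion_derivative[OF virtual_diagram_immersion[OF D]] by blast
  have d: "(curve ?E has_vector_derivative a * c' (t + r)) (at t)" for t
    by (rule rescale_derivative[OF c'(1)])
  have vd: "vector_derivative (curve ?E) (at t) = a * c' (t + r)" for t
    by (rule vector_derivative_at[OF d])
  have vdD: "vector_derivative (curve D) (at t) = c' t" for t
    by (rule vector_derivative_at[OF c'(1)])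
  have imm: "closed_immersion (curve ?E)"
  proof (rule closed_immersionI[OF _ d])
    show "curve ?E (t + 1) = curve ?E t" for t
      using virtual_diagram_periodic[OF D, of "t + r"] by (simp add: rescale_def add_ac)
    show "continuous_on UNIV (\<lambda>t. a * c' (t + r))"
      by (intro continuous_intros continuous_on_compose2[OF c'(2)]) auto
    show "a * c' (t + r) \<noteq> 0" for t using a c'(3) by simp
  qed
  have dp: "double_point (curve ?E) s t \<longleftrightarrow> double_point (curve D) (s + r) (t + r)" for s t
    using a by (simp add: double_point_def rescale_def)
  have mk: "mark ?E t = mark D (t + r)" for t by (simp add: rescale_def)
  have "{s \<in> {0..<1}. \<exists>t. double_point (curve ?E) s t} \<subseteq>
      (\<lambda>s. frac (s - r)) ` {s \<in> {0..<1}. \<exists>t. double_point (curve D) s t}"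
  proof
    fix s assume "s \<in> {s \<in> {0..<1}. \<exists>t. double_point (curve ?E) s t}"
    then obtain t where s: "s \<in> {0..<1}" and t: "double_point (curve D) (s + r) (t + r)"
      by (auto simp: dp)
    obtain u where u: "u \<in> {0..<1}" "s + r - u \<in> \<int>" using ex_Ints_unit by blast
    then have "double_point (curve D) u (t + r)" using double_point_Ints[OF D u(2), of "t + r" "t + r"] t by simp
    moreover have "frac (u - r) = s"
      using s Ints_sym[OF u(2)] by (auto simp: frac_unique_iff algebra_simps)
    ultimately show "s \<in> (\<lambda>s. frac (s - r)) ` {s \<in> {0..<1}. \<exists>t. double_point (curve D) s t}"
      using u(1) by blast
  qed
  moreover have "finite {s \<in> {0..<1}. \<exists>t. double_point (curve D) s t}"
    using D unfolding virtual_diagram_def generic_curve_def by blast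
  ultimately have fin: "finite {s \<in> {0..<1}. \<exists>t. double_point (curve ?E) s t}"
    by (meson finite_imageI finite_subset)
  have tr: "cross2 (vector_derivative (curve ?E) (at s)) (vector_derivative (curve ?E) (at t)) \<noteq> 0"
    if "double_point (curve ?E) s t" for s t
  proof -
    have "cross2 (c' (s + r)) (c' (t + r)) \<noteq> 0"
      using D that unfolding dp virtual_diagram_def generic_curve_def vdD by blast
    then show ?thesis unfolding vd cross2_mult using a by simp
  qed
  have un: "t - u \<in> \<int>" if "double_point (curve ?E) s t" "double_point (curve ?E) s u" for s t u
    using double_point_unique[OF D, of "s + r" "t + r" "u + r"] that by (simp add: dp)
  have per: "mark ?E (t + 1) = mark ?E t" for t
    using mark_Ints[OF D, of "t + 1 + r" "t + r"] by (simp add: mk)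
  have pl: "mark ?E s = Plain \<longleftrightarrow> \<not> (\<exists>t. double_point (curve ?E) s t)" for s
  proof -
    have "(\<exists>t. double_point (curve D) (s + r) t) \<longleftrightarrow> (\<exists>t. double_point (curve D) (s + r) (t + r))"
      by (metis diff_add_cancel)
    then show ?thesis using plain_iff[OF D, of "s + r"] by (simp add: mk dp)
  qed
  have mm: "(mark ?E s, mark ?E t) \<in> {(Over, Under), (Under, Over), (Virtual, Virtual)}"
    if "double_point (curve ?E) s t" for s t
    using mark_double_point[OF D] that unfolding mk dp by blast
  show ?thesis
    using imm fin tr un per pl mm unfolding virtual_diagram_def generic_curve_def by blast
qed

section \<open>Periodic bumps, and tangles seen in one period\<close>

text \<open>\<open>round\<close> jumps at half integers, but the bump vanishes there since
  \<open>d < 1 / 2\<close>. Up to the distance \<open>1 - d\<close> from an integer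
  \<open>n\<close>, the nearest integer may be replaced by the fixed \<open>n\<close>. These open
  intervals cover the line, so the sum is C1.\<close>

lemma periodic_bump:
  fixes c g :: "real \<Rightarrow> complex"
  assumes c: "\<And>t. c (t + 1) = c t" "\<And>t. (c has_vector_derivative c' t) (at t)" "continuous_on UNIV c'"
    and g: "\<And>t. (g has_vector_derivative g' t) (at t)" "continuous_on UNIV g'"
    and supp: "\<And>t. d \<le> \<bar>t\<bar> \<Longrightarrow> g t = 0" and d: "d < 1 / 2"
    and h_def: "\<And>t. h t = c t + g (t - of_int (round t))"
    and h'_def: "\<And>t. h' t = c' t + g' (t - of_int (round t))"
  shows "h (t + 1) = h t" "(h has_vector_derivative h' t) (at t)" "continuous_on UNIV h'"
    and "\<And>n. \<bar>t - of_int n\<bar> < 1 - d \<Longrightarrow> h t = c t + g (t - of_int n)"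
proof -
  have rnd: "\<bar>t - of_int (round t)\<bar> \<le> 1 / 2" for t :: real
    using of_int_round_abs_le[of t] by (simp add: abs_minus_commute)
  have g'0: "g' t = 0" if "d < \<bar>t\<bar>" for t
  proof -
    have "(g has_vector_derivative 0) (at t)"
    proof (rule has_vector_derivative_transform_within_open[of "\<lambda>_. 0"])
      show "open {t. d < \<bar>t\<bar>}" by (intro open_Collect_less continuous_intros)
    qed (use that supp in auto)
    then show ?thesis using g(1) vector_derivative_at by metis
  qed
  \<comment> \<open>Two different integers are at least one apart, so \<open>t\<close> is farther
    than \<open>d\<close> from both and neither bump is felt.\<close>
  have other: "d < \<bar>t - of_int n\<bar> \<and> d < \<bar>t - of_int (round t)\<bar>" if "\<bar>t - of_int n\<bar> < 1 - d" "n \<noteq> round t" for t n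
  proof -
    have "\<bar>real_of_int n - of_int (round t)\<bar> \<ge> 1" using that(2) by linarith
    then show ?thesis using that(1) rnd[of t] d by linarith
  qed
  have h: "h t = c t + g (t - of_int n)" if "\<bar>t - of_int n\<bar> < 1 - d" for t n
  proof (cases "n = round t")
    case False
    then show ?thesis using other[OF that False] supp[of "t - of_int n"] supp[of "t - of_int (round t)"]
      by (simp add: h_def)
  qed (simp add: h_def)
  then show "\<And>n. \<bar>t - of_int n\<bar> < 1 - d \<Longrightarrow> h t = c t + g (t - of_int n)" .
  have h': "h' t = c' t + g' (t - of_int n)" if "\<bar>t - of_int n\<bar> < 1 - d" for t n
  proof (cases "n = round t")
    case False
    then show ?thesis using other[OF that False] g'0 by (simp add: h'_def)
  qed (simp add: h'_def)
  have op: "open {s. \<bar>s - of_int n\<bar> < 1 - d}" for n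
    by (intro open_Collect_less continuous_intros)
  have "round (t + 1) = round t + 1" unfolding round_def by linarith
  then show "h (t + 1) = h t" using c(1) by (simp add: h_def)
  have in_nbhd: "\<bar>t - of_int (round t)\<bar> < 1 - d" for t using rnd[of t] d by linarith
  have shift: "((\<lambda>t. g (t - of_int n)) has_vector_derivative g' (t - of_int n)) (at t)" for n t
    using has_vector_derivative_affine[of g _ 1 t "- of_int n"] g(1) by simp
  show "(h has_vector_derivative h' t) (at t)"
    using has_vector_derivative_transform_within_open[OF _ op[of "round t"], of "\<lambda>s. c s + g (s - of_int (round t))"
        "h' t" t h]
      has_vector_derivative_add[OF c(2)[of t] shift[of "round t" t]] in_nbhd[of t] h
    by (simp add: h'_def)
  show "continuous_on UNIV h'"
    unfolding continuous_on_eq_continuous_at[OF open_UNIV]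
  proof
    fix t :: real
    have "continuous_on {s. \<bar>s - of_int (round t)\<bar> < 1 - d} (\<lambda>s. c' s + g' (s - of_int (round t)))"
      by (intro continuous_intros continuous_on_compose2[OF g(2)] continuous_on_subset[OF c(3)]) auto
    then have "continuous_on {s. \<bar>s - of_int (round t)\<bar> < 1 - d} h'"
      by (rule continuous_on_eq) (simp add: h')
    then show "isCont h' t"
      using in_nbhd[of t] op continuous_on_eq_continuous_at by blast
  qed
qed

text \<open>By periodicity one period suffices. Strands strictly inside the window from
  \<open>- 1 / 2\<close> to \<open>1 / 2\<close> have parameters less than one apart, so disjoint
  intervals give disjoint strands on the circle.\<close>

lemma tangleI:
  assumes per: "\<And>t. curve D (t + 1) = curve D t"
    and Is: "\<And>a b. (a, b) \<in> set Is \<Longrightarrow> - (1 / 2) < a \<and> a < b \<and> b < 1 / 2"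
    and disj: "\<And>i j. i < length Is \<Longrightarrow> j < length Is \<Longrightarrow> i \<noteq> j \<Longrightarrow>
      {fst (Is ! i)..snd (Is ! i)} \<inter> {fst (Is ! j)..snd (Is ! j)} = {}"
    and closed: "\<And>t. \<bar>t\<bar> \<le> 1 / 2 \<Longrightarrow> norm (curve D t) \<le> 1 \<longleftrightarrow> (\<exists>I\<in>set Is. t \<in> {fst I..snd I})"
    and opn: "\<And>t. \<bar>t\<bar> \<le> 1 / 2 \<Longrightarrow> norm (curve D t) < 1 \<longleftrightarrow> (\<exists>I\<in>set Is. t \<in> {fst I<..<snd I})"
  shows "tangle D Is"
proof -
  have cI: "curve D (t + of_int n) = curve D t" for t n
    using periodic_int[of "curve D"] per by blast
  have small: "\<bar>t\<bar> < 1 / 2" if "I \<in> set Is" "t \<in> {fst I..snd I}" for I t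
    using Is[of "fst I" "snd I"] that by auto
  have rnd: "\<bar>t + of_int (- round t)\<bar> \<le> 1 / 2" for t :: real
    using of_int_round_abs_le[of t] by (simp add: abs_minus_commute)
  have c: "norm (curve D t) \<le> 1 \<longleftrightarrow> (\<exists>I\<in>set Is. t \<in> closed_strand I)" for t
  proof
    assume "norm (curve D t) \<le> 1"
    then have "norm (curve D (t + of_int (- round t))) \<le> 1" by (simp only: cI)
    then show "\<exists>I\<in>set Is. t \<in> closed_strand I"
      using closed[OF rnd[of t]] unfolding closed_strand_def by blast
  next
    assume "\<exists>I\<in>set Is. t \<in> closed_strand I"
    then obtain I n where I: "I \<in> set Is" "t + of_int n \<in> {fst I..snd I}"
      unfolding closed_strand_def by blast
    then have "norm (curve D (t + of_int n)) \<le> 1" using closed[of "t + of_int n"] small[OF I] by auto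
    then show "norm (curve D t) \<le> 1" by (simp only: cI)
  qed
  have o: "norm (curve D t) < 1 \<longleftrightarrow> (\<exists>I\<in>set Is. t \<in> open_strand I)" for t
  proof
    assume "norm (curve D t) < 1"
    then have "norm (curve D (t + of_int (- round t))) < 1" by (simp only: cI)
    then show "\<exists>I\<in>set Is. t \<in> open_strand I"
      using opn[OF rnd[of t]] unfolding open_strand_def by blast
  next
    assume "\<exists>I\<in>set Is. t \<in> open_strand I"
    then obtain I n where I: "I \<in> set Is" "t + of_int n \<in> {fst I<..<snd I}"
      unfolding open_strand_def by blast
    then have "norm (curve D (t + of_int n)) < 1" using opn[of "t + of_int n"] small[OF I(1), of "t + of_int n"] by auto
    then show "norm (curve D t) < 1" by (simp only: cI)
  qed
  have "closed_strand (Is ! i) \<inter> closed_strand (Is ! j) = {}"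
    if ij: "i < length Is" "j < length Is" "i \<noteq> j" for i j
  proof (rule ccontr)
    assume "closed_strand (Is ! i) \<inter> closed_strand (Is ! j) \<noteq> {}"
    then obtain t where t: "t \<in> closed_strand (Is ! i)" "t \<in> closed_strand (Is ! j)" by blast
    obtain u where u: "u \<in> {fst (Is ! i)..snd (Is ! i)}" "t - u \<in> \<int>" using t(1) closed_strandE by blast
    obtain v where v: "v \<in> {fst (Is ! j)..snd (Is ! j)}" "t - v \<in> \<int>" using t(2) closed_strandE by blast
    have "u - v \<in> \<int>" using u(2) v(2) by (meson Ints_sym Ints_trans)
    moreover have "\<bar>u - v\<bar> < 1" using small[OF nth_mem[OF ij(1)] u(1)] small[OF nth_mem[OF ij(2)] v(1)] by linarith
    ultimately have "u = v" using Ints_abs_less_1 by fastforce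
    then show False using u(1) v(1) disj[OF ij] by blast
  qed
  moreover have "\<forall>(a, b)\<in>set Is. a < b \<and> b < a + 1" using Is by fastforce
  moreover have "curve D -` cball 0 1 = (\<Union>I\<in>set Is. closed_strand I)"
    "curve D -` ball 0 1 = (\<Union>I\<in>set Is. open_strand I)" using c o by auto
  ultimately show ?thesis unfolding tangle_def by blast
qed

section \<open>The virtual kink\<close>

text \<open>The truncated square. Linear combinations of its translates are quadratic splines: they
  are C1, and their values and slopes are explicit on each piece.\<close>

definition posq :: "real \<Rightarrow> real" where
  "posq u = (max 0 u)\<^sup>2"

lemma posq_pos: "0 \<le> u \<Longrightarrow> posq u = u\<^sup>2" and posq_neg: "u \<le> 0 \<Longrightarrow> posq u = 0"
  by (auto simp: posq_def)

text \<open>A square is the sum of its two truncated halves. This reduces the symmetries of the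
  splines to polynomial identities.\<close>

lemma posq_minus: "posq (- u + k) = (u - k)\<^sup>2 - posq (u - k)"
  "posq (- u - k) = (u + k)\<^sup>2 - posq (u + k)" "posq (- u) = u\<^sup>2 - posq u"
  by (auto simp: posq_def max_def power2_eq_square algebra_simps)

lemma posq_nonneg: "0 \<le> posq u"
  by (simp add: posq_def)

lemma posq_le_1: "u \<le> 1 \<Longrightarrow> posq u \<le> 1"
  by (cases "u \<le> 0") (simp_all add: posq_pos posq_neg abs_square_le_1)

lemma DERIV_posq: "(posq has_real_derivative 2 * max 0 u) (at u)"
proof (cases u "0 :: real" rule: linorder_cases)
  case less
  have "(posq has_real_derivative 0) (at u)"
    by (rule has_field_derivative_transform_within_open[of "\<lambda>_. 0" 0 u "{..<0}"])
      (use less in \<open>auto simp: posq_def\<close>)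
  then show ?thesis using less by simp
next
  case greater
  have "(posq has_real_derivative 2 * u) (at u)"
    by (rule has_field_derivative_transform_within_open[of "\<lambda>u. u\<^sup>2" "2 * u" u "{0<..}"])
      (use greater in \<open>auto simp: posq_def intro!: derivative_eq_intros\<close>)
  then show ?thesis using greater by simp
next
  case equal
  have "((\<lambda>h. (posq h - posq 0) / h) \<longlongrightarrow> 0) (at 0)"
  proof (rule Lim_null_comparison)
    show "\<forall>\<^sub>F h in at 0. norm ((posq h - posq 0) / h) \<le> \<bar>h\<bar>"
      by (auto simp: posq_def max_def power2_eq_square eventually_at intro!: exI[of _ 1])
    show "((\<lambda>h :: real. \<bar>h\<bar>) \<longlongrightarrow> 0) (at 0)" by (auto intro!: tendsto_eq_intros)
  qed
  then show ?thesis using equal by (simp add: DERIV_def)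
qed

lemma DERIV_posq_chain [derivative_intros]:
  assumes "(f has_real_derivative f') (at u)"
  shows "((\<lambda>u. posq (f u)) has_real_derivative 2 * max 0 (f u) * f') (at u)"
  using DERIV_chain2[OF DERIV_posq assms] .

text \<open>
  The kink runs along the real axis, except for the parameters between \<open>-3\<close> and \<open>3\<close>. Its height
  is an even function, strictly decreasing in the absolute value of the parameter, and its abscissa
  is odd, so a double point has two opposite parameters at which the abscissa vanishes: \<open>-2\<close> and \<open>2\<close>.
  The part with parameters between \<open>1\<close> and \<open>2\<close> is a straight segment above the incoming ray.
\<close>

definition kink_height :: "real \<Rightarrow> real" where
  "kink_height u = (posq (u + 3) - posq (u + 2) - posq (u + 1) + posq (u - 1) + posq (u - 2) - posq (u - 3)) / 2"

definition kink_height' :: "real \<Rightarrow> real" where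
  "kink_height' u = max 0 (u + 3) - max 0 (u + 2) - max 0 (u + 1) + max 0 (u - 1) + max 0 (u - 2) - max 0 (u - 3)"

text \<open>The coefficients of the truncated squares are half the jumps of the second derivative.
  The slope rises from 1 to 5 between -3 and -2, falls from 5 at -1 to -15 at 0, is back at 5 at 1
  and returns to 1 between 2 and 3. The values at -2, -1, 0, 1, 2 are 0, 5, 0, -5, 0; the excursion
  to -5 carries the returning strand over the incoming ray.\<close>

definition kink_abscissa :: "real \<Rightarrow> real" where
  "kink_abscissa u = u + 2 * posq (u + 3) - 2 * posq (u + 2) - 10 * posq (u + 1) + 20 * posq u
     - 10 * posq (u - 1) - 2 * posq (u - 2) + 2 * posq (u - 3)"

definition kink_abscissa' :: "real \<Rightarrow> real" where
  "kink_abscissa' u = 1 + 4 * max 0 (u + 3) - 4 * max 0 (u + 2) - 20 * max 0 (u + 1) + 40 * max 0 u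
     - 20 * max 0 (u - 1) - 4 * max 0 (u - 2) + 4 * max 0 (u - 3)"

lemma DERIV_kink_height: "(kink_height has_real_derivative kink_height' u) (at u)"
  unfolding kink_height_def kink_height'_def
  by (rule derivative_eq_intros refl | simp)+

lemma DERIV_kink_abscissa: "(kink_abscissa has_real_derivative kink_abscissa' u) (at u)"
  unfolding kink_abscissa_def kink_abscissa'_def
  by (rule derivative_eq_intros refl | simp)+

lemma kink_height_minus: "kink_height (- u) = kink_height u"
  unfolding kink_height_def posq_minus by (simp add: power2_eq_square field_simps)

lemma kink_abscissa_minus: "kink_abscissa (- u) = - kink_abscissa u"
  unfolding kink_abscissa_def posq_minus by (simp add: power2_eq_square field_simps)

lemma kink_height_pieces:
  "0 \<le> u \<Longrightarrow> u \<le> 1 \<Longrightarrow> kink_height u = 2 - u\<^sup>2 / 2"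
  "1 \<le> u \<Longrightarrow> u \<le> 2 \<Longrightarrow> kink_height u = 5 / 2 - u"
  "2 \<le> u \<Longrightarrow> u \<le> 3 \<Longrightarrow> kink_height u = (3 - u)\<^sup>2 / 2"
  "3 \<le> u \<Longrightarrow> kink_height u = 0"
  unfolding kink_height_def
  by (simp_all add: posq_pos posq_neg power2_eq_square field_simps)

lemma kink_abscissa_pieces:
  "0 \<le> u \<Longrightarrow> u \<le> 1 \<Longrightarrow> kink_abscissa u = u - 4 * u * (4 - 5 / 2 * u)"
  "1 \<le> u \<Longrightarrow> u \<le> 2 \<Longrightarrow> kink_abscissa u = 5 * u - 10"
  "2 \<le> u \<Longrightarrow> u \<le> 3 \<Longrightarrow> kink_abscissa u = u - 2 * (3 - u)\<^sup>2"
  "3 \<le> u \<Longrightarrow> kink_abscissa u = u"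
  unfolding kink_abscissa_def
  by (simp_all add: posq_pos posq_neg power2_eq_square field_simps)

lemma kink_outside:
  assumes "3 \<le> \<bar>u\<bar>"
  shows "kink_height u = 0" "kink_abscissa u = u"
  using assms kink_height_pieces(4)[of "\<bar>u\<bar>"] kink_abscissa_pieces(4)[of "\<bar>u\<bar>"]
    kink_height_minus[of u] kink_abscissa_minus[of u] by (auto simp: abs_if split: if_splits)

lemma kink_derivative_pieces:
  "0 \<le> u \<Longrightarrow> u \<le> 1 \<Longrightarrow> kink_height' u = - u"
  "1 \<le> u \<Longrightarrow> u \<le> 2 \<Longrightarrow> kink_height' u = - 1"
  "2 \<le> u \<Longrightarrow> u \<le> 3 \<Longrightarrow> kink_height' u = u - 3"
  "-1 \<le> u \<Longrightarrow> u \<le> 0 \<Longrightarrow> kink_height' u = - u"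
  "-2 \<le> u \<Longrightarrow> u \<le> -1 \<Longrightarrow> kink_height' u = 1"
  "-3 \<le> u \<Longrightarrow> u \<le> -2 \<Longrightarrow> kink_height' u = u + 3"
  "3 \<le> \<bar>u\<bar> \<Longrightarrow> kink_height' u = 0"
  "3 \<le> \<bar>u\<bar> \<Longrightarrow> kink_abscissa' u = 1"
  "kink_abscissa' 0 = -15" "kink_abscissa' 2 = 5" "kink_abscissa' (-2) = 5"
  unfolding kink_height'_def kink_abscissa'_def by (auto simp: max_def abs_if split: if_splits)

lemma kink_abscissa'_middle: "1 \<le> u \<Longrightarrow> u \<le> 2 \<Longrightarrow> kink_abscissa' u = 5"
  unfolding kink_abscissa'_def by (simp add: max_def)

text \<open>The height has slope zero only at the top and outside the kink, and there the abscissa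
  has slope -15 and 1.\<close>

lemma kink_derivative_nonzero: "kink_height' u \<noteq> 0 \<or> kink_abscissa' u \<noteq> 0"
proof (cases "u = 0 \<or> 3 \<le> \<bar>u\<bar>")
  case True
  then show ?thesis using kink_derivative_pieces(8,9) by fastforce
next
  case False
  then consider "0 < u" "u \<le> 1" | "1 \<le> u" "u \<le> 2" | "2 \<le> u" "u < 3" | "-1 \<le> u" "u < 0"
    | "-2 \<le> u" "u \<le> -1" | "-3 < u" "u \<le> -2" by linarith
  then show ?thesis
    by cases (use kink_derivative_pieces(1-6)[of u] in auto)
qed

lemma kink_height_strict:
  assumes "0 \<le> u" "u < v" "v \<le> 3"
  shows "kink_height v < kink_height u"
proof (rule DERIV_neg_imp_decreasing_open[OF assms(2)])
  fix x assume x: "u < x" "x < v"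
  then have "0 < x" "x < 3" using assms by auto
  then have "kink_height' x < 0"
    using kink_derivative_pieces(1-3)[of x] by (cases "x \<le> 1"; cases "x \<le> 2") auto
  then show "\<exists>y. (kink_height has_real_derivative y) (at x) \<and> y < 0"
    using DERIV_kink_height by blast
next
  show "continuous_on {u..v} kink_height"
    using DERIV_kink_height by (meson DERIV_continuous continuous_at_imp_continuous_on)
qed

lemma kink_height_pos: "\<bar>u\<bar> < 3 \<Longrightarrow> kink_height u > 0"
  using kink_height_strict[of "\<bar>u\<bar>" 3] kink_height_pieces(4)[of 3] kink_height_minus[of u]
  by (auto simp: abs_if split: if_splits)

lemma kink_height_le: "kink_height u \<le> 2" and kink_height_nonneg: "0 \<le> kink_height u"
proof -
  have "kink_height u \<le> 2 \<and> 0 \<le> kink_height u" if "0 \<le> u" for u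
  proof (cases "3 \<le> u")
    case False
    then show ?thesis
      using kink_height_strict[of 0 u] kink_height_pieces(1)[of 0] kink_height_pos[of u] that
      by (cases "u = 0") auto
  qed (simp add: kink_height_pieces)
  then have "kink_height \<bar>u\<bar> \<le> 2 \<and> 0 \<le> kink_height \<bar>u\<bar>" by simp
  then show "kink_height u \<le> 2" "0 \<le> kink_height u"
    using kink_height_minus[of u] by (auto simp: abs_if split: if_splits)
qed

text \<open>On the first piece the other root is \<open>3 / 2\<close>, outside that piece. On the
  third a zero requires \<open>u = 2 * (3 - u)\<^sup>2\<close>, which is at most 2.\<close>

lemma kink_abscissa_zero:
  assumes "0 < u" "kink_abscissa u = 0"
  shows "u = 2"
proof -
  consider "u \<le> 1" | "1 \<le> u" "u \<le> 2" | "2 \<le> u" "u \<le> 3" | "3 \<le> u" by linarith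
  then show ?thesis
  proof cases
    case 1
    then have "u * (10 * u - 15) = 0"
      using assms kink_abscissa_pieces(1)[of u] by (simp add: algebra_simps)
    then show ?thesis using 1 assms(1) by auto
  next
    case 3
    have "(3 - u)\<^sup>2 \<le> 1" using 3 by (auto simp: abs_square_le_1)
    then show ?thesis using assms(2) kink_abscissa_pieces(3)[OF 3] 3 by linarith
  qed (use assms kink_abscissa_pieces[of u] in auto)
qed

text \<open>The minimum on the first piece is -45/8, at \<open>3 / 4\<close>, whence the bound 6.
  The first bound separates the kink from the arms beyond 6; the last two keep outer pieces of the
  kink away from the disk of the bigon.\<close>

lemma kink_abscissa_bounds:
  "\<bar>u\<bar> \<le> 6 \<Longrightarrow> \<bar>kink_abscissa u\<bar> \<le> 6"
  "\<bar>u\<bar> \<le> 3 \<Longrightarrow> \<bar>kink_abscissa u\<bar> \<le> 6"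
  "u \<le> -1 \<Longrightarrow> u \<le> kink_abscissa u"
  "2 \<le> u \<Longrightarrow> 0 \<le> kink_abscissa u"
proof -
  have b: "\<bar>kink_abscissa u\<bar> \<le> max 6 u" if "0 \<le> u" for u
  proof -
    consider "u \<le> 1" | "1 \<le> u" "u \<le> 2" | "2 \<le> u" "u \<le> 3" | "3 \<le> u" by linarith
    then show ?thesis
    proof cases
      case 1
      have "u * (1 - u) \<ge> 0" using that 1 by simp
      have "kink_abscissa u = - 15 * u + 10 * u\<^sup>2" using kink_abscissa_pieces(1)[OF that 1]
        by (simp add: algebra_simps power2_eq_square)
      moreover have "10 * u\<^sup>2 - 15 * u + 6 = 10 * (u - 3/4)\<^sup>2 + 3/8"
        by (simp add: algebra_simps power2_eq_square)
      moreover have "(u - 3/4)\<^sup>2 \<ge> 0" by simp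
      moreover have "u\<^sup>2 \<le> u" using that 1 by (simp add: power2_eq_square mult_left_le)
      ultimately have "\<bar>kink_abscissa u\<bar> \<le> 6" using that by linarith
      then show ?thesis by simp
    next
      case 3
      have "(3 - u)\<^sup>2 \<le> 1" "0 \<le> (3 - u)\<^sup>2" using 3 by (auto simp: abs_square_le_1)
      then have "\<bar>kink_abscissa u\<bar> \<le> 6" using kink_abscissa_pieces(3)[OF 3] 3 by linarith
      then show ?thesis by simp
    qed (use that kink_abscissa_pieces[of u] in auto)
  qed
  then have b': "\<bar>kink_abscissa u\<bar> \<le> max 6 \<bar>u\<bar>" for u
    using b[of u] b[of "- u"] kink_abscissa_minus[of u] by (cases "0 \<le> u") auto
  show "\<bar>u\<bar> \<le> 6 \<Longrightarrow> \<bar>kink_abscissa u\<bar> \<le> 6" "\<bar>u\<bar> \<le> 3 \<Longrightarrow> \<bar>kink_abscissa u\<bar> \<le> 6"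
    using b'[of u] by auto
  have up: "kink_abscissa v \<le> v" if "1 \<le> v" for v
  proof -
    consider "v \<le> 2" | "2 \<le> v" "v \<le> 3" | "3 \<le> v" using that by linarith
    then show ?thesis by cases (use that kink_abscissa_pieces[of v] in auto)
  qed
  show "u \<le> -1 \<Longrightarrow> u \<le> kink_abscissa u"
    using up[of "- u"] kink_abscissa_minus[of u] by simp
  show "2 \<le> u \<Longrightarrow> 0 \<le> kink_abscissa u"
  proof (cases "u \<le> 3")
    assume u: "2 \<le> u" "u \<le> 3"
    then have "(3 - u)\<^sup>2 \<le> 1" by (auto simp: abs_square_le_1)
    then show ?thesis using u kink_abscissa_pieces(3)[of u] by linarith
  qed (simp add: kink_abscissa_pieces)
qed

definition kink :: "real \<Rightarrow> complex" where
  "kink u = Complex (kink_abscissa u) (kink_height u)"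

lemma Re_kink [simp]: "Re (kink u) = kink_abscissa u" and Im_kink [simp]: "Im (kink u) = kink_height u"
  by (simp_all add: kink_def)

lemma kink_eq_iff:
  "kink u = kink v \<longleftrightarrow> u = v \<or> (u = 2 \<and> v = -2) \<or> (u = -2 \<and> v = 2)"
proof
  assume eq: "kink u = kink v"
  then have h: "kink_height u = kink_height v" and x: "kink_abscissa u = kink_abscissa v"
    by (auto simp: complex_eq_iff)
  have abs: "kink_height \<bar>w\<bar> = kink_height w" for w using kink_height_minus[of w] by (simp add: abs_if)
  show "u = v \<or> (u = 2 \<and> v = -2) \<or> (u = -2 \<and> v = 2)"
  proof (cases "3 \<le> \<bar>u\<bar> \<or> 3 \<le> \<bar>v\<bar>")
    case True
    then have "3 \<le> \<bar>u\<bar>" "3 \<le> \<bar>v\<bar>"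
      using h kink_height_pos[of u] kink_height_pos[of v] kink_outside(1)[of u] kink_outside(1)[of v]
      by linarith+
    then show ?thesis using x by (simp add: kink_outside)
  next
    case False
    then have "\<bar>u\<bar> = \<bar>v\<bar>"
      using kink_height_strict[of "\<bar>u\<bar>" "\<bar>v\<bar>"] kink_height_strict[of "\<bar>v\<bar>" "\<bar>u\<bar>"] h abs[of u] abs[of v]
      by linarith
    then consider "u = v" | "v = - u" by linarith
    then show ?thesis
    proof cases
      case 2
      then have "kink_abscissa u = 0" "kink_abscissa v = 0" using x kink_abscissa_minus[of u] by auto
      then show ?thesis using 2 kink_abscissa_zero[of u] kink_abscissa_zero[of v]
        by (cases u "0 :: real" rule: linorder_cases) auto
    qed simp
  qed
next
  have "kink 2 = kink (-2)"
    using kink_abscissa_minus[of 2] kink_height_minus[of 2] kink_abscissa_pieces(2)[of 2]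
    by (auto simp: complex_eq_iff)
  then show "u = v \<or> (u = 2 \<and> v = -2) \<or> (u = -2 \<and> v = 2) \<Longrightarrow> kink u = kink v" by auto
qed

definition kink' :: "real \<Rightarrow> complex" where
  "kink' u = Complex (kink_abscissa' u) (kink_height' u)"

lemma kink_has_vector_derivative: "(kink has_vector_derivative kink' u) (at u)"
  unfolding kink_def kink'_def Complex_eq
  by (intro derivative_intros has_vector_derivative_of_real DERIV_kink_abscissa DERIV_kink_height
    DERIV_kink_abscissa[unfolded has_real_derivative_iff_has_vector_derivative]
    DERIV_kink_height[unfolded has_real_derivative_iff_has_vector_derivative])

lemma continuous_kink': "continuous_on A kink'"
  unfolding kink'_def Complex_eq kink_abscissa'_def kink_height'_def
  by (intro continuous_intros)

lemma kink'_nonzero: "kink' u \<noteq> 0"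
  using kink_derivative_nonzero[of u] by (auto simp: kink'_def complex_eq_iff)

text \<open>The directions at the crossing are (5, -1) and (5, 1).\<close>

lemma cross2_kink': "cross2 (kink' 2) (kink' (-2)) = 10" "cross2 (kink' (-2)) (kink' 2) = - 10"
  using kink_derivative_pieces(2)[of 2] kink_derivative_pieces(5)[of "-2"]
  by (simp_all add: cross2_def kink'_def kink_derivative_pieces(10,11))

text \<open>The coordinates are at most 6 and 2 in size. The sum 8 is below 9, the radius of the
  disk in which the kink is inserted.\<close>

lemma norm_kink_le: "\<bar>u\<bar> \<le> 3 \<Longrightarrow> norm (kink u) \<le> 8"
  using kink_abscissa_bounds(2)[of u] kink_height_le[of u] kink_height_nonneg[of u]
    cmod_le[of "kink u"] by simp

section \<open>Magnifying an arc until it is almost straight\<close>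

lemma vector_derivative_lipschitz:
  fixes f :: "real \<Rightarrow> 'a::real_normed_vector"
  assumes "\<And>x. x \<in> {a..b} \<Longrightarrow> (f has_vector_derivative f' x) (at x)"
    and "\<And>x. x \<in> {a..b} \<Longrightarrow> norm (f' x) \<le> B" and "x \<in> {a..b}" "y \<in> {a..b}"
  shows "norm (f x - f y) \<le> B * \<bar>x - y\<bar>"
proof -
  have "norm (f x - f y) \<le> B * norm (x - y)"
  proof (rule differentiable_bound[of "{a..b}" f "\<lambda>x h. h *\<^sub>R f' x"])
    show "(f has_derivative (\<lambda>h. h *\<^sub>R f' x)) (at x within {a..b})" if "x \<in> {a..b}" for x
      using assms(1)[OF that] unfolding has_vector_derivative_def by (rule has_derivative_at_withinI)
    show "onorm (\<lambda>h. h *\<^sub>R f' x) \<le> B" if "x \<in> {a..b}" for x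
      by (rule onorm_le) (use mult_left_mono[OF assms(2)[OF that] abs_ge_zero] in \<open>simp add: mult.commute\<close>)
  qed (use assms in auto)
  then show ?thesis by simp
qed

text \<open>Magnification at a plain point. In the coordinate \<open>t / \<epsilon>\<close> and in
  units of \<open>1 / 9\<close> the arc is the real axis up to an error \<open>e\<close>, whose
  slope is small by continuity of the derivative. The rest of the curve lies outside the unit disk:
  by compactness it has a positive distance from a point that is not double.\<close>

lemma ex_straight_arc:
  assumes D: "virtual_diagram D"
  obtains E \<epsilon> e e' where "isotopic D E" "virtual_diagram E" "0 < \<epsilon>" "\<epsilon> < 1 / 100"
    "\<And>t. curve E t = (of_real (t / \<epsilon>) + e (t / \<epsilon>)) / 9"
    "e 0 = 0" "\<And>u. (e has_vector_derivative e' u) (at u)" "continuous_on UNIV e'"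
    "\<And>u. \<bar>u\<bar> \<le> 11 \<Longrightarrow> norm (e' u) \<le> 1 / 100"
    "\<And>t. \<bar>t\<bar> \<le> 1 / 2 \<Longrightarrow> 11 * \<epsilon> < \<bar>t\<bar> \<Longrightarrow> 1 < norm (curve E t)"
    "\<And>t. \<bar>t\<bar> \<le> 11 * \<epsilon> \<Longrightarrow> mark E t = Plain"
proof -
  let ?c = "curve D"
  define F where "F = {s \<in> {0..<1}. \<exists>t. double_point ?c s t}"
  have "finite F" using D unfolding F_def virtual_diagram_def generic_curve_def by blast
  then have "open ({0<..<1} - F)" by (intro open_Diff finite_imp_closed) auto
  moreover have "{0<..<1} - F \<noteq> {}"
  proof
    assume "{0<..<1} - F = {}"
    then have "finite {0<..<1 :: real}" using \<open>finite F\<close> by (meson Diff_eq_empty_iff finite_subset)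
    then show False using infinite_Ioo[of "0 :: real" 1] by simp
  qed
  ultimately obtain t0 r where r: "0 < r" "ball t0 r \<subseteq> {0<..<1} - F"
    by (metis all_not_in_conv openE)
  have plain: "mark D t = Plain" if "\<bar>t - t0\<bar> < r" for t
  proof -
    have "t \<in> {0<..<1} - F" using r(2) that by (auto simp: dist_real_def abs_minus_commute)
    then show ?thesis using plain_iff[OF D, of t] by (auto simp: F_def)
  qed
  obtain c' where c': "\<And>t. (?c has_vector_derivative c' t) (at t)" "continuous_on UNIV c'" "\<And>t. c' t \<noteq> 0"
    using closed_immersion_derivative[OF virtual_diagram_immersion[OF D]] by blast
  define w where "w = c' t0"
  have w: "w \<noteq> 0" using c'(3) by (simp add: w_def)
  have "isCont c' t0" using c'(2) by (simp add: continuous_on_eq_continuous_at)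
  then obtain d1 where d1: "0 < d1" "\<And>t. \<bar>t - t0\<bar> < d1 \<Longrightarrow> norm (c' t - w) < norm w / 100"
    using w unfolding continuous_at_eps_delta w_def dist_norm
    by (metis divide_pos_pos real_norm_def zero_less_norm_iff zero_less_numeral)
  define \<delta> where "\<delta> = min (min (d1 / 2) (r / 2)) (1 / 4)"
  have \<delta>: "0 < \<delta>" "\<delta> < d1" "\<delta> < r" "\<delta> \<le> 1 / 4" using d1(1) r(1) by (auto simp: \<delta>_def)
  \<comment> \<open>The parameters of one period, relative to \<open>t0\<close>, that are not close
    to \<open>t0\<close>. The curve does not return to its point at \<open>t0\<close>, so its least
    distance \<open>m\<close> from there is positive.\<close>
  define K where "K = {t :: real. \<delta> \<le> \<bar>t\<bar> \<and> \<bar>t\<bar> \<le> 1 / 2}"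
  have "K = {- (1/2)..1/2} \<inter> {t. \<delta> \<le> \<bar>t\<bar>}" by (auto simp: K_def)
  moreover have "closed {t :: real. \<delta> \<le> \<bar>t\<bar>}" by (intro closed_Collect_le continuous_intros)
  ultimately have "compact K" by (simp add: compact_Int_closed)
  moreover have "K \<noteq> {}" using \<delta> by (auto simp: K_def intro!: exI[of _ "1/4"])
  moreover have "continuous_on K (\<lambda>t. norm (?c (t0 + t) - ?c t0))"
    by (intro continuous_intros continuous_on_compose2[OF virtual_diagram_continuous[OF D, of UNIV]]) auto
  ultimately obtain tm where tm: "tm \<in> K" "\<And>t. t \<in> K \<Longrightarrow> norm (?c (t0 + tm) - ?c t0) \<le> norm (?c (t0 + t) - ?c t0)"
    using continuous_attains_inf[of K "\<lambda>t. norm (?c (t0 + t) - ?c t0)"] by blast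
  define m where "m = norm (?c (t0 + tm) - ?c t0)"
  have "m > 0"
  proof -
    have "?c t0 \<noteq> ?c (t0 + tm)"
    proof
      assume "?c t0 = ?c (t0 + tm)"
      moreover have "tm \<noteq> 0" "\<bar>tm\<bar> < 1" using tm(1) \<delta> by (auto simp: K_def)
      then have "- tm \<notin> \<int>" using Ints_abs_less_1[of "- tm"] by auto
      ultimately have "double_point ?c t0 (t0 + tm)" by (simp add: double_point_def)
      then show False using plain[of t0] r(1) plain_iff[OF D] by auto
    qed
    then show ?thesis by (simp add: m_def)
  qed
  \<comment> \<open>The first bound keeps \<open>11 * \<epsilon>\<close> inside the almost straight
    arc, the second is the required smallness, and the third puts points at distance
    \<open>m\<close> outside the disk of radius \<open>9 * \<epsilon> * norm w\<close>, which
    becomes the unit disk.\<close>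
  define \<epsilon> where "\<epsilon> = min (min (\<delta> / 12) (1 / 200)) (m / (10 * norm w))"
  have e: "0 < \<epsilon>" "11 * \<epsilon> < \<delta>" "\<epsilon> < 1 / 100" "9 * \<epsilon> * norm w < m"
  proof -
    show "0 < \<epsilon>" using \<delta> \<open>m > 0\<close> w by (simp add: \<epsilon>_def)
    have "\<epsilon> \<le> \<delta> / 12" "\<epsilon> \<le> 1 / 200" "\<epsilon> \<le> m / (10 * norm w)" by (auto simp: \<epsilon>_def)
    then show "11 * \<epsilon> < \<delta>" "\<epsilon> < 1 / 100" using \<delta> by auto
    have "\<epsilon> * (10 * norm w) \<le> m" using \<open>\<epsilon> \<le> m / (10 * norm w)\<close> w by (simp add: pos_le_divide_eq)
    moreover have "\<epsilon> * norm w > 0" using \<open>0 < \<epsilon>\<close> w by simp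
    ultimately show "9 * \<epsilon> * norm w < m" by linarith
  qed
  \<comment> \<open>The base point goes to 0 and the tangent direction \<open>w\<close> to the
    positive real axis.\<close>
  define E where "E = rescale (1 / (of_real (9 * \<epsilon>) * w)) (- ?c t0 / (of_real (9 * \<epsilon>) * w)) t0 D"
  have a0: "1 / (of_real (9 * \<epsilon>) * w) \<noteq> 0" using w e(1) by simp
  have cE: "curve E t = (?c (t + t0) - ?c t0) / (of_real (9 * \<epsilon>) * w)" for t
    by (simp add: E_def rescale_def diff_divide_distrib)
  have mE: "mark E t = mark D (t + t0)" for t by (simp add: E_def rescale_def)
  define e where "e u = 9 * curve E (\<epsilon> * u) - of_real u" for u
  define e' where "e' u = c' (\<epsilon> * u + t0) / w - 1" for u
  have ee: "curve E t = (of_real (t / \<epsilon>) + e (t / \<epsilon>)) / 9" for t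
    using e(1) by (simp add: e_def)
  have dE: "(curve E has_vector_derivative 1 / (of_real (9 * \<epsilon>) * w) * c' (t + t0)) (at t)" for t
    unfolding E_def by (rule rescale_derivative[OF c'(1)])
  have de: "(e has_vector_derivative e' u) (at u)" for u
  proof -
    have "((\<lambda>u. curve E (\<epsilon> * u)) has_vector_derivative \<epsilon> *\<^sub>R (1 / (of_real (9 * \<epsilon>) * w) * c' (\<epsilon> * u + t0))) (at u)"
      using has_vector_derivative_affine[of "curve E" _ \<epsilon> u 0] dE[of "\<epsilon> * u"] by simp
    then have "((\<lambda>u. 9 * curve E (\<epsilon> * u) - of_real u) has_vector_derivative
        9 * (\<epsilon> *\<^sub>R (1 / (of_real (9 * \<epsilon>) * w) * c' (\<epsilon> * u + t0))) - of_real 1) (at u)"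
      by (intro has_vector_derivative_diff has_vector_derivative_mult_right has_vector_derivative_of_real DERIV_ident)
    then show ?thesis
      unfolding e_def[abs_def] e'_def using e(1) w by (simp add: scaleR_conv_of_real field_simps)
  qed
  have e'b: "norm (e' u) \<le> 1 / 100" if "\<bar>\<epsilon> * u\<bar> < d1" for u
  proof -
    have "norm (c' (\<epsilon> * u + t0) - w) < norm w / 100" using d1(2) that by simp
    moreover have "e' u = (c' (\<epsilon> * u + t0) - w) / w" using w by (simp add: e'_def diff_divide_distrib)
    ultimately show ?thesis using w by (simp add: norm_divide divide_le_eq)
  qed
  have e0: "e 0 = 0" by (simp add: e_def cE)
  show ?thesis
  proof (rule that)
    show "isotopic D E" unfolding E_def by (rule isotopic_rescale[OF a0])
    show "virtual_diagram E" unfolding E_def by (rule virtual_diagram_rescale[OF D a0])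
    show "0 < \<epsilon>" "\<epsilon> < 1 / 100" by fact+
    show "curve E t = (of_real (t / \<epsilon>) + e (t / \<epsilon>)) / 9" for t by (rule ee)
    show "e 0 = 0" by (rule e0)
    show "(e has_vector_derivative e' u) (at u)" for u by (rule de)
    show "continuous_on UNIV e'" unfolding e'_def
      by (intro continuous_intros continuous_on_compose2[OF c'(2)]) (use w in auto)
    show "norm (e' u) \<le> 1 / 100" if "\<bar>u\<bar> \<le> 11" for u
    proof (rule e'b)
      have "\<bar>\<epsilon> * u\<bar> \<le> \<epsilon> * 11" using that e(1) by (simp add: abs_mult)
      then show "\<bar>\<epsilon> * u\<bar> < d1" using e(2) \<delta>(2) by linarith
    qed
    show "mark E t = Plain" if "\<bar>t\<bar> \<le> 11 * \<epsilon>" for t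
      unfolding mE by (rule plain) (use that e(2) \<delta> in auto)
    show "1 < norm (curve E t)" if t: "\<bar>t\<bar> \<le> 1 / 2" "11 * \<epsilon> < \<bar>t\<bar>" for t
    \<comment> \<open>Up to \<open>\<delta>\<close> the slope of \<open>e\<close> is still at most
      \<open>1 / 100\<close>, and 99/100 of 11 exceeds 9; beyond \<open>\<delta>\<close> the
      distance \<open>m\<close> decides.\<close>
    proof (cases "\<bar>t\<bar> < \<delta>")
      case True
      define u where "u = t / \<epsilon>"
      have u: "11 < \<bar>u\<bar>" using t(2) e(1) by (simp add: u_def pos_less_divide_eq abs_divide)
      have "norm (e u - e 0) \<le> 1 / 100 * \<bar>u - 0\<bar>"
      proof (rule vector_derivative_lipschitz[of "- \<bar>u\<bar>" "\<bar>u\<bar>" e e'])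
        show "norm (e' x) \<le> 1 / 100" if x: "x \<in> {- \<bar>u\<bar>..\<bar>u\<bar>}" for x
        proof (rule e'b)
          have "\<bar>\<epsilon> * x\<bar> \<le> \<epsilon> * \<bar>u\<bar>" using x e(1) by (auto simp: abs_mult)
          also have "\<dots> = \<bar>t\<bar>" using e(1) by (simp add: u_def abs_divide)
          finally show "\<bar>\<epsilon> * x\<bar> < d1" using True \<delta>(2) by linarith
        qed
      qed (auto intro: de)
      then have "norm (e u) \<le> \<bar>u\<bar> / 100" by (simp add: e0)
      then have "norm (of_real u + e u) \<ge> \<bar>u\<bar> - \<bar>u\<bar> / 100"
        using norm_diff_ineq[of "of_real u" "e u"] by (simp add: )
      then show ?thesis unfolding ee u_def[symmetric] using u by (simp add: norm_divide)
    next
      case False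
      then have "m \<le> norm (?c (t0 + t) - ?c t0)" using tm(2)[of t] t by (auto simp: K_def m_def)
      then have "9 * \<epsilon> * norm w < norm (?c (t0 + t) - ?c t0)" using e(4) by linarith
      moreover have "norm (of_real (9 * \<epsilon>) * w) = 9 * \<epsilon> * norm w" using e(1) by (simp add: norm_mult)
      moreover have "9 * \<epsilon> * norm w > 0" using e(1) w by simp
      ultimately show ?thesis unfolding cE norm_divide by (simp add: add.commute)
    qed
  qed
qed

section \<open>Replacing the almost straight arc by the kink\<close>

text \<open>A C1 cutoff that is 0 up to \<open>\<bar>u\<bar> = 6\<close> and 1 from 7 on. The inner
  truncated squares start with slope zero at 6 and -6; the outer one stops with slope zero where its
  argument vanishes, at 7 and -7.\<close>

definition blend :: "real \<Rightarrow> real" where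
  "blend u = 1 - posq (1 - posq (u - 6) - posq (- u - 6))"

definition blend' :: "real \<Rightarrow> real" where
  "blend' u = 2 * max 0 (1 - posq (u - 6) - posq (- u - 6)) * (2 * max 0 (u - 6) - 2 * max 0 (- u - 6))"

lemma DERIV_blend: "(blend has_real_derivative blend' u) (at u)"
  unfolding blend_def blend'_def by (rule derivative_eq_intros refl | simp add: algebra_simps)+

lemma blend_inside: "\<bar>u\<bar> \<le> 6 \<Longrightarrow> blend u = 0" "\<bar>u\<bar> \<le> 6 \<Longrightarrow> blend' u = 0"
  by (auto simp: blend_def blend'_def posq_def)

lemma blend_outside:
  assumes "7 \<le> \<bar>u\<bar>"
  shows "blend u = 1" "blend' u = 0"
proof -
  have "1 \<le> max (posq (u - 6)) (posq (- u - 6))"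
    using assms by (auto simp: posq_def max_def one_le_power abs_if split: if_splits)
  then have "1 - posq (u - 6) - posq (- u - 6) \<le> 0"
    using posq_nonneg[of "u - 6"] posq_nonneg[of "- u - 6"] by linarith
  then show "blend u = 1" "blend' u = 0" by (simp_all add: blend_def blend'_def posq_neg)
qed

text \<open>The slope bound 4 makes the blended error a contraction: as \<open>e\<close> is at most
  \<open>11 / 100\<close> in norm, the slope of the product stays below
  \<open>1 / 2\<close>.\<close>

lemma blend_bounds: "0 \<le> blend u" "blend u \<le> 1" "\<bar>blend' u\<bar> \<le> 4"
proof -
  have le: "1 - posq (u - 6) - posq (- u - 6) \<le> 1"
    using posq_nonneg[of "u - 6"] posq_nonneg[of "- u - 6"] by linarith
  then show "0 \<le> blend u" "blend u \<le> 1" using posq_le_1[OF le] posq_nonneg by (simp_all add: blend_def)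
  show "\<bar>blend' u\<bar> \<le> 4"
  proof (cases "7 \<le> \<bar>u\<bar>")
    case False
    have "\<bar>2 * max 0 (1 - posq (u - 6) - posq (- u - 6))\<bar> \<le> 2" using le by auto
    moreover have "\<bar>2 * max 0 (u - 6) - 2 * max 0 (- u - 6)\<bar> \<le> 2" using False by (auto simp: max_def)
    ultimately have "\<bar>blend' u\<bar> \<le> 2 * 2" unfolding blend'_def abs_mult by (intro mult_mono) auto
    then show ?thesis by simp
  qed (simp add: blend_outside)
qed

text \<open>The disk of radius 9 has to cut each arm in a single point, the end of the strand. As
  \<open>e\<close> varies slowly, the distance from 0 increases strictly between 7 and 11, and it
  passes 9 there because the error is at most \<open>11 / 100\<close>.\<close>

lemma radius_crossing:
  fixes e :: "real \<Rightarrow> complex"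
  assumes lip: "\<And>u v. \<bar>u\<bar> \<le> 11 \<Longrightarrow> \<bar>v\<bar> \<le> 11 \<Longrightarrow> norm (e u - e v) \<le> \<bar>u - v\<bar> / 100" and e0: "e 0 = 0"
  obtains b where "7 < b" "b < 11" "\<And>u. 7 \<le> u \<Longrightarrow> u \<le> 11 \<Longrightarrow> norm (of_real u + e u) \<le> 9 \<longleftrightarrow> u \<le> b"
    "\<And>u. 7 \<le> u \<Longrightarrow> u \<le> 11 \<Longrightarrow> norm (of_real u + e u) < 9 \<longleftrightarrow> u < b"
proof -
  define n where "n u = norm (of_real u + e u)" for u
  have eb: "norm (e u) \<le> 11 / 100" if "\<bar>u\<bar> \<le> 11" for u
    using lip[OF that, of 0] e0 that by simp
  have mono: "n u < n v" if "7 \<le> u" "u < v" "v \<le> 11" for u v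
  proof -
    \<comment> \<open>Position \<open>z\<close> and increment \<open>d\<close>. The squared norm
      grows because their inner product is positive: the real parts contribute at least
      \<open>3 * (v - u)\<close>, the imaginary parts at least \<open>- (v - u)\<close>.\<close>
    define z where "z = of_real u + e u"
    define d where "d = of_real (v - u) + (e v - e u)"
    have zd: "of_real v + e v = z + d" by (simp add: z_def d_def)
    have "norm (e v - e u) \<le> (v - u) / 100" using lip[of v u] that by simp
    then have re: "\<bar>Re (e v - e u)\<bar> \<le> (v - u) / 100" and im: "\<bar>Im (e v - e u)\<bar> \<le> (v - u) / 100"
      using abs_Re_le_cmod[of "e v - e u"] abs_Im_le_cmod[of "e v - e u"] by linarith+
    have Red: "Re d = v - u + Re (e v - e u)" and Imd: "Im d = Im (e v - e u)" by (simp_all add: d_def)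
    have d: "Re d \<ge> (v - u) / 2" "\<bar>Im d\<bar> \<le> v - u"
      using re im that unfolding Red Imd by (auto simp: abs_if field_simps split: if_splits)
    have z: "Re z \<ge> 6" "\<bar>Im z\<bar> \<le> 1"
      using abs_Re_le_cmod[of "e u"] abs_Im_le_cmod[of "e u"] eb[of u] that by (auto simp: z_def)
    have aux: "0 < A + B" if "3 * r \<le> A" "- r \<le> B" "0 < r" for A B r :: real using that by linarith
    have "Re z * Re d \<ge> 6 * ((v - u) / 2)" using z d that by (intro mult_mono) auto
    then have "3 * (v - u) \<le> Re z * Re d" by simp
    moreover have "\<bar>Im z * Im d\<bar> \<le> 1 * (v - u)" unfolding abs_mult using z d by (intro mult_mono) auto
    then have "- (v - u) \<le> Im z * Im d" by (simp add: abs_le_iff)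
    ultimately have "Re z * Re d + Im z * Im d > 0" using aux[of "v - u" "Re z * Re d" "Im z * Im d"] that by argo
    moreover have "(norm (z + d))\<^sup>2 = (norm z)\<^sup>2 + ((Re z * Re d + Im z * Im d) + (Re z * Re d + Im z * Im d)) + (norm d)\<^sup>2"
      unfolding cmod_power2 by (simp add: power2_eq_square algebra_simps)
    ultimately have "(norm z)\<^sup>2 < (norm (z + d))\<^sup>2"
      using zero_le_power2[of "norm d"] by linarith
    then have "norm z < norm (z + d)" using power_less_imp_less_base by fastforce
    then show ?thesis unfolding n_def zd z_def[symmetric] .
  qed
  have "continuous_on {7..11} e"
  proof (rule continuous_onI)
    fix x \<eta> :: real assume x: "x \<in> {7..11}" "0 < \<eta>"
    have "dist (e y) (e x) \<le> \<eta>" if "y \<in> {7..11}" "dist y x < \<eta>" for y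
      using lip[of y x] that x by (auto simp: dist_norm)
    then show "\<exists>d>0. \<forall>x'\<in>{7..11}. dist x' x < d \<longrightarrow> dist (e x') (e x) \<le> \<eta>" using x(2) by blast
  qed
  then have cont: "continuous_on {7..11} n" unfolding n_def by (intro continuous_intros)
  have n7: "n 7 < 9" using norm_triangle_ineq[of 7 "e 7"] eb[of 7] by (simp add: n_def)
  have n11: "n 11 > 9" using norm_diff_ineq[of 11 "e 11"] eb[of 11] by (simp add: n_def)
  obtain b where b: "7 \<le> b" "b \<le> 11" "n b = 9"
    using IVT'[of n 7 9 11] n7 n11 cont by auto
  show ?thesis
  proof (rule that)
    show "7 < b" "b < 11" using b n7 n11 by (auto simp: order_le_less)
    fix u :: real assume u: "7 \<le> u" "u \<le> 11"
    consider "u < b" | "u = b" | "b < u" by linarith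
    then show "norm (of_real u + e u) \<le> 9 \<longleftrightarrow> u \<le> b" "norm (of_real u + e u) < 9 \<longleftrightarrow> u < b"
      using mono[of u b] mono[of b u] u b unfolding n_def[symmetric] by (cases; simp)+
  qed
qed

text \<open>The new arc switches the error off up to 6, so that the result is the exact kink there
  and the bigon can be computed. The change ends at 7, and each arm meets the circle of radius 9
  beyond 7, where it is still the old curve.\<close>

lemma kink_move:
  assumes D: "virtual_diagram D"
  obtains E \<epsilon> where "move_sequence D [VRI] E" "0 < \<epsilon>" "\<epsilon> < 1 / 100"
    "\<And>u. \<bar>u\<bar> \<le> 6 \<Longrightarrow> curve E (\<epsilon> * u) = kink u"
    "\<And>t. \<bar>t\<bar> \<le> 1 / 2 \<Longrightarrow> 6 * \<epsilon> < \<bar>t\<bar> \<Longrightarrow> 6 < norm (curve E t)"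
    "\<And>t. \<bar>t\<bar> \<le> 6 * \<epsilon> \<Longrightarrow> mark E t \<in> {Plain, Virtual}"
    "\<And>t. \<bar>t\<bar> \<le> 6 * \<epsilon> \<Longrightarrow> \<bar>t\<bar> \<noteq> 2 * \<epsilon> \<Longrightarrow> mark E t = Plain"
proof -
  obtain C \<epsilon> e e' where iso: "isotopic D C" and C: "virtual_diagram C" and eps: "0 < \<epsilon>" "\<epsilon> < 1 / 100"
    and cC: "\<And>t. curve C t = (of_real (t / \<epsilon>) + e (t / \<epsilon>)) / 9"
    and e0: "e 0 = 0" and de: "\<And>u. (e has_vector_derivative e' u) (at u)" and ce': "continuous_on UNIV e'"
    and e'b: "\<And>u. \<bar>u\<bar> \<le> 11 \<Longrightarrow> norm (e' u) \<le> 1 / 100"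
    and far: "\<And>t. \<bar>t\<bar> \<le> 1 / 2 \<Longrightarrow> 11 * \<epsilon> < \<bar>t\<bar> \<Longrightarrow> 1 < norm (curve C t)"
    and plain: "\<And>t. \<bar>t\<bar> \<le> 11 * \<epsilon> \<Longrightarrow> mark C t = Plain"
    using ex_straight_arc[OF D] by metis
  have lip: "norm (e u - e v) \<le> \<bar>u - v\<bar> / 100" if "\<bar>u\<bar> \<le> 11" "\<bar>v\<bar> \<le> 11" for u v
  proof -
    have "norm (e u - e v) \<le> 1 / 100 * \<bar>u - v\<bar>"
    proof (rule vector_derivative_lipschitz[of "-11" 11 e e', OF de])
      show "norm (e' x) \<le> 1 / 100" if "x \<in> {-11..11}" for x by (rule e'b) (use that in auto)
    qed (use that in auto)
    then show ?thesis by simp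
  qed
  have eb: "norm (e u) \<le> 11 / 100" if "\<bar>u\<bar> \<le> 11" for u
    using lip[OF that, of 0] e0 that by simp
  define f where "f u = blend u *\<^sub>R e u" for u
  define f' where "f' u = blend u *\<^sub>R e' u + blend' u *\<^sub>R e u" for u
  have df: "(f has_vector_derivative f' u) (at u)" for u
    unfolding f_def[abs_def] f'_def by (rule has_vector_derivative_scaleR[OF DERIV_blend de])
  have f'b: "norm (f' u) \<le> 1 / 2" if "\<bar>u\<bar> \<le> 11" for u
  proof -
    have "norm (f' u) \<le> \<bar>blend u\<bar> * norm (e' u) + \<bar>blend' u\<bar> * norm (e u)"
      unfolding f'_def using norm_triangle_ineq[of "blend u *\<^sub>R e' u" "blend' u *\<^sub>R e u"] by simp
    also have "\<dots> \<le> 1 * (1 / 100) + 4 * (11 / 100)"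
      using blend_bounds[of u] e'b[OF that] eb[OF that] by (intro add_mono mult_mono) auto
    finally show ?thesis by simp
  qed
  \<comment> \<open>The factor \<open>1 / 2\<close> keeps the arms, which are the identity plus
    \<open>f\<close>, injective.\<close>
  have flip: "norm (f u - f v) \<le> \<bar>u - v\<bar> / 2" if "\<bar>u\<bar> \<le> 11" "\<bar>v\<bar> \<le> 11" for u v
  proof -
    have "norm (f u - f v) \<le> 1 / 2 * \<bar>u - v\<bar>"
    proof (rule vector_derivative_lipschitz[of "-11" 11 f f', OF df])
      show "norm (f' x) \<le> 1 / 2" if "x \<in> {-11..11}" for x by (rule f'b) (use that in auto)
    qed (use that in auto)
    then show ?thesis by simp
  qed
  have fb: "norm (f u) \<le> 11 / 100" if "\<bar>u\<bar> \<le> 11" for u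
  proof -
    have "norm (f u) \<le> 1 * norm (e u)" unfolding f_def norm_scaleR
      using blend_bounds[of u] by (intro mult_right_mono) auto
    then show ?thesis using eb[OF that] by simp
  qed
  have f_in: "f u = 0" "f' u = 0" if "\<bar>u\<bar> \<le> 6" for u using blend_inside[OF that] by (simp_all add: f_def f'_def)
  have f_out: "f u = e u" "f' u = e' u" if "7 \<le> \<bar>u\<bar>" for u using blend_outside[OF that] by (simp_all add: f_def f'_def)
  \<comment> \<open>the new arc, exactly the kink for \<open>\<bar>u\<bar> \<le> 6\<close> and the old arc for \<open>7 \<le> \<bar>u\<bar>\<close>\<close>
  define M where "M u = kink u + f u" for u
  have M_in: "M u = kink u" if "\<bar>u\<bar> \<le> 6" for u using f_in that by (simp add: M_def)
  have kink_arm: "kink u = of_real u" if "3 \<le> \<bar>u\<bar>" for u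
    using kink_outside[OF that] by (simp add: complex_eq_iff)
  have M_arm: "M u = of_real u + f u" if "3 \<le> \<bar>u\<bar>" for u using kink_arm[OF that] by (simp add: M_def)
  \<comment> \<open>\<open>f\<close> vanishes at 6 and -6, so beyond these points the real part
    moves outwards at least half as fast as \<open>u\<close>.\<close>
  have ReM: "6 < \<bar>Re (M u)\<bar>" if "6 < \<bar>u\<bar>" "\<bar>u\<bar> \<le> 11" for u
  proof -
    have "norm (f u - f (6 * sgn u)) \<le> \<bar>u - 6 * sgn u\<bar> / 2"
      using that by (intro flip) (auto simp: abs_mult abs_sgn_eq)
    also have "f (6 * sgn u) = 0" by (rule f_in) (auto simp: abs_mult abs_sgn_eq)
    also have "\<bar>u - 6 * sgn u\<bar> = \<bar>u\<bar> - 6" using that by (auto simp: sgn_if abs_if)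
    finally have "\<bar>Re (f u)\<bar> \<le> (\<bar>u\<bar> - 6) / 2" using abs_Re_le_cmod[of "f u"] by simp
    moreover have "Re (M u) = u + Re (f u)" using M_arm[of u] that by simp
    ultimately show ?thesis using that by (auto simp: abs_if field_simps split: if_splits)
  qed
  \<comment> \<open>Near 0 the arc is the exact kink; on the arms \<open>f\<close> is a contraction;
    an arm and the kink are separated by the absolute value 6 of the real part.\<close>
  have M_eq: "M u = M v \<longleftrightarrow> u = v \<or> (u = 2 \<and> v = -2) \<or> (u = -2 \<and> v = 2)"
    if "\<bar>u\<bar> \<le> 11" "\<bar>v\<bar> \<le> 11" for u v
  proof -
    consider "\<bar>u\<bar> \<le> 6" "\<bar>v\<bar> \<le> 6" | "3 \<le> \<bar>u\<bar>" "3 \<le> \<bar>v\<bar>" | "\<bar>u\<bar> < 3" "6 < \<bar>v\<bar>" | "6 < \<bar>u\<bar>" "\<bar>v\<bar> < 3"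
      by linarith
    then show ?thesis
    proof cases
      case 1
      then show ?thesis by (simp add: M_in kink_eq_iff)
    next
      case 2
      have "u = v" if "M u = M v"
      proof -
        have "of_real (u - v) = f v - f u" using that 2 by (simp add: M_arm algebra_simps)
        then have "\<bar>u - v\<bar> = norm (f v - f u)" by (metis norm_of_real real_norm_def)
        then show ?thesis using flip[of v u] \<open>\<bar>u\<bar> \<le> 11\<close> \<open>\<bar>v\<bar> \<le> 11\<close> by simp
      qed
      then show ?thesis using 2 by auto
    next
      case 3
      then have "\<bar>Re (M u)\<bar> \<le> 6" using kink_abscissa_bounds(1)[of u] by (simp add: M_in)
      then show ?thesis using ReM[of v] that 3 by auto
    next
      case 4
      then have "\<bar>Re (M v)\<bar> \<le> 6" using kink_abscissa_bounds(1)[of v] by (simp add: M_in)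
      then show ?thesis using ReM[of u] that 4 by auto
    qed
  qed
  have M_norm: "norm (M u) < 9" if "\<bar>u\<bar> \<le> 7" for u
  proof (cases "3 \<le> \<bar>u\<bar>")
    case True
    have "norm (M u) \<le> \<bar>u\<bar> + norm (f u)"
      unfolding M_arm[OF True] using norm_triangle_ineq[of "of_real u" "f u"] by simp
    then show ?thesis using fb[of u] that by linarith
  next
    case False
    then show ?thesis using norm_kink_le[of u] by (simp add: M_in)
  qed
  obtain b where b: "7 < b" "b < 11" "\<And>u. 7 \<le> u \<Longrightarrow> u \<le> 11 \<Longrightarrow> norm (of_real u + e u) \<le> 9 \<longleftrightarrow> u \<le> b"
    "\<And>u. 7 \<le> u \<Longrightarrow> u \<le> 11 \<Longrightarrow> norm (of_real u + e u) < 9 \<longleftrightarrow> u < b"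
    using radius_crossing[OF lip e0] by blast
  \<comment> \<open>The left arm becomes a right arm when \<open>u\<close> is replaced by
    \<open>- u\<close> and the curve by its negative.\<close>
  have lip': "norm (- e (- u) - - e (- v)) \<le> \<bar>u - v\<bar> / 100" if "\<bar>u\<bar> \<le> 11" "\<bar>v\<bar> \<le> 11" for u v
    using lip[of "- v" "- u"] that by simp
  obtain a where a: "7 < a" "a < 11" "\<And>u. 7 \<le> u \<Longrightarrow> u \<le> 11 \<Longrightarrow> norm (of_real u + - e (- u)) \<le> 9 \<longleftrightarrow> u \<le> a"
    "\<And>u. 7 \<le> u \<Longrightarrow> u \<le> 11 \<Longrightarrow> norm (of_real u + - e (- u)) < 9 \<longleftrightarrow> u < a"
    using radius_crossing[of "\<lambda>u. - e (- u)", OF lip'] e0 by auto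
  have a': "norm (of_real u + e u) \<le> 9 \<longleftrightarrow> - a \<le> u" "norm (of_real u + e u) < 9 \<longleftrightarrow> - a < u"
    if "-11 \<le> u" "u \<le> -7" for u
  proof -
    have "norm (of_real (- u) + - e (- (- u))) = norm (of_real u + e u)"
      by (metis minus_add_distrib minus_minus norm_minus_cancel of_real_minus)
    then show "norm (of_real u + e u) \<le> 9 \<longleftrightarrow> - a \<le> u" "norm (of_real u + e u) < 9 \<longleftrightarrow> - a < u"
      using a(3,4)[of "- u"] that by auto
  qed
  \<comment> \<open>The difference of the new and the old arc: a bump that vanishes from
    \<open>7 * \<epsilon>\<close> on.\<close>
  define g where "g t = (M (t / \<epsilon>) - (of_real (t / \<epsilon>) + e (t / \<epsilon>))) / 9" for t
  define g' where "g' t = (kink' (t / \<epsilon>) + f' (t / \<epsilon>) - (1 + e' (t / \<epsilon>))) / (9 * of_real \<epsilon>)" for t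
  define c' where "c' t = (1 + e' (t / \<epsilon>)) / (9 * of_real \<epsilon>)" for t
  define cE where "cE t = curve C t + g (t - of_int (round t))" for t
  have d_scale: "((\<lambda>t. h (t / \<epsilon>) / 9) has_vector_derivative h' / (9 * of_real \<epsilon>)) (at t)"
    if "(h has_vector_derivative h') (at (t / \<epsilon>))" for h :: "real \<Rightarrow> complex" and h' t
  proof -
    have "((\<lambda>t. h (t / \<epsilon>)) has_vector_derivative (1 / \<epsilon>) *\<^sub>R h') (at t)"
      using has_vector_derivative_affine[of h h' "1 / \<epsilon>" t 0] that by simp
    then have "((\<lambda>t. (1 / 9) * h (t / \<epsilon>)) has_vector_derivative (1 / 9) * ((1 / \<epsilon>) *\<^sub>R h')) (at t)"
      by (rule has_vector_derivative_mult_right)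
    then show ?thesis by (simp add: scaleR_conv_of_real field_simps)
  qed
  have de1: "((\<lambda>u. of_real u + e u) has_vector_derivative 1 + e' u) (at u)" for u
    using has_vector_derivative_add[OF has_vector_derivative_of_real[OF DERIV_ident] de] by simp
  have dM: "(M has_vector_derivative kink' u + f' u) (at u)" for u
    unfolding M_def[abs_def] by (rule has_vector_derivative_add[OF kink_has_vector_derivative df])
  have dC: "(curve C has_vector_derivative c' t) (at t)" for t
    unfolding cC[abs_def] c'_def by (rule d_scale[OF de1])
  have dg: "(g has_vector_derivative g' t) (at t)" for t
    unfolding g_def[abs_def] g'_def by (rule d_scale[OF has_vector_derivative_diff[OF dM de1]])
  have cont_f': "continuous_on UNIV f'"
  proof -
    have "continuous_on UNIV e" "continuous_on UNIV blend"
      using de DERIV_blend by (meson has_vector_derivative_continuous continuous_at_imp_continuous_on DERIV_isCont)+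
    moreover have "continuous_on UNIV blend'"
      unfolding blend'_def posq_def by (intro continuous_intros)
    ultimately show ?thesis unfolding f'_def by (intro continuous_intros ce')
  qed
  have cont_c': "continuous_on UNIV c'"
    unfolding c'_def using eps by (intro continuous_intros continuous_on_compose2[OF ce']) auto
  have cont_g': "continuous_on UNIV g'"
    unfolding g'_def using eps
    by (intro continuous_intros continuous_on_compose2[OF ce'] continuous_on_compose2[OF cont_f']
      continuous_on_compose2[OF continuous_kink'[of UNIV]]) auto
  have supp: "g t = 0" if "7 * \<epsilon> \<le> \<bar>t\<bar>" for t
  proof -
    have "7 \<le> \<bar>t / \<epsilon>\<bar>" using that eps by (simp add: abs_divide pos_le_divide_eq)
    then show ?thesis using f_out(1)[of "t / \<epsilon>"] M_arm[of "t / \<epsilon>"] by (simp add: g_def)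
  qed
  have d7: "7 * \<epsilon> < 1 / 2" using eps by simp
  note bump = periodic_bump[of "curve C" c' g g' "7 * \<epsilon>" cE, OF virtual_diagram_periodic[OF C] dC cont_c' dg cont_g'
      supp d7 cE_def refl]
  have near: "cE t = M (t / \<epsilon>) / 9" if "\<bar>t\<bar> \<le> 1 / 2" for t
  proof -
    have "\<bar>t - of_int 0\<bar> < 1 - 7 * \<epsilon>"
      unfolding of_int_0 diff_0_right using that d7 by linarith
    then have "cE t = curve C t + g (t - of_int 0)" using bump(4)[of t 0] by blast
    then show ?thesis by (simp add: cC g_def diff_divide_distrib)
  qed
  define E where "E = \<lparr>curve = cE, mark = (\<lambda>t. if t - 2 * \<epsilon> \<in> \<int> \<or> t + 2 * \<epsilon> \<in> \<int> then Virtual else mark C t)\<rparr>"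
  have cE: "curve E = cE" by (simp add: E_def)
  have mE: "mark E t = (if t - 2 * \<epsilon> \<in> \<int> \<or> t + 2 * \<epsilon> \<in> \<int> then Virtual else mark C t)" for t
    by (simp add: E_def)
  have rnd: "\<bar>t - of_int (round t)\<bar> \<le> 1 / 2" "t - (t - of_int (round t)) \<in> \<int>" for t :: real
    using of_int_round_abs_le[of t] by (simp_all add: abs_minus_commute)
  define Is where "Is = [(- (\<epsilon> * a), \<epsilon> * b)]"
  define S where "S = (\<Union>I\<in>set Is. closed_strand I)"
  have scale: "t \<in> {- (\<epsilon> * a)..\<epsilon> * b} \<longleftrightarrow> - a \<le> t / \<epsilon> \<and> t / \<epsilon> \<le> b"
    "t \<in> {- (\<epsilon> * a)<..<\<epsilon> * b} \<longleftrightarrow> - a < t / \<epsilon> \<and> t / \<epsilon> < b" for t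
    using eps by (auto simp: field_simps)
  \<comment> \<open>Stated for a general \<open>X\<close> to serve the old and the new diagram: both
    stay inside the disk up to \<open>7 * \<epsilon>\<close> and agree from there on.\<close>
  have tangle: "tangle X Is" if per: "\<And>t. curve X (t + 1) = curve X t"
    and X7: "\<And>t. \<bar>t\<bar> \<le> 7 * \<epsilon> \<Longrightarrow> norm (curve X t) < 1"
    and X: "\<And>t. \<bar>t\<bar> \<le> 1 / 2 \<Longrightarrow> 7 * \<epsilon> \<le> \<bar>t\<bar> \<Longrightarrow> curve X t = curve C t" for X
  proof (rule tangleI[OF per])
    have "\<epsilon> * a < \<epsilon> * 11" "\<epsilon> * b < \<epsilon> * 11" "0 < \<epsilon> * a" "0 < \<epsilon> * b" using eps a b by simp_all
    then have "\<epsilon> * a < 1 / 2" "\<epsilon> * b < 1 / 2" "- (\<epsilon> * a) < \<epsilon> * b" using eps by linarith+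
    then show "- (1 / 2) < x \<and> x < y \<and> y < 1 / 2" if "(x, y) \<in> set Is" for x y
      using that eps by (simp add: Is_def)
    fix t :: real assume t: "\<bar>t\<bar> \<le> 1 / 2"
    define u where "u = t / \<epsilon>"
    have tu: "\<bar>t\<bar> = \<epsilon> * \<bar>u\<bar>" using eps by (simp add: u_def abs_divide)
    consider "\<bar>u\<bar> \<le> 7" | "7 \<le> u" "u \<le> 11" | "-11 \<le> u" "u \<le> -7" | "11 < \<bar>u\<bar>" by linarith
    then have "(norm (curve X t) \<le> 1 \<longleftrightarrow> - a \<le> u \<and> u \<le> b) \<and> (norm (curve X t) < 1 \<longleftrightarrow> - a < u \<and> u < b)"
    proof cases
      case 1
      then have "\<bar>t\<bar> \<le> 7 * \<epsilon>" using tu eps by simp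
      then show ?thesis using X7[of t] 1 a(1) b(1) by auto
    next
      case 2
      then have "\<epsilon> * 7 \<le> \<epsilon> * \<bar>u\<bar>" using eps by (intro mult_left_mono) auto
      then have "7 * \<epsilon> \<le> \<bar>t\<bar>" using tu by simp
      then have "curve X t = (of_real u + e u) / 9" using X[OF t] cC[of t] by (simp only: u_def)
      then have "norm (curve X t) = norm (of_real u + e u) / 9" by (simp only: norm_divide norm_numeral)
      then show ?thesis using b(3,4)[OF 2] 2 a(1) by auto
    next
      case 3
      then have "\<epsilon> * 7 \<le> \<epsilon> * \<bar>u\<bar>" using eps by (intro mult_left_mono) auto
      then have "7 * \<epsilon> \<le> \<bar>t\<bar>" using tu by simp
      then have "curve X t = (of_real u + e u) / 9" using X[OF t] cC[of t] by (simp only: u_def)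
      then have "norm (curve X t) = norm (of_real u + e u) / 9" by (simp only: norm_divide norm_numeral)
      then show ?thesis using a'[OF 3] 3 b(1) by auto
    next
      case 4
      then have "11 * \<epsilon> < \<bar>t\<bar>" using tu eps by simp
      then have "1 < norm (curve X t)" using X[OF t] far[OF t] eps by simp
      then show ?thesis using 4 a b by auto
    qed
    then show "norm (curve X t) \<le> 1 \<longleftrightarrow> (\<exists>I\<in>set Is. t \<in> {fst I..snd I})"
      "norm (curve X t) < 1 \<longleftrightarrow> (\<exists>I\<in>set Is. t \<in> {fst I<..<snd I})"
      unfolding Is_def using scale[of t] by (simp_all add: u_def)
  qed (simp add: Is_def)
  have TC: "tangle C Is"
  proof (rule tangle[OF virtual_diagram_periodic[OF C]])
    fix t assume "\<bar>t\<bar> \<le> 7 * \<epsilon>"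
    then have "\<bar>t / \<epsilon>\<bar> \<le> 7" using eps by (simp add: abs_divide pos_divide_le_eq)
    then have "norm (of_real (t / \<epsilon>) + e (t / \<epsilon>)) < 9"
      using norm_triangle_ineq[of "of_real (t / \<epsilon>)" "e (t / \<epsilon>)"] eb[of "t / \<epsilon>"] unfolding norm_of_real by linarith
    then show "norm (curve C t) < 1" by (simp add: cC norm_divide)
  qed simp
  have TE: "tangle E Is"
  proof (rule tangle)
    show "curve E (t + 1) = curve E t" for t unfolding cE by (rule bump(1))
    fix t
    {
      assume t: "\<bar>t\<bar> \<le> 7 * \<epsilon>"
      then have "\<bar>t / \<epsilon>\<bar> \<le> 7" using eps by (simp add: abs_divide pos_divide_le_eq)
      then have "norm (M (t / \<epsilon>)) < 9" by (rule M_norm)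
      moreover have "cE t = M (t / \<epsilon>) / 9" by (rule near) (use t d7 in linarith)
      ultimately show "norm (curve E t) < 1" unfolding cE by (simp only: norm_divide norm_numeral)
    next
      assume t: "\<bar>t\<bar> \<le> 1 / 2" "7 * \<epsilon> \<le> \<bar>t\<bar>"
      have "\<bar>t - of_int 0\<bar> < 1 - 7 * \<epsilon>"
        unfolding of_int_0 diff_0_right using t(1) d7 by linarith
    then have "cE t = curve C t + g (t - of_int 0)" using bump(4)[of t 0] by blast
      then show "curve E t = curve C t" using supp[of t] t unfolding cE by simp
    }
  qed
  have eab: "7 * \<epsilon> < \<epsilon> * a" "\<epsilon> * a < 11 * \<epsilon>" "7 * \<epsilon> < \<epsilon> * b" "\<epsilon> * b < 11 * \<epsilon>"
    using mult_strict_left_mono[OF a(1) eps(1)] mult_strict_left_mono[OF a(2) eps(1)]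
      mult_strict_left_mono[OF b(1) eps(1)] mult_strict_left_mono[OF b(2) eps(1)] by linarith+
  have in_open: "t \<in> (\<Union>I\<in>set Is. open_strand I)" if ts: "t - s \<in> \<int>" and s: "\<bar>s\<bar> \<le> 7 * \<epsilon>" for t s
  proof -
    obtain n where n: "t - s = of_int n" using ts by (auto elim: Ints_cases)
    then have "t + of_int (- n) = s" by simp
    moreover have "s \<in> {- (\<epsilon> * a)<..<\<epsilon> * b}"
      using s eab unfolding greaterThanLessThan_iff abs_le_iff by linarith
    ultimately have "t \<in> open_strand (- (\<epsilon> * a), \<epsilon> * b)"
      unfolding open_strand_def fst_conv snd_conv by (metis (mono_tags, lifting) mem_Collect_eq)
    then show ?thesis by (simp add: Is_def)
  qed
  have outo: "curve E t = curve C t \<and> mark E t = mark C t" if t: "t \<notin> (\<Union>I\<in>set Is. open_strand I)" for t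
  proof -
    have "7 * \<epsilon> < \<bar>t - of_int (round t)\<bar>" using in_open[OF rnd(2)[of t]] t by force
    then have "curve E t = curve C t" unfolding cE cE_def using supp by simp
    moreover have "t - 2 * \<epsilon> \<notin> \<int>" "t + 2 * \<epsilon> \<notin> \<int>"
      using in_open[of t "2 * \<epsilon>"] in_open[of t "- 2 * \<epsilon>"] t eps by auto
    ultimately show ?thesis by (simp add: mE)
  qed
  have osub: "(\<Union>I\<in>set Is. open_strand I) \<subseteq> S" using open_strand_subset unfolding S_def by blast
  have inS: "\<exists>s. s \<in> {- (\<epsilon> * a)..\<epsilon> * b} \<and> t - s \<in> \<int>" if "t \<in> S" for t
    using that closed_strandE[of t "(- (\<epsilon> * a), \<epsilon> * b)"] unfolding S_def Is_def by auto
  have plainS: "mark C t = Plain" if "t \<in> S" for t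
  proof -
    obtain s where s: "s \<in> {- (\<epsilon> * a)..\<epsilon> * b}" "t - s \<in> \<int>" using inS[OF \<open>t \<in> S\<close>] by blast
    moreover have "\<bar>s\<bar> \<le> 11 * \<epsilon>" using s(1) eab unfolding atLeastAtMost_iff abs_le_iff by linarith
    ultimately show ?thesis using plain[of s] mark_Ints[OF C s(2)] by simp
  qed
  have imm: "closed_immersion (curve E)"
    unfolding cE
  proof (rule closed_immersionI[OF bump(1-3)])
    fix t :: real
    define s where "s = t - of_int (round t)"
    have "c' t = c' s"
      using vector_derivative_periodic[OF virtual_diagram_immersion[OF C] rnd(2)[of t]]
      unfolding s_def[symmetric] vector_derivative_at[OF dC] by simp
    then have "c' t + g' s = (kink' (s / \<epsilon>) + f' (s / \<epsilon>)) / (9 * of_real \<epsilon>)"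
      by (simp add: c'_def g'_def add_divide_distrib diff_divide_distrib)
    moreover have "kink' u + f' u \<noteq> 0" if u: "u = s / \<epsilon>" for u
    proof -
      consider "\<bar>u\<bar> \<le> 6" | "6 \<le> \<bar>u\<bar>" "\<bar>u\<bar> \<le> 11" | "7 \<le> \<bar>u\<bar>" by linarith
      then show ?thesis
      proof cases
        case 1
        then show ?thesis by (simp add: f_in kink'_nonzero)
      next
        case 2
        then have "kink' u = 1" using kink_derivative_pieces(7,8)[of u] by (simp add: kink'_def complex_eq_iff)
        moreover have "norm (f' u) < norm (1 :: complex)" using f'b[of u] 2 by simp
        ultimately show ?thesis by (metis add_eq_0_iff norm_minus_cancel order_less_irrefl)
      next
        case 3
        then have "kink' u = 1" using kink_derivative_pieces(7,8)[of u] by (simp add: kink'_def complex_eq_iff)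
        then have "kink' u + f' u = c' s * (9 * of_real \<epsilon>)"
          using f_out[OF 3] eps unfolding c'_def u by simp
        moreover have "c' s \<noteq> 0"
          using virtual_diagram_immersion[OF C] vector_derivative_at[OF dC]
          unfolding closed_immersion_def by metis
        ultimately show ?thesis using eps by simp
      qed
    qed
    ultimately show "c' t + g' (t - of_int (round t)) \<noteq> 0" using eps unfolding s_def by simp
  qed
  \<comment> \<open>The parameters of the construction lie within a few \<open>\<epsilon>\<close> of
    0, so congruent ones among them are equal, by \<open>\<epsilon> < 1 / 100\<close>.\<close>
  have small_int: "x = 0" if "x \<in> \<int>" "\<bar>x\<bar> < 100 * \<epsilon>" for x
    using Ints_abs_less_1[OF that(1)] that(2) eps by simp
  define P where "P = {(2 * \<epsilon>, - 2 * \<epsilon>), (- 2 * \<epsilon>, 2 * \<epsilon>)}"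
  have PS: "2 * \<epsilon> \<in> S" "- 2 * \<epsilon> \<in> S"
    using in_open[of "2 * \<epsilon>" "2 * \<epsilon>"] in_open[of "- 2 * \<epsilon>" "- 2 * \<epsilon>"] eps osub by auto
  have c2: "curve E (2 * \<epsilon>) = curve E (- 2 * \<epsilon>)"
  proof -
    have "cE (2 * \<epsilon>) = M 2 / 9" "cE (- 2 * \<epsilon>) = M (-2) / 9"
      using near[of "2 * \<epsilon>"] near[of "- 2 * \<epsilon>"] eps by simp_all
    then show ?thesis unfolding cE using M_eq[of 2 "-2"] by (simp only: abs_numeral) simp
  qed
  have mE2: "mark E (2 * \<epsilon>) = Virtual" "mark E (- 2 * \<epsilon>) = Virtual" by (simp_all add: mE)
  have vE: "virtual_diagram E"
  proof (rule virtual_diagram_replace[OF C TC TE, folded S_def, of P])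
    show "curve E t = curve C t \<and> mark E t = mark C t" if "t \<notin> S" for t
      using outo that osub by blast
    show "mark C t = Plain" if "t \<in> S" for t using that by (rule plainS)
    show "closed_immersion (curve E)" by (rule imm)
    show "mark E (t + 1) = mark E t" for t
    proof -
      have "t + 1 - 2 * \<epsilon> \<in> \<int> \<longleftrightarrow> t - 2 * \<epsilon> \<in> \<int>" "t + 1 + 2 * \<epsilon> \<in> \<int> \<longleftrightarrow> t + 2 * \<epsilon> \<in> \<int>"
        using Ints_trans[of "t + 1 - 2 * \<epsilon>" "t - 2 * \<epsilon>" 0] Ints_trans[of "t - 2 * \<epsilon>" "t + 1 - 2 * \<epsilon>" 0]
          Ints_trans[of "t + 1 + 2 * \<epsilon>" "t + 2 * \<epsilon>" 0] Ints_trans[of "t + 2 * \<epsilon>" "t + 1 + 2 * \<epsilon>" 0] by auto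
      then show ?thesis using mark_Ints[OF C, of "t + 1" t] by (simp add: mE)
    qed
    show "finite P" by (simp add: P_def)
    show "p \<in> S \<and> q \<in> S" if "(p, q) \<in> P" for p q using that PS by (auto simp: P_def)
    show "q - q' \<in> \<int>" if "(p, q) \<in> P" "(p', q') \<in> P" "p - p' \<in> \<int>" for p q p' q'
      using that small_int[of "p - p'"] eps by (auto simp: P_def)
    show "double_point (curve E) s t \<longleftrightarrow> (\<exists>(p, q)\<in>P. s - p \<in> \<int> \<and> t - q \<in> \<int>)" if st: "s \<in> S" "t \<in> S" for s t
    proof -
      have per: "\<forall>t. curve E (t + 1) = curve E t" unfolding cE using bump(1) by blast
      obtain s0 where s0: "s0 \<in> {- (\<epsilon> * a)..\<epsilon> * b}" "s - s0 \<in> \<int>" using inS[OF st(1)] by blast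
      obtain t0 where t0: "t0 \<in> {- (\<epsilon> * a)..\<epsilon> * b}" "t - t0 \<in> \<int>" using inS[OF st(2)] by blast
      have b0: "\<bar>s0\<bar> < 11 * \<epsilon>" "\<bar>t0\<bar> < 11 * \<epsilon>" using s0(1) t0(1) eab eps unfolding atLeastAtMost_iff by linarith+
      have cc: "curve E s = M (s0 / \<epsilon>) / 9" "curve E t = M (t0 / \<epsilon>) / 9"
        using periodic_Ints[OF per s0(2)] periodic_Ints[OF per t0(2)] near[of s0] near[of t0] b0 eps
        unfolding cE by auto
      have u: "\<bar>s0 / \<epsilon>\<bar> \<le> 11" "\<bar>t0 / \<epsilon>\<bar> \<le> 11" using b0 eps by (simp_all add: abs_divide pos_divide_le_eq)
      have c_iff: "curve E s = curve E t \<longleftrightarrow> s0 = t0 \<or> (s0 = 2 * \<epsilon> \<and> t0 = - 2 * \<epsilon>) \<or> (s0 = - 2 * \<epsilon> \<and> t0 = 2 * \<epsilon>)"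
      proof -
        have "curve E s = curve E t \<longleftrightarrow> M (s0 / \<epsilon>) = M (t0 / \<epsilon>)" unfolding cc by simp
        also have "\<dots> \<longleftrightarrow> s0 / \<epsilon> = t0 / \<epsilon> \<or> (s0 / \<epsilon> = 2 \<and> t0 / \<epsilon> = -2) \<or> (s0 / \<epsilon> = -2 \<and> t0 / \<epsilon> = 2)"
          by (rule M_eq[OF u])
        finally show ?thesis using eps by (simp add: divide_eq_eq)
      qed
      have i_iff: "s - t \<in> \<int> \<longleftrightarrow> s0 = t0"
      proof
        assume "s - t \<in> \<int>"
        then have "s0 - t0 \<in> \<int>" using s0(2) t0(2) by (meson Ints_sym Ints_trans)
        then show "s0 = t0" using small_int[of "s0 - t0"] b0 by auto
      qed (use s0(2) t0(2) in \<open>meson Ints_sym Ints_trans\<close>)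
      have shift: "r - p \<in> \<int> \<longleftrightarrow> r0 = p" if "r - r0 \<in> \<int>" "\<bar>r0\<bar> < 11 * \<epsilon>" "\<bar>p\<bar> \<le> 2 * \<epsilon>" for r r0 p
      proof
        assume "r - p \<in> \<int>"
        then have "r0 - p \<in> \<int>" using that(1) by (meson Ints_sym Ints_trans)
        then show "r0 = p" using small_int[of "r0 - p"] that(2,3) by auto
      qed (use that in auto)
      have R: "(\<exists>(p, q)\<in>P. s - p \<in> \<int> \<and> t - q \<in> \<int>) \<longleftrightarrow>
          (s - 2 * \<epsilon> \<in> \<int> \<and> t - (- 2 * \<epsilon>) \<in> \<int>) \<or> (s - (- 2 * \<epsilon>) \<in> \<int> \<and> t - 2 * \<epsilon> \<in> \<int>)"
        by (simp only: P_def bex_simps case_prod_conv simp_thms)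
      have small: "\<bar>2 * \<epsilon>\<bar> \<le> 2 * \<epsilon>" "\<bar>- 2 * \<epsilon>\<bar> \<le> 2 * \<epsilon>" using eps by auto
      note sh = shift[OF s0(2) b0(1) small(1)] shift[OF s0(2) b0(1) small(2)]
        shift[OF t0(2) b0(2) small(1)] shift[OF t0(2) b0(2) small(2)]
      show ?thesis unfolding double_point_def R sh c_iff i_iff using eps by auto
    qed
    show "cross2 (vector_derivative (curve E) (at p)) (vector_derivative (curve E) (at q)) \<noteq> 0" if "(p, q) \<in> P" for p q
    proof -
      have "vector_derivative (curve E) (at t) = (1 / (9 * of_real \<epsilon>)) * kink' (t / \<epsilon>)" if t: "\<bar>t\<bar> \<le> 6 * \<epsilon>" for t
      proof -
        have "round t = 0" using t eps by (intro round_unique') auto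
        have "(kink' (t / \<epsilon>) + f' (t / \<epsilon>)) / (9 * of_real \<epsilon>) = c' t + g' (t - of_int (round t))"
          using \<open>round t = 0\<close> by (simp add: c'_def g'_def add_divide_distrib diff_divide_distrib)
        moreover have "f' (t / \<epsilon>) = 0" by (rule f_in) (use t eps in \<open>simp add: abs_divide pos_divide_le_eq\<close>)
        ultimately show ?thesis using vector_derivative_at[OF bump(2)[of t]] unfolding cE by simp
      qed
      note vd = this
      have "vector_derivative (curve E) (at (2 * \<epsilon>)) = (1 / (9 * of_real \<epsilon>)) * kink' 2"
        "vector_derivative (curve E) (at (- 2 * \<epsilon>)) = (1 / (9 * of_real \<epsilon>)) * kink' (-2)"
        using vd[of "2 * \<epsilon>"] vd[of "- 2 * \<epsilon>"] eps by simp_all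
      then have "cross2 (vector_derivative (curve E) (at (2 * \<epsilon>))) (vector_derivative (curve E) (at (- 2 * \<epsilon>))) =
          (norm (1 / (9 * of_real \<epsilon> :: complex)))\<^sup>2 * 10"
        "cross2 (vector_derivative (curve E) (at (- 2 * \<epsilon>))) (vector_derivative (curve E) (at (2 * \<epsilon>))) =
          (norm (1 / (9 * of_real \<epsilon> :: complex)))\<^sup>2 * - 10"
        by (simp_all only: cross2_mult cross2_kink')
      moreover have "norm (1 / (9 * of_real \<epsilon> :: complex)) \<noteq> 0" using eps by simp
      ultimately have "cross2 (vector_derivative (curve E) (at (2 * \<epsilon>))) (vector_derivative (curve E) (at (- 2 * \<epsilon>))) \<noteq> 0"
        "cross2 (vector_derivative (curve E) (at (- 2 * \<epsilon>))) (vector_derivative (curve E) (at (2 * \<epsilon>))) \<noteq> 0"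
        by (metis mult_eq_0_iff power_not_zero zero_neq_numeral neg_equal_0_iff_equal)+
      then show ?thesis using that unfolding P_def by blast
    qed
    show "mark E t = Plain \<longleftrightarrow> \<not> (\<exists>(p, q)\<in>P. t - p \<in> \<int>)" if "t \<in> S" for t
      using plainS[OF that] by (auto simp: mE P_def)
    show "(mark E p, mark E q) \<in> {(Over, Under), (Under, Over), (Virtual, Virtual)}" if "(p, q) \<in> P" for p q
      using that mE2 by (auto simp: P_def)
  qed
  have plE: "mark E t = Plain" if t: "\<bar>t\<bar> \<le> 11 * \<epsilon>" "t \<noteq> 2 * \<epsilon>" "t \<noteq> - 2 * \<epsilon>" for t
  proof -
    have "t - 2 * \<epsilon> \<notin> \<int>" "t + 2 * \<epsilon> \<notin> \<int>"
    proof -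
      have "\<bar>t - 2 * \<epsilon>\<bar> < 100 * \<epsilon>" "\<bar>t + 2 * \<epsilon>\<bar> < 100 * \<epsilon>" using t(1) eps(1) by linarith+
      then show "t - 2 * \<epsilon> \<notin> \<int>" "t + 2 * \<epsilon> \<notin> \<int>"
        using small_int[of "t - 2 * \<epsilon>"] small_int[of "t + 2 * \<epsilon>"] t(2,3) by auto
    qed
    then show ?thesis using plain[OF t(1)] by (simp add: mE)
  qed
  have "kink_added {Virtual} C E"
    unfolding kink_added_def
  proof (intro exI conjI)
    show "local_change [(- (\<epsilon> * a), \<epsilon> * b)] C E"
      using TC TE outo unfolding local_change_def Is_def by blast
    show "plain_on C {- (\<epsilon> * a)..\<epsilon> * b}" 
      unfolding plain_on_def
    proof
      fix t assume "t \<in> {- (\<epsilon> * a)..\<epsilon> * b}"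
      then have "\<bar>t\<bar> \<le> 11 * \<epsilon>" using eab unfolding atLeastAtMost_iff abs_le_iff by linarith
      then show "mark C t = Plain" by (rule plain)
    qed
    show "- (\<epsilon> * a) < - 2 * \<epsilon>" "- 2 * \<epsilon> < 2 * \<epsilon>" "2 * \<epsilon> < \<epsilon> * b" using eab eps by linarith+
    show "curve E (- 2 * \<epsilon>) = curve E (2 * \<epsilon>)" using c2 by simp
    show "mark E (- 2 * \<epsilon>) \<in> {Virtual}" using mE2 by simp
    show "plain_on E ({- (\<epsilon> * a)..\<epsilon> * b} - {- 2 * \<epsilon>, 2 * \<epsilon>})"
      unfolding plain_on_def
    proof
      fix t assume t: "t \<in> {- (\<epsilon> * a)..\<epsilon> * b} - {- 2 * \<epsilon>, 2 * \<epsilon>}"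
      then have "\<bar>t\<bar> \<le> 11 * \<epsilon>" using eab unfolding Diff_iff atLeastAtMost_iff abs_le_iff by linarith
      then show "mark E t = Plain" using t by (intro plE) auto
    qed
  qed
  then have "reidemeister_move VRI C E" by (simp add: reidemeister_move_def)
  moreover have "move_sequence D [] C" using move_sequence.isotopy[OF move_sequence.start[OF D] iso C] .
  ultimately have "move_sequence D [VRI] E" using move_sequence.move[of D "[]" C VRI E] vE by simp
  \<comment> \<open>Undoes the division by 9 that the unit disk required, so that the curve near 0
    is \<open>kink\<close> itself.\<close>
  moreover define E9 where "E9 = rescale 9 0 0 E"
  ultimately have ms: "move_sequence D [VRI] E9"
    using move_sequence.isotopy[of D "[VRI]" E E9] isotopic_rescale[of 9 E 0 0] virtual_diagram_rescale[OF vE, of 9 0 0]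
    by simp
  have cE9: "curve E9 t = 9 * cE t" and mE9: "mark E9 t = mark E t" for t
    by (simp_all add: E9_def rescale_def cE)
  show ?thesis
  proof (rule that[OF ms eps])
    show "curve E9 (\<epsilon> * u) = kink u" if "\<bar>u\<bar> \<le> 6" for u
    proof -
      have "\<bar>\<epsilon> * u\<bar> \<le> \<epsilon> * 6" using that eps by (simp add: abs_mult)
      then have "cE (\<epsilon> * u) = M (\<epsilon> * u / \<epsilon>) / 9" using eps by (intro near) simp
      then show ?thesis using M_in[OF that] eps by (simp add: cE9 mult.commute)
    qed
    show "6 < norm (curve E9 t)" if t: "\<bar>t\<bar> \<le> 1 / 2" "6 * \<epsilon> < \<bar>t\<bar>" for t
    proof -
      define u where "u = t / \<epsilon>"
      have tu: "\<bar>t\<bar> = \<epsilon> * \<bar>u\<bar>" using eps by (simp add: u_def abs_divide)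
      have c: "curve E9 t = M u" using near[OF t(1)] by (simp add: cE9 u_def mult.commute)
      show ?thesis
      proof (cases "\<bar>u\<bar> \<le> 11")
        case True
        have "6 < \<bar>u\<bar>" using t(2) tu eps by simp
        then show ?thesis using ReM[OF _ True] abs_Re_le_cmod[of "M u"] unfolding c by linarith
      next
        case False
        then have "11 * \<epsilon> < \<bar>t\<bar>" using tu eps by simp
        then have "1 < norm (curve C t)" using far t(1) by blast
        moreover have "M u = 9 * curve C t" using M_arm[of u] f_out(1)[of u] False by (simp add: cC u_def)
        ultimately show ?thesis unfolding c by (simp add: norm_mult)
      qed
    qed
    show "mark E9 t = Plain" if "\<bar>t\<bar> \<le> 6 * \<epsilon>" "\<bar>t\<bar> \<noteq> 2 * \<epsilon>" for t
      unfolding mE9 by (rule plE) (use that eps in auto)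
    show "mark E9 t \<in> {Plain, Virtual}" if "\<bar>t\<bar> \<le> 6 * \<epsilon>" for t
    proof (cases "t = 2 * \<epsilon> \<or> t = - 2 * \<epsilon>")
      case True
      then show ?thesis using mE2 unfolding mE9 by auto
    next
      case False
      then show ?thesis using plE[of t] that eps unfolding mE9 by auto
    qed
  qed
qed

section \<open>The bigon\<close>

lemma norm_le_iff_squares:
  assumes "0 \<le> c"
  shows "norm z \<le> c \<longleftrightarrow> (Re z)\<^sup>2 + (Im z)\<^sup>2 \<le> c\<^sup>2" "norm z < c \<longleftrightarrow> (Re z)\<^sup>2 + (Im z)\<^sup>2 < c\<^sup>2"
proof -
  have "norm z \<le> c \<longleftrightarrow> (norm z)\<^sup>2 \<le> c\<^sup>2" using assms by (metis norm_ge_zero power2_le_imp_le power_mono)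
  then show "norm z \<le> c \<longleftrightarrow> (Re z)\<^sup>2 + (Im z)\<^sup>2 \<le> c\<^sup>2" by (simp only: cmod_power2)
  have "norm z < c \<longleftrightarrow> (norm z)\<^sup>2 < c\<^sup>2"
    using assms by (metis norm_ge_zero power2_less_imp_less power_strict_mono zero_less_numeral)
  then show "norm z < c \<longleftrightarrow> (Re z)\<^sup>2 + (Im z)\<^sup>2 < c\<^sup>2" by (simp only: cmod_power2)
qed

text \<open>
  The bigon is made in the disk with the following centre and radius \<open>7 / 10\<close>. It meets the kink in two
  chords, one on the incoming ray and one on the straight segment above it, whose halves have the
  lengths \<open>low_half\<close> and \<open>high_half\<close> in terms of the parameter.
\<close>

definition disk_centre :: complex where
  "disk_centre = Complex (-4) (13 / 20)"

text \<open>The squared radius minus the square of the distance \<open>13 / 20\<close> from the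
  centre to the ray.\<close>

definition low_half :: real where
  "low_half = sqrt (27 / 400)"

text \<open>On the segment the squared distance from the centre is
  \<open>26 * (u - 49 / 40)\<^sup>2 + 13 / 32\<close>, where 26 is the squared speed. The squared
  radius exceeds \<open>13 / 32\<close> by \<open>67 / 800\<close>, which is divided by 26.\<close>

definition high_half :: real where
  "high_half = sqrt (67 / 20800)"

lemma low_half: "1 / 4 < low_half" "low_half < 1 / 2"
  unfolding low_half_def
  by (rule real_less_rsqrt, simp add: power2_eq_square) (rule real_less_lsqrt; simp add: power2_eq_square)

lemma high_half: "1 / 200 < high_half" "high_half < 1 / 10"
  unfolding high_half_def
  by (rule real_less_rsqrt, simp add: power2_eq_square) (rule real_less_lsqrt; simp add: power2_eq_square)

lemma abs_le_sqrt_iff: "0 \<le> c \<Longrightarrow> \<bar>x\<bar> \<le> sqrt c \<longleftrightarrow> x\<^sup>2 \<le> c" "0 \<le> c \<Longrightarrow> \<bar>x\<bar> < sqrt c \<longleftrightarrow> x\<^sup>2 < c"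
  by (metis real_sqrt_abs real_sqrt_le_iff) (metis real_sqrt_abs real_sqrt_less_iff)

lemma low_chord:
  assumes "u \<le> -3"
  shows "norm (kink u - disk_centre) \<le> 7 / 10 \<longleftrightarrow> \<bar>u + 4\<bar> \<le> low_half"
    "norm (kink u - disk_centre) < 7 / 10 \<longleftrightarrow> \<bar>u + 4\<bar> < low_half"
proof -
  have k: "kink_abscissa u = u" "kink_height u = 0" using kink_outside[of u] assms by auto
  have sq: "(Re (kink u - disk_centre))\<^sup>2 + (Im (kink u - disk_centre))\<^sup>2 = (u + 4)\<^sup>2 - 27 / 400 + (7 / 10)\<^sup>2"
    by (simp add: k disk_centre_def power2_eq_square algebra_simps)
  have nn: "(0 :: real) \<le> 7 / 10" by simp
  have "norm (kink u - disk_centre) \<le> 7 / 10 \<longleftrightarrow> (u + 4)\<^sup>2 \<le> 27 / 400"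
    unfolding norm_le_iff_squares(1)[OF nn] sq by (rule iffI; linarith)
  also have "\<dots> \<longleftrightarrow> \<bar>u + 4\<bar> \<le> low_half"
    unfolding low_half_def by (rule abs_le_sqrt_iff(1)[symmetric]) simp
  finally show "norm (kink u - disk_centre) \<le> 7 / 10 \<longleftrightarrow> \<bar>u + 4\<bar> \<le> low_half" .
  have "norm (kink u - disk_centre) < 7 / 10 \<longleftrightarrow> (u + 4)\<^sup>2 < 27 / 400"
    unfolding norm_le_iff_squares(2)[OF nn] sq by (rule iffI; linarith)
  also have "\<dots> \<longleftrightarrow> \<bar>u + 4\<bar> < low_half"
    unfolding low_half_def by (rule abs_le_sqrt_iff(2)[symmetric]) simp
  finally show "norm (kink u - disk_centre) < 7 / 10 \<longleftrightarrow> \<bar>u + 4\<bar> < low_half" .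
qed

lemma high_chord:
  assumes "1 \<le> u" "u \<le> 2"
  shows "norm (kink u - disk_centre) \<le> 7 / 10 \<longleftrightarrow> \<bar>u - 49 / 40\<bar> \<le> high_half"
    "norm (kink u - disk_centre) < 7 / 10 \<longleftrightarrow> \<bar>u - 49 / 40\<bar> < high_half"
proof -
  have k: "kink_abscissa u = 5 * u - 10" "kink_height u = 5 / 2 - u"
    using kink_abscissa_pieces(2)[OF assms] kink_height_pieces(2)[OF assms] by auto
  have sq: "(Re (kink u - disk_centre))\<^sup>2 + (Im (kink u - disk_centre))\<^sup>2 =
      26 * (u - 49 / 40)\<^sup>2 - 67 / 800 + (7 / 10)\<^sup>2"
    by (simp add: k disk_centre_def power2_eq_square algebra_simps)
  have nn: "(0 :: real) \<le> 7 / 10" by simp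
  have "norm (kink u - disk_centre) \<le> 7 / 10 \<longleftrightarrow> (u - 49 / 40)\<^sup>2 \<le> 67 / 20800"
    unfolding norm_le_iff_squares(1)[OF nn] sq by (rule iffI; linarith)
  also have "\<dots> \<longleftrightarrow> \<bar>u - 49 / 40\<bar> \<le> high_half"
    unfolding high_half_def by (rule abs_le_sqrt_iff(1)[symmetric]) simp
  finally show "norm (kink u - disk_centre) \<le> 7 / 10 \<longleftrightarrow> \<bar>u - 49 / 40\<bar> \<le> high_half" .
  have "norm (kink u - disk_centre) < 7 / 10 \<longleftrightarrow> (u - 49 / 40)\<^sup>2 < 67 / 20800"
    unfolding norm_le_iff_squares(2)[OF nn] sq by (rule iffI; linarith)
  also have "\<dots> \<longleftrightarrow> \<bar>u - 49 / 40\<bar> < high_half"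
    unfolding high_half_def by (rule abs_le_sqrt_iff(2)[symmetric]) simp
  finally show "norm (kink u - disk_centre) < 7 / 10 \<longleftrightarrow> \<bar>u - 49 / 40\<bar> < high_half" .
qed

text \<open>The remaining pieces miss the disk by one coordinate: between -3 and -1 and beyond 2 the
  kink is too far to the right, and the arch over \<open>\<bar>u\<bar> \<le> 1\<close> has height at
  least \<open>3 / 2\<close>.\<close>

lemma kink_in_disk:
  shows "norm (kink u - disk_centre) \<le> 7 / 10 \<longleftrightarrow> \<bar>u + 4\<bar> \<le> low_half \<or> \<bar>u - 49 / 40\<bar> \<le> high_half"
    "norm (kink u - disk_centre) < 7 / 10 \<longleftrightarrow> \<bar>u + 4\<bar> < low_half \<or> \<bar>u - 49 / 40\<bar> < high_half"
proof -
  let ?d = "norm (kink u - disk_centre)"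
  have re: "\<bar>kink_abscissa u + 4\<bar> \<le> ?d" using abs_Re_le_cmod[of "kink u - disk_centre"] by (simp add: disk_centre_def)
  have im: "\<bar>kink_height u - 13 / 20\<bar> \<le> ?d" using abs_Im_le_cmod[of "kink u - disk_centre"] by (simp add: disk_centre_def)
  have nl: "\<not> \<bar>u + 4\<bar> \<le> low_half" "\<not> \<bar>u + 4\<bar> < low_half" if "-3 < u" using that low_half by linarith+
  have nh: "\<not> \<bar>u - 49 / 40\<bar> \<le> high_half" "\<not> \<bar>u - 49 / 40\<bar> < high_half" if "u \<le> 1 \<or> 2 \<le> u"
    using that high_half by linarith+
  have nd: "\<not> ?d \<le> 7 / 10" "\<not> ?d < 7 / 10" if "7 / 10 < ?d" using that by linarith+
  consider "u \<le> -3" | "-3 < u" "u \<le> -1" | "\<bar>u\<bar> \<le> 1" | "1 \<le> u" "u \<le> 2" | "2 \<le> u" by linarith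
  then have "(?d \<le> 7 / 10 \<longleftrightarrow> \<bar>u + 4\<bar> \<le> low_half \<or> \<bar>u - 49 / 40\<bar> \<le> high_half) \<and>
    (?d < 7 / 10 \<longleftrightarrow> \<bar>u + 4\<bar> < low_half \<or> \<bar>u - 49 / 40\<bar> < high_half)"
  proof cases
    case 1
    then have "u \<le> 1 \<or> 2 \<le> u" by simp
    then show ?thesis using low_chord[OF 1] nh by blast
  next
    case 2
    then have "7 / 10 < ?d" using re kink_abscissa_bounds(3)[of u] by linarith
    moreover have "u \<le> 1 \<or> 2 \<le> u" using 2 by simp
    ultimately show ?thesis using nd nl nh 2 by blast
  next
    case 3
    have "\<bar>u\<bar>\<^sup>2 \<le> 1" using 3 by (intro power_le_one) auto
    then have "kink_height \<bar>u\<bar> \<ge> 3 / 2" using kink_height_pieces(1)[of "\<bar>u\<bar>"] 3 by simp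
    then have "kink_height u \<ge> 3 / 2" using kink_height_minus[of u] by (simp add: abs_if split: if_splits)
    then have "7 / 10 < ?d" using im by linarith
    moreover have "u \<le> 1 \<or> 2 \<le> u" "-3 < u" using 3 by auto
    ultimately show ?thesis using nd nl nh by blast
  next
    case 4
    then have "-3 < u" by simp
    then show ?thesis using high_chord[OF 4] nl by blast
  next
    case 5
    then have "7 / 10 < ?d" using re kink_abscissa_bounds(4)[of u] by linarith
    moreover have "u \<le> 1 \<or> 2 \<le> u" "-3 < u" using 5 by auto
    ultimately show ?thesis using nd nl nh by blast
  qed
  then show "?d \<le> 7 / 10 \<longleftrightarrow> \<bar>u + 4\<bar> \<le> low_half \<or> \<bar>u - 49 / 40\<bar> \<le> high_half"
    "?d < 7 / 10 \<longleftrightarrow> \<bar>u + 4\<bar> < low_half \<or> \<bar>u - 49 / 40\<bar> < high_half" by blast+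
qed

section \<open>Pushing the upper strand across the lower one\<close>

text \<open>
  The upper strand is pushed down by multiplying its height with \<open>1 - 51 / 50 * dip u\<close>, where the
  bump \<open>dip\<close> has maximum 1. So it crosses the lower strand exactly where \<open>dip u = 50 / 51\<close>.
\<close>

definition dip :: "real \<Rightarrow> real" where
  "dip u = posq (1 - (200 * (u - 49 / 40))\<^sup>2)"

definition dip' :: "real \<Rightarrow> real" where
  "dip' u = 2 * max 0 (1 - (200 * (u - 49 / 40))\<^sup>2) * (- 80000 * (u - 49 / 40))"

lemma DERIV_dip: "(dip has_real_derivative dip' u) (at u)"
  unfolding dip_def dip'_def by (rule derivative_eq_intros refl | simp add: algebra_simps)+

lemma dip_outside:
  assumes "1 / 200 \<le> \<bar>u - 49 / 40\<bar>"
  shows "dip u = 0" "dip' u = 0"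
proof -
  have "(1 :: real) = 200 * (1 / 200)" by simp
  also have "\<dots> \<le> 200 * \<bar>u - 49 / 40\<bar>" using assms by (intro mult_left_mono) auto
  also have "\<dots> = \<bar>200 * (u - 49 / 40)\<bar>" by (simp only: abs_mult abs_numeral)
  finally have "1 \<le> \<bar>200 * (u - 49 / 40)\<bar>" .
  then have "1 \<le> (200 * (u - 49 / 40))\<^sup>2" by (metis one_le_power power2_abs)
  then show "dip u = 0" "dip' u = 0" by (simp_all add: dip_def dip'_def posq_neg)
qed

lemma dip_bounds: "0 \<le> dip u" "dip u \<le> 1"
  unfolding dip_def by (rule posq_nonneg) (rule posq_le_1, simp)

text \<open>The distance of the crossings from the middle parameter \<open>49 / 40\<close>: the
  positive solution of \<open>(1 - (200 * x)\<^sup>2)\<^sup>2 = 50 / 51\<close> inside the support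
  of \<open>dip\<close>.\<close>

definition dip_offset :: real where
  "dip_offset = sqrt (1 - sqrt (50 / 51)) / 200"

lemma dip_offset: "0 < dip_offset" "dip_offset < 1 / 200"
proof -
  have "0 < sqrt (50 / 51 :: real)" "sqrt (50 / 51) < (1 :: real)" by simp_all
  then have "0 < sqrt (1 - sqrt (50 / 51))" "sqrt (1 - sqrt (50 / 51)) < 1" by (simp_all add: real_sqrt_lt_1_iff)
  then show "0 < dip_offset" "dip_offset < 1 / 200" by (simp_all add: dip_offset_def)
qed

lemma dip_eq_iff: "dip u = 50 / 51 \<longleftrightarrow> u = 49 / 40 - dip_offset \<or> u = 49 / 40 + dip_offset"
proof -
  define v where "v = 200 * (u - 49 / 40)"
  have r: "0 < sqrt (50 / 51 :: real)" "sqrt (50 / 51) < (1 :: real)" by simp_all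
  have "dip u = 50 / 51 \<longleftrightarrow> 1 - v\<^sup>2 = sqrt (50 / 51)"
  proof (cases "0 \<le> 1 - v\<^sup>2")
    case True
    then have "dip u = (1 - v\<^sup>2)\<^sup>2" by (simp add: dip_def v_def posq_pos)
    moreover have "x\<^sup>2 = 50 / 51 \<longleftrightarrow> x = sqrt (50 / 51)" if "0 \<le> x" for x :: real
      using that real_sqrt_unique[of x "50 / 51"] real_sqrt_pow2[of "50 / 51"] by (metis divide_nonneg_nonneg zero_le_numeral)
    ultimately show ?thesis using True by metis
  next
    case False
    then have "dip u = 0" by (simp add: dip_def v_def posq_neg)
    moreover have "1 - v\<^sup>2 \<noteq> sqrt (50 / 51)" using False r(1) by linarith
    ultimately show ?thesis by simp
  qed
  also have "\<dots> \<longleftrightarrow> v\<^sup>2 = (sqrt (1 - sqrt (50 / 51)))\<^sup>2" using r by auto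
  also have "\<dots> \<longleftrightarrow> v = - sqrt (1 - sqrt (50 / 51)) \<or> v = sqrt (1 - sqrt (50 / 51))"
    unfolding power2_eq_iff by blast
  also have "\<dots> \<longleftrightarrow> u = 49 / 40 - dip_offset \<or> u = 49 / 40 + dip_offset"
    unfolding dip_offset_def v_def by (auto simp: field_simps)
  finally show ?thesis .
qed

text \<open>The slope of \<open>dip\<close> vanishes only at its maximum and off its support, where
  the value is not \<open>50 / 51\<close>. This gives the transversality of the two
  crossings.\<close>

lemma dip'_nonzero:
  assumes "dip u = 50 / 51"
  shows "dip' u \<noteq> 0"
proof -
  have "u \<noteq> 49 / 40" using assms dip_eq_iff[of u] dip_offset by auto
  moreover have "1 - (200 * (u - 49 / 40))\<^sup>2 > 0"
    using assms posq_neg[of "1 - (200 * (u - 49 / 40))\<^sup>2"] by (force simp: dip_def not_less[symmetric])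
  ultimately show ?thesis by (simp add: dip'_def)
qed

text \<open>The vertical displacement of the segment, whose height is \<open>5 / 2 - u\<close>. As a
  function supported near \<open>49 / 40\<close> it can be added as a periodic bump.\<close>

definition push :: "real \<Rightarrow> real" where
  "push u = - (51 / 50 * (5 / 2 - u) * dip u)"

definition push' :: "real \<Rightarrow> real" where
  "push' u = 51 / 50 * dip u - 51 / 50 * (5 / 2 - u) * dip' u"

lemma DERIV_push: "(push has_real_derivative push' u) (at u)"
  unfolding push_def push'_def by (rule DERIV_dip derivative_eq_intros refl | simp add: algebra_simps)+

lemma push_outside: "1 / 200 \<le> \<bar>u - 49 / 40\<bar> \<Longrightarrow> push u = 0" "1 / 200 \<le> \<bar>u - 49 / 40\<bar> \<Longrightarrow> push' u = 0"
  by (simp_all add: push_def push'_def dip_outside)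

text \<open>The factor 51/50 exceeds 1 only slightly, so the pushed strand passes the axis without
  falling below \<open>- 13 / 500\<close>. With the narrow support of \<open>dip\<close> this keeps
  it in the open disk, as
  \<open>(169 / 250)\<^sup>2 + (3 / 20)\<^sup>2 < (7 / 10)\<^sup>2\<close>.\<close>

lemma pushed_in_disk:
  assumes "\<bar>u - 49 / 40\<bar> < 1 / 200"
  shows "norm (kink u + Complex 0 (push u) - disk_centre) < 7 / 10"
proof -
  have u: "1 \<le> u" "u \<le> 2" "24 / 20 < u" "u < 25 / 20" using assms by linarith+
  have k: "kink_abscissa u = 5 * u - 10" "kink_height u = 5 / 2 - u"
    using kink_abscissa_pieces(2)[OF u(1,2)] kink_height_pieces(2)[OF u(1,2)] by auto
  define s where "s = 1 - 51 / 50 * dip u"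
  have s: "- (1 / 50) \<le> s" "s \<le> 1" using dip_bounds[of u] by (auto simp: s_def)
  define y where "y = (5 / 2 - u) * s"
  have "(5 / 2 - u) * s \<le> (5 / 2 - u) * 1" using s u by (intro mult_left_mono) auto
  then have "y \<le> 5 / 2 - u" by (simp only: y_def mult_1_right)
  then have y1: "y \<le> 13 / 10" using u by linarith
  have "(5 / 2 - u) * (- (1 / 50)) \<le> (5 / 2 - u) * s" using s u by (intro mult_left_mono) auto
  moreover have "(5 / 2 - u) * (- (1 / 50)) = u / 50 - 1 / 20" by (simp add: field_simps)
  ultimately have y2: "- (13 / 500) \<le> y" using u by (simp only: y_def)
  have "\<bar>y - 13 / 20\<bar> \<le> 169 / 250" unfolding abs_le_iff using y1 y2 by linarith
  then have "\<bar>y - 13 / 20\<bar>\<^sup>2 \<le> (169 / 250)\<^sup>2" by (intro power_mono) auto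
  moreover have "\<bar>5 * u - 6\<bar> \<le> 3 / 20" using assms by linarith
  then have "\<bar>5 * u - 6\<bar>\<^sup>2 \<le> (3 / 20)\<^sup>2" by (intro power_mono) auto
  moreover have "(169 / 250)\<^sup>2 + (3 / 20)\<^sup>2 < (7 / 10 :: real)\<^sup>2" by (simp add: power2_eq_square)
  ultimately have lt: "(5 * u - 6)\<^sup>2 + (y - 13 / 20)\<^sup>2 < (7 / 10)\<^sup>2" unfolding power2_abs by linarith
  have c: "Re (kink u + Complex 0 (push u) - disk_centre) = 5 * u - 6"
    "Im (kink u + Complex 0 (push u) - disk_centre) = y - 13 / 20"
    by (simp_all add: k disk_centre_def y_def s_def push_def algebra_simps)
  show ?thesis using lt norm_le_iff_squares(2)[of "7 / 10" "kink u + Complex 0 (push u) - disk_centre"] unfolding c by simp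
qed

lemma card_four: "a < b \<Longrightarrow> b < c \<Longrightarrow> c < d \<Longrightarrow> card {a, b, c, d :: real} = 4"
  by auto

lemma sum_four:
  "a < b \<Longrightarrow> b < c \<Longrightarrow> c < d \<Longrightarrow> (\<Sum>x\<in>{a, b, c, d :: real}. f x) = f a + f b + f c + (f d :: int)"
  by auto

section \<open>The type II move on the kink\<close>

text \<open>Both strands run to the right, so they pass the two crossings in the same order and the
  chords are interleaved. From the first strand to the second the curve meets only virtual
  crossings, so no other real ends come between.\<close>

lemma bigon_move:
  assumes C: "virtual_diagram C" and eps: "0 < \<epsilon>" "\<epsilon> < 1 / 100"
    and cC: "\<And>u. \<bar>u\<bar> \<le> 6 \<Longrightarrow> curve C (\<epsilon> * u) = kink u"
    and far: "\<And>t. \<bar>t\<bar> \<le> 1 / 2 \<Longrightarrow> 6 * \<epsilon> < \<bar>t\<bar> \<Longrightarrow> 6 < norm (curve C t)"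
    and mC: "\<And>t. \<bar>t\<bar> \<le> 6 * \<epsilon> \<Longrightarrow> mark C t \<in> {Plain, Virtual}"
    and plain: "\<And>t. \<bar>t\<bar> \<le> 6 * \<epsilon> \<Longrightarrow> \<bar>t\<bar> \<noteq> 2 * \<epsilon> \<Longrightarrow> mark C t = Plain"
  obtains B E where "isotopic C B" "virtual_diagram B" "bigon_added Over B E" "virtual_diagram E"
    "odd_number E = odd_number B + 4"
proof -
  \<comment> \<open>Scales the disk of radius \<open>7 / 10\<close> to the unit disk.\<close>
  define k :: complex where "k = 10 / 7"
  have k0: "k \<noteq> 0" by (simp add: k_def)
  define B where "B = rescale k (- k * disk_centre) 0 C"
  have isoB: "isotopic C B" and B: "virtual_diagram B"
    unfolding B_def using isotopic_rescale[OF k0] virtual_diagram_rescale[OF C k0] by auto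
  have cB: "curve B t = k * (curve C t - disk_centre)" and mB: "mark B t = mark C t" for t
    by (simp_all add: B_def rescale_def algebra_simps)
  have normk: "norm (k * z) \<le> 1 \<longleftrightarrow> norm z \<le> 7 / 10" "norm (k * z) < 1 \<longleftrightarrow> norm z < 7 / 10" for z
    by (auto simp: k_def norm_mult norm_divide)
  have near: "curve C t = kink (t / \<epsilon>)" "\<bar>t / \<epsilon>\<bar> \<le> 6" if "\<bar>t\<bar> \<le> 6 * \<epsilon>" for t
  proof -
    show u: "\<bar>t / \<epsilon>\<bar> \<le> 6" using that eps by (simp add: abs_divide pos_divide_le_eq)
    show "curve C t = kink (t / \<epsilon>)" using cC[OF u] eps by simp
  qed
  obtain b' where dB: "\<And>t. (curve B has_vector_derivative b' t) (at t)" and cont_b': "continuous_on UNIV b'"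
    and b'0: "\<And>t. b' t \<noteq> 0"
    using closed_immersion_derivative[OF virtual_diagram_immersion[OF B]] by blast
  have scale: "((\<lambda>t. h (t / \<epsilon>)) has_vector_derivative h' / of_real \<epsilon>) (at t)"
    if "(h has_vector_derivative h') (at (t / \<epsilon>))" for h :: "real \<Rightarrow> complex" and h' t
  proof -
    have "((\<lambda>t. h (t / \<epsilon>)) has_vector_derivative (1 / \<epsilon>) *\<^sub>R h') (at t)"
      using has_vector_derivative_affine[of h h' "1 / \<epsilon>" t 0] that by simp
    then show ?thesis by (simp add: scaleR_conv_of_real)
  qed
  have b': "b' t = k * (kink' (t / \<epsilon>) / of_real \<epsilon>)" if "\<bar>t\<bar> < 6 * \<epsilon>" for t
  proof -
    have "((\<lambda>t. k * (kink (t / \<epsilon>) - disk_centre)) has_vector_derivative k * (kink' (t / \<epsilon>) / of_real \<epsilon> - 0)) (at t)"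
      by (intro has_vector_derivative_mult_right has_vector_derivative_diff scale kink_has_vector_derivative
        has_vector_derivative_const)
    then have "(curve B has_vector_derivative k * (kink' (t / \<epsilon>) / of_real \<epsilon> - 0)) (at t)"
    proof (rule has_vector_derivative_transform_within_open)
      show "open {t. \<bar>t\<bar> < 6 * \<epsilon>}" by (intro open_Collect_less continuous_intros)
    qed (use that near(1) cB in auto)
    then show ?thesis using vector_derivative_at dB by (metis diff_zero)
  qed
  define g where "g t = k * (\<i> * of_real (push (t / \<epsilon>)))" for t
  define g' where "g' t = k * (\<i> * of_real (push' (t / \<epsilon>)) / of_real \<epsilon>)" for t
  have dg: "(g has_vector_derivative g' t) (at t)" for t
    unfolding g_def[abs_def] g'_def
    by (intro has_vector_derivative_mult_right scale[of "\<lambda>u. \<i> * of_real (push u)"] has_vector_derivative_of_real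
      DERIV_push)
  have cont_g': "continuous_on UNIV g'"
  proof -
    have d: "continuous_on UNIV dip" using DERIV_dip by (meson DERIV_isCont continuous_at_imp_continuous_on)
    have "continuous_on UNIV push'" unfolding push'_def dip'_def by (intro continuous_intros d)
    then have "continuous_on UNIV (\<lambda>t. push' (t / \<epsilon>))"
      by (rule continuous_on_compose2) (use eps in \<open>auto intro!: continuous_intros\<close>)
    then show ?thesis unfolding g'_def using eps by (intro continuous_intros) auto
  qed
  have supp: "g t = 0" if "2 * \<epsilon> \<le> \<bar>t\<bar>" for t
  proof -
    have "2 \<le> \<bar>t / \<epsilon>\<bar>" using that eps by (simp add: abs_divide pos_le_divide_eq)
    then have "1 / 200 \<le> \<bar>t / \<epsilon> - 49 / 40\<bar>" by linarith
    then show ?thesis by (simp add: g_def push_outside)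
  qed
  have d2: "2 * \<epsilon> < 1 / 2" using eps by simp
  define cE where "cE t = curve B t + g (t - of_int (round t))" for t
  note bump = periodic_bump[of "curve B" b' g g' "2 * \<epsilon>" cE, OF virtual_diagram_periodic[OF B] dB cont_b' dg cont_g'
      supp d2 cE_def refl]
  have cE0: "cE t = curve B t + g t" if "\<bar>t\<bar> \<le> 1 / 2" for t
  proof -
    have "\<bar>t - of_int 0\<bar> < 1 - 2 * \<epsilon>"
      unfolding of_int_0 diff_0_right using that d2 by linarith
    then show ?thesis using bump(4)[of t 0] by simp
  qed
  have cE_near: "cE t = k * (kink (t / \<epsilon>) + Complex 0 (push (t / \<epsilon>)) - disk_centre)" if "\<bar>t\<bar> \<le> 6 * \<epsilon>" for t
  proof -
    have "\<bar>t\<bar> \<le> 1 / 2" using that eps by linarith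
    then have "cE t = curve B t + g t" by (rule cE0)
    also have "curve B t = k * (kink (t / \<epsilon>) - disk_centre)" by (simp add: cB near(1)[OF that])
    also have "g t = k * Complex 0 (push (t / \<epsilon>))" by (simp add: g_def Complex_eq)
    finally show ?thesis by (simp add: algebra_simps)
  qed
  define w1 where "w1 = 49 / 40 - dip_offset"
  define w2 where "w2 = 49 / 40 + dip_offset"
  \<comment> \<open>The abscissa is \<open>5 * u - 10\<close> on the segment and the parameter
    itself on the ray, so this is the parameter of the ray at the crossing with
    \<open>w1\<close>.\<close>
  define a1 where "a1 = 5 * w1 - 10"
  define a2 where "a2 = 5 * w2 - 10"
  have w: "\<bar>w1 - 49 / 40\<bar> < 1 / 200" "\<bar>w2 - 49 / 40\<bar> < 1 / 200" "w1 < w2"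
    using dip_offset by (auto simp: w1_def w2_def)
  have a: "\<bar>a1 + 4\<bar> < 1 / 4" "\<bar>a2 + 4\<bar> < 1 / 4" "a1 < a2"
    using dip_offset by (auto simp: a1_def a2_def w1_def w2_def abs_less_iff)
  have w': "1 < w1" "w2 < 2" and a': "-5 < a1" "a2 < -3" using w a by linarith+
  define Z where "Z = {\<epsilon> * a1, \<epsilon> * a2, \<epsilon> * w1, \<epsilon> * w2}"
  define mE where "mE t = (if t - \<epsilon> * a1 \<in> \<int> \<or> t - \<epsilon> * a2 \<in> \<int> then Over
      else if t - \<epsilon> * w1 \<in> \<int> \<or> t - \<epsilon> * w2 \<in> \<int> then Under else mark B t)" for t
  define E where "E = \<lparr>curve = cE, mark = mE\<rparr>"
  have cE: "curve E = cE" and mE: "mark E = mE" by (simp_all add: E_def)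
  have perE: "cE (t + 1) = cE t" for t by (rule bump(1))
  define I1 where "I1 = (\<epsilon> * (- 4 - low_half), \<epsilon> * (- 4 + low_half))"
  define I2 where "I2 = (\<epsilon> * (49 / 40 - high_half), \<epsilon> * (49 / 40 + high_half))"
  define Is where "Is = [I1, I2]"
  define S where "S = (\<Union>I\<in>set Is. closed_strand I)"
  have in1: "t \<in> {fst I1..snd I1} \<longleftrightarrow> \<bar>t / \<epsilon> + 4\<bar> \<le> low_half" "t \<in> {fst I1<..<snd I1} \<longleftrightarrow> \<bar>t / \<epsilon> + 4\<bar> < low_half" for t
    unfolding I1_def fst_conv snd_conv atLeastAtMost_iff greaterThanLessThan_iff
    using eps by (auto simp: pos_le_divide_eq[symmetric] pos_divide_le_eq[symmetric] pos_less_divide_eq[symmetric]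
      pos_divide_less_eq[symmetric] mult.commute[of \<epsilon>] abs_le_iff abs_less_iff)
  have in2: "t \<in> {fst I2..snd I2} \<longleftrightarrow> \<bar>t / \<epsilon> - 49 / 40\<bar> \<le> high_half" "t \<in> {fst I2<..<snd I2} \<longleftrightarrow> \<bar>t / \<epsilon> - 49 / 40\<bar> < high_half" for t
    unfolding I2_def fst_conv snd_conv atLeastAtMost_iff greaterThanLessThan_iff
    using eps by (auto simp: pos_le_divide_eq[symmetric] pos_divide_le_eq[symmetric] pos_less_divide_eq[symmetric]
      pos_divide_less_eq[symmetric] mult.commute[of \<epsilon>] abs_le_iff abs_less_iff)
  have small1: "-5 * \<epsilon> < t \<and> t < -3 * \<epsilon>" if "t \<in> {fst I1..snd I1}" for t
  proof -
    have "-5 < t / \<epsilon>" "t / \<epsilon> < -3" using that low_half unfolding in1 by linarith+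
    then show ?thesis using eps by (simp add: pos_less_divide_eq pos_divide_less_eq)
  qed
  have small2: "\<epsilon> < t \<and> t < 2 * \<epsilon>" if "t \<in> {fst I2..snd I2}" for t
  proof -
    have "1 < t / \<epsilon>" "t / \<epsilon> < 2" using that high_half unfolding in2 by linarith+
    then show ?thesis using eps by (simp add: pos_less_divide_eq pos_divide_less_eq)
  qed
  \<comment> \<open>For the old and the new diagram at once: they differ only on the pushed piece,
    which is in the open disk in both.\<close>
  have tangle: "tangle X Is" if per: "\<And>t. curve X (t + 1) = curve X t"
    and X: "\<And>t. \<bar>t\<bar> \<le> 6 * \<epsilon> \<Longrightarrow> 1 / 200 \<le> \<bar>t / \<epsilon> - 49 / 40\<bar> \<Longrightarrow> curve X t = curve B t"
    and far': "\<And>t. \<bar>t\<bar> \<le> 1 / 2 \<Longrightarrow> 6 * \<epsilon> < \<bar>t\<bar> \<Longrightarrow> curve X t = curve B t"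
    and Xin: "\<And>t. \<bar>t\<bar> \<le> 6 * \<epsilon> \<Longrightarrow> \<bar>t / \<epsilon> - 49 / 40\<bar> < 1 / 200 \<Longrightarrow> norm (curve X t) < 1" for X
  proof (rule tangleI[OF per])
    show "- (1 / 2) < x \<and> x < y \<and> y < 1 / 2" if "(x, y) \<in> set Is" for x y
    proof -
      have le: "fst I1 < snd I1" "fst I2 < snd I2" using low_half high_half eps by (auto simp: I1_def I2_def)
      have "x < y" using that le by (auto simp: Is_def)
      moreover have "x \<in> {fst I1..snd I1} \<and> y \<in> {fst I1..snd I1} \<or> x \<in> {fst I2..snd I2} \<and> y \<in> {fst I2..snd I2}"
        using that le by (auto simp: Is_def)
      then have "- (1 / 2) < x \<and> y < 1 / 2" using small1[of x] small1[of y] small2[of x] small2[of y] eps by linarith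
      ultimately show ?thesis by blast
    qed
    have "{fst I1..snd I1} \<inter> {fst I2..snd I2} = {}"
      using small1 small2 eps by (smt (verit) disjoint_iff)
    then show "{fst (Is ! i)..snd (Is ! i)} \<inter> {fst (Is ! j)..snd (Is ! j)} = {}"
      if "i < length Is" "j < length Is" "i \<noteq> j" for i j
      using that by (auto simp: Is_def less_Suc_eq nth_Cons split: nat.splits)
    fix t :: real assume t: "\<bar>t\<bar> \<le> 1 / 2"
    have "(norm (curve X t) \<le> 1 \<longleftrightarrow> \<bar>t / \<epsilon> + 4\<bar> \<le> low_half \<or> \<bar>t / \<epsilon> - 49 / 40\<bar> \<le> high_half) \<and>
      (norm (curve X t) < 1 \<longleftrightarrow> \<bar>t / \<epsilon> + 4\<bar> < low_half \<or> \<bar>t / \<epsilon> - 49 / 40\<bar> < high_half)"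
    proof (cases "\<bar>t\<bar> \<le> 6 * \<epsilon>")
      case t6: True
      show ?thesis
      proof (cases "\<bar>t / \<epsilon> - 49 / 40\<bar> < 1 / 200")
        case True
        then show ?thesis using Xin[OF t6 True] high_half by auto
      next
        case False
        then have "curve X t = k * (kink (t / \<epsilon>) - disk_centre)"
          using X[OF t6] cB[of t] near(1)[OF t6] by simp
        then show ?thesis by (simp only: normk kink_in_disk)
      qed
    next
      case False
      then have "6 < norm (curve C t)" using far t by simp
      moreover have "norm disk_centre \<le> 5"
        using cmod_le[of disk_centre] by (simp add: disk_centre_def)
      ultimately have "norm (curve C t - disk_centre) > 7 / 10"
        using norm_triangle_ineq2[of "curve C t" disk_centre] by linarith
      then have n: "\<not> norm (curve X t) \<le> 1" "\<not> norm (curve X t) < 1"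
        using far'[OF t] False cB[of t] normk[of "curve C t - disk_centre"] by auto
      have "t \<notin> {fst I1..snd I1}" "t \<notin> {fst I2..snd I2}"
        using small1[of t] small2[of t] False eps by linarith+
      then have "\<not> \<bar>t / \<epsilon> + 4\<bar> \<le> low_half" "\<not> \<bar>t / \<epsilon> - 49 / 40\<bar> \<le> high_half" unfolding in1 in2 .
      then show ?thesis using n by auto
    qed
    then show "norm (curve X t) \<le> 1 \<longleftrightarrow> (\<exists>I\<in>set Is. t \<in> {fst I..snd I})"
      "norm (curve X t) < 1 \<longleftrightarrow> (\<exists>I\<in>set Is. t \<in> {fst I<..<snd I})"
      unfolding in1[symmetric] in2[symmetric] by (simp_all add: Is_def)
  qed
  have TB: "tangle B Is"
  proof (rule tangle[OF virtual_diagram_periodic[OF B]])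
    fix t assume t: "\<bar>t\<bar> \<le> 6 * \<epsilon>" "\<bar>t / \<epsilon> - 49 / 40\<bar> < 1 / 200"
    then have "\<bar>t / \<epsilon> - 49 / 40\<bar> < high_half" using high_half by linarith
    then have "norm (kink (t / \<epsilon>) - disk_centre) < 7 / 10" unfolding kink_in_disk by blast
    then show "norm (curve B t) < 1" by (simp only: cB near(1)[OF t(1)] normk)
  qed simp_all
  have TE: "tangle E Is"
  proof (rule tangle)
    show "curve E (t + 1) = curve E t" for t unfolding cE by (rule perE)
    fix t
    {
      assume t: "\<bar>t\<bar> \<le> 6 * \<epsilon>" "1 / 200 \<le> \<bar>t / \<epsilon> - 49 / 40\<bar>"
      have "\<bar>t\<bar> \<le> 1 / 2" using t(1) eps by linarith
      then show "curve E t = curve B t" using cE0[of t] push_outside(1)[OF t(2)] by (simp add: cE g_def)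
    next
      assume t: "\<bar>t\<bar> \<le> 1 / 2" "6 * \<epsilon> < \<bar>t\<bar>"
      then show "curve E t = curve B t" using cE0[OF t(1)] supp[of t] eps by (simp add: cE)
    next
      assume t: "\<bar>t\<bar> \<le> 6 * \<epsilon>" "\<bar>t / \<epsilon> - 49 / 40\<bar> < 1 / 200"
      show "norm (curve E t) < 1" using pushed_in_disk[OF t(2)] by (simp only: cE cE_near[OF t(1)] normk)
    }
  qed
  have small_int: "x = 0" if "x \<in> \<int>" "\<bar>x\<bar> < 100 * \<epsilon>" for x
    using Ints_abs_less_1[OF that(1)] that(2) eps by simp
  have strands: "{fst I1..snd I1} \<union> {fst I2..snd I2} \<subseteq> {-5 * \<epsilon><..<2 * \<epsilon>}"
    using small1 small2 eps by (smt (verit) UnE greaterThanLessThan_iff subsetI)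
  have ew: "\<epsilon> * w1 \<in> {fst I2<..<snd I2}" "\<epsilon> * w2 \<in> {fst I2<..<snd I2}"
    unfolding in2 using w high_half eps by auto
  have ea: "\<epsilon> * a1 \<in> {fst I1<..<snd I1}" "\<epsilon> * a2 \<in> {fst I1<..<snd I1}"
    unfolding in1 using a low_half eps by auto
  have order: "\<epsilon> * a1 < \<epsilon> * a2" "\<epsilon> * a2 < \<epsilon> * w1" "\<epsilon> * w1 < \<epsilon> * w2" using w w' a a' eps by auto
  have Zsub: "Z \<subseteq> {-5 * \<epsilon><..<2 * \<epsilon>}"
  proof -
    have "Z \<subseteq> {fst I1<..<snd I1} \<union> {fst I2<..<snd I2}" unfolding Z_def using ea ew by blast
    also have "\<dots> \<subseteq> {fst I1..snd I1} \<union> {fst I2..snd I2}" by auto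
    also note strands
    finally show ?thesis .
  qed
  have inopen: "t \<in> (\<Union>I\<in>set Is. open_strand I)" if ts: "t - s \<in> \<int>" and s: "s \<in> {fst I1<..<snd I1} \<union> {fst I2<..<snd I2}" for t s
  proof -
    obtain n where "t - s = of_int n" using ts by (auto elim: Ints_cases)
    then have "t + of_int (- n) = s" by simp
    then have "t \<in> open_strand I1 \<or> t \<in> open_strand I2"
      using s unfolding open_strand_def by (metis (mono_tags, lifting) UnE mem_Collect_eq)
    then show ?thesis by (auto simp: Is_def)
  qed
  have out: "curve E t = curve B t \<and> mark E t = mark B t" if t: "t \<notin> (\<Union>I\<in>set Is. open_strand I)" for t
  proof -
    define s where "s = t - of_int (round t)"
    have ts: "t - s \<in> \<int>" by (simp add: s_def)
    have "\<not> \<bar>s / \<epsilon> - 49 / 40\<bar> < high_half" using inopen[OF ts] t in2(2)[of s] by blast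
    then have "push (s / \<epsilon>) = 0" using high_half by (intro push_outside(1)) linarith
    then have "curve E t = curve B t" by (simp add: cE cE_def g_def s_def)
    moreover have "t - \<epsilon> * a1 \<notin> \<int>" "t - \<epsilon> * a2 \<notin> \<int>" "t - \<epsilon> * w1 \<notin> \<int>" "t - \<epsilon> * w2 \<notin> \<int>"
      using inopen t ea ew by blast+
    ultimately show ?thesis by (simp add: mE mE_def)
  qed
  have osub: "(\<Union>I\<in>set Is. open_strand I) \<subseteq> S" using open_strand_subset unfolding S_def by blast
  have inS: "\<exists>s. s \<in> {fst I1..snd I1} \<union> {fst I2..snd I2} \<and> t - s \<in> \<int>" if "t \<in> S" for t
    using that unfolding S_def Is_def by (auto elim!: closed_strandE)
  have plainB: "mark B t = Plain" if "t \<in> {fst I1..snd I1} \<union> {fst I2..snd I2}" for t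
  proof -
    have "\<bar>t\<bar> \<le> 6 * \<epsilon>" "\<bar>t\<bar> \<noteq> 2 * \<epsilon>" using that small1[of t] small2[of t] eps by auto
    then show ?thesis unfolding mB by (rule plain)
  qed
  have plainS: "mark B t = Plain" if "t \<in> S" for t
    using inS[OF that] plainB mark_Ints[OF B] by metis
  have imm: "closed_immersion (curve E)"
    unfolding cE
  proof (rule closed_immersionI[OF bump(1-3)])
    fix t :: real
    define s where "s = t - of_int (round t)"
    show "b' t + g' (t - of_int (round t)) \<noteq> 0"
    proof (cases "1 / 200 \<le> \<bar>s / \<epsilon> - 49 / 40\<bar>")
      case True
      then have "g' s = 0" by (simp add: g'_def push_outside)
      then show ?thesis using b'0 by (simp add: s_def)
    next
      case False
      have "1 \<le> s / \<epsilon>" "s / \<epsilon> \<le> 2" using False by linarith+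
      then have s: "\<epsilon> \<le> s" "s \<le> 2 * \<epsilon>" using eps by (simp_all add: pos_le_divide_eq pos_divide_le_eq)
      have "b' t = b' s"
        using vector_derivative_periodic[OF virtual_diagram_immersion[OF B], of t s]
        unfolding vector_derivative_at[OF dB] by (simp add: s_def)
      also have "b' s = k * (kink' (s / \<epsilon>) / of_real \<epsilon>)" using s eps by (intro b') simp
      finally have "b' t + g' s = k * ((kink' (s / \<epsilon>) + \<i> * of_real (push' (s / \<epsilon>))) / of_real \<epsilon>)"
        by (simp add: g'_def algebra_simps add_divide_distrib)
      \<comment> \<open>The displacement is vertical, so the horizontal speed 5 of the segment is
        unchanged.\<close>
      moreover have "Re (kink' (s / \<epsilon>) + \<i> * of_real (push' (s / \<epsilon>))) = 5"
        using kink_abscissa'_middle[OF \<open>1 \<le> s / \<epsilon>\<close> \<open>s / \<epsilon> \<le> 2\<close>] by (simp add: kink'_def)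
      then have "kink' (s / \<epsilon>) + \<i> * of_real (push' (s / \<epsilon>)) \<noteq> 0" by (metis zero_complex.sel(1) zero_neq_numeral)
      ultimately show ?thesis using eps k0 by (simp add: s_def)
    qed
  qed
  define P where "P = {(\<epsilon> * a1, \<epsilon> * w1), (\<epsilon> * w1, \<epsilon> * a1), (\<epsilon> * a2, \<epsilon> * w2), (\<epsilon> * w2, \<epsilon> * a2)}"
  have PZ: "p \<in> Z \<and> q \<in> Z" if "(p, q) \<in> P" for p q using that by (auto simp: P_def Z_def)
  have Zint: "p = q" if "p \<in> {-5 * \<epsilon><..<2 * \<epsilon>}" "q \<in> {-5 * \<epsilon><..<2 * \<epsilon>}" "p - q \<in> \<int>" for p q
  proof -
    have "\<bar>p - q\<bar> < 100 * \<epsilon>" using that(1,2) eps unfolding greaterThanLessThan_iff by linarith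
    then show ?thesis using small_int[OF that(3)] by simp
  qed
  have ZS: "z \<in> S" if "z \<in> Z" for z
    using inopen[of z z] that ea ew osub unfolding Z_def by auto
  have lower: "cE t = k * (of_real (t / \<epsilon>) - disk_centre)" if "t \<in> {fst I1..snd I1}" for t
  proof -
    have t: "t / \<epsilon> < -3" using that low_half unfolding in1 by linarith
    then have "push (t / \<epsilon>) = 0" "kink (t / \<epsilon>) = of_real (t / \<epsilon>)"
    proof -
      have "1 / 200 \<le> \<bar>t / \<epsilon> - 49 / 40\<bar>" "3 \<le> \<bar>t / \<epsilon>\<bar>" using t by linarith+
      from push_outside(1)[OF this(1)] kink_outside[OF this(2)]
      show "push (t / \<epsilon>) = 0" "kink (t / \<epsilon>) = of_real (t / \<epsilon>)" by (auto simp: complex_eq_iff)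
    qed
    moreover have "\<bar>t\<bar> \<le> 6 * \<epsilon>" using small1[OF that] eps by linarith
    ultimately show ?thesis by (simp add: cE_near zero_complex.code[symmetric])
  qed
  have upper: "cE t = k * (Complex (5 * (t / \<epsilon>) - 10) ((5 / 2 - t / \<epsilon>) * (1 - 51 / 50 * dip (t / \<epsilon>))) - disk_centre)"
    if "t \<in> {fst I2..snd I2}" for t
  proof -
    have t: "1 \<le> t / \<epsilon>" "t / \<epsilon> \<le> 2" using that high_half unfolding in2 by linarith+
    have "kink (t / \<epsilon>) + Complex 0 (push (t / \<epsilon>)) = Complex (5 * (t / \<epsilon>) - 10) ((5 / 2 - t / \<epsilon>) * (1 - 51 / 50 * dip (t / \<epsilon>)))"
      using kink_abscissa_pieces(2)[OF t] kink_height_pieces(2)[OF t]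
      by (simp add: complex_eq_iff push_def algebra_simps)
    moreover have "\<bar>t\<bar> \<le> 6 * \<epsilon>" using small2[OF that] eps by linarith
    ultimately show ?thesis by (simp add: cE_near)
  qed
  have canc: "k * (x - disk_centre) = k * (y - disk_centre) \<longleftrightarrow> x = y" for x y using k0 by simp
  \<comment> \<open>The lower strand lies on the axis, so the strands meet where the height factor
    of the upper one vanishes and the abscissas agree.\<close>
  have meet: "cE s = cE t \<longleftrightarrow> (s, t) \<in> {(\<epsilon> * a1, \<epsilon> * w1), (\<epsilon> * a2, \<epsilon> * w2)}"
    if s: "s \<in> {fst I1..snd I1}" and t: "t \<in> {fst I2..snd I2}" for s t
  proof -
    have t2: "t / \<epsilon> \<le> 2" using t high_half unfolding in2 by linarith
    have "cE s = cE t \<longleftrightarrow> s / \<epsilon> = 5 * (t / \<epsilon>) - 10 \<and> (5 / 2 - t / \<epsilon>) * (1 - 51 / 50 * dip (t / \<epsilon>)) = 0"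
      unfolding lower[OF s] upper[OF t] canc by (auto simp: complex_eq_iff)
    also have "\<dots> \<longleftrightarrow> s / \<epsilon> = 5 * (t / \<epsilon>) - 10 \<and> dip (t / \<epsilon>) = 50 / 51"
    proof -
      have "5 / 2 - t / \<epsilon> \<noteq> 0" using t2 by linarith
      moreover have "1 - 51 / 50 * d = 0 \<longleftrightarrow> d = 50 / 51" for d :: real by auto
      ultimately show ?thesis by (simp only: mult_eq_0_iff simp_thms)
    qed
    also have "\<dots> \<longleftrightarrow> (s / \<epsilon> = a1 \<and> t / \<epsilon> = w1) \<or> (s / \<epsilon> = a2 \<and> t / \<epsilon> = w2)"
      unfolding dip_eq_iff w1_def[symmetric] w2_def[symmetric] a1_def a2_def by auto
    also have "\<dots> \<longleftrightarrow> (s = \<epsilon> * a1 \<and> t = \<epsilon> * w1) \<or> (s = \<epsilon> * a2 \<and> t = \<epsilon> * w2)"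
      using eps by (simp add: divide_eq_eq mult.commute)
    finally show ?thesis by simp
  qed
  \<comment> \<open>The abscissa is injective on each strand: even the pushed one remains a graph
    over the axis.\<close>
  have cE_inj: "s = t" if "cE s = cE t" "(s \<in> {fst I1..snd I1} \<and> t \<in> {fst I1..snd I1}) \<or> (s \<in> {fst I2..snd I2} \<and> t \<in> {fst I2..snd I2})" for s t
  proof -
    have "s / \<epsilon> = t / \<epsilon>"
      using that(2)
    proof
      assume "s \<in> {fst I1..snd I1} \<and> t \<in> {fst I1..snd I1}"
      then have "complex_of_real (s / \<epsilon>) = of_real (t / \<epsilon>)" using that(1) lower canc by metis
      then show ?thesis by (simp only: of_real_eq_iff)
    next
      assume "s \<in> {fst I2..snd I2} \<and> t \<in> {fst I2..snd I2}"
      then have "5 * (s / \<epsilon>) - 10 = 5 * (t / \<epsilon>) - 10"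
        using that(1) upper canc by (metis complex.inject)
      then show ?thesis by linarith
    qed
    then show ?thesis using eps by simp
  qed
  have disj12: "{fst I1..snd I1} \<inter> {fst I2..snd I2} = {}"
    using small1 small2 eps by (smt (verit) disjoint_iff)
  have eq_iff: "cE s = cE t \<longleftrightarrow> s = t \<or> (s, t) \<in> P"
    if s: "s \<in> {fst I1..snd I1} \<union> {fst I2..snd I2}" and t: "t \<in> {fst I1..snd I1} \<union> {fst I2..snd I2}" for s t
  proof -
    have ea': "\<epsilon> * a1 \<in> {fst I1..snd I1}" "\<epsilon> * a2 \<in> {fst I1..snd I1}" "\<epsilon> * w1 \<in> {fst I2..snd I2}" "\<epsilon> * w2 \<in> {fst I2..snd I2}"
      using ea ew by auto
    have Pm: "(x \<in> {fst I1..snd I1} \<and> y \<in> {fst I2..snd I2}) \<or> (x \<in> {fst I2..snd I2} \<and> y \<in> {fst I1..snd I1})" if "(x, y) \<in> P" for x y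
      using that ea' unfolding P_def by blast
    consider "s \<in> {fst I1..snd I1}" "t \<in> {fst I2..snd I2}" | "s \<in> {fst I2..snd I2}" "t \<in> {fst I1..snd I1}"
      | "(s \<in> {fst I1..snd I1} \<and> t \<in> {fst I1..snd I1}) \<or> (s \<in> {fst I2..snd I2} \<and> t \<in> {fst I2..snd I2})"
      using s t by blast
    then show ?thesis
    proof cases
      case 1
      then have "s \<noteq> t" using disj12 by blast
      moreover have "(s, t) \<in> P \<longleftrightarrow> (s, t) \<in> {(\<epsilon> * a1, \<epsilon> * w1), (\<epsilon> * a2, \<epsilon> * w2)}"
        using 1 ea' disj12 unfolding P_def by blast
      ultimately show ?thesis using meet[OF 1] by simp
    next
      case 2
      then have "s \<noteq> t" using disj12 by blast
      moreover have "(s, t) \<in> P \<longleftrightarrow> (t, s) \<in> {(\<epsilon> * a1, \<epsilon> * w1), (\<epsilon> * a2, \<epsilon> * w2)}"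
        using 2 ea' disj12 unfolding P_def by blast
      ultimately show ?thesis using meet[OF 2(2,1)] by metis
    next
      case 3
      then have "(s, t) \<notin> P" using Pm[of s t] disj12 by blast
      then show ?thesis using cE_inj[OF _ 3] by blast
    qed
  qed
  have mEZ: "mE (\<epsilon> * a1) = Over" "mE (\<epsilon> * a2) = Over" "mE (\<epsilon> * w1) = Under" "mE (\<epsilon> * w2) = Under"
  proof -
    have n: "x - y \<notin> \<int>" if "x \<in> Z" "y \<in> Z" "y < x" for x y
      using Zint[of x y] that Zsub by blast
    have mem: "\<epsilon> * a1 \<in> Z" "\<epsilon> * a2 \<in> Z" "\<epsilon> * w1 \<in> Z" "\<epsilon> * w2 \<in> Z" by (simp_all add: Z_def)
    have "\<epsilon> * a1 < \<epsilon> * w1" "\<epsilon> * a1 < \<epsilon> * w2" "\<epsilon> * a2 < \<epsilon> * w2" using order by linarith+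
    then have "\<epsilon> * w1 - \<epsilon> * a1 \<notin> \<int>" "\<epsilon> * w1 - \<epsilon> * a2 \<notin> \<int>" "\<epsilon> * w2 - \<epsilon> * a1 \<notin> \<int>" "\<epsilon> * w2 - \<epsilon> * a2 \<notin> \<int>"
      using n mem order(2) by blast+
    then show "mE (\<epsilon> * a1) = Over" "mE (\<epsilon> * a2) = Over" "mE (\<epsilon> * w1) = Under" "mE (\<epsilon> * w2) = Under"
      by (simp_all add: mE_def)
  qed
  have mE_plain: "mE t = mark B t" if "\<And>z. z \<in> Z \<Longrightarrow> t - z \<notin> \<int>" for t
    using that by (simp add: mE_def Z_def)
  have mE_real: "mE t \<in> {Over, Under}" if "z \<in> Z" "t - z \<in> \<int>" for t z
    using that by (auto simp: mE_def Z_def)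
  have per': "\<forall>t. cE (t + 1) = cE t" using perE by blast
  have vE: "virtual_diagram E"
  proof (rule virtual_diagram_replace[OF B TB TE, folded S_def, of P])
    show "curve E t = curve B t \<and> mark E t = mark B t" if "t \<notin> S" for t
      using out that osub by blast
    show "mark B t = Plain" if "t \<in> S" for t using that by (rule plainS)
    show "closed_immersion (curve E)" by (rule imm)
    show "mark E (t + 1) = mark E t" for t
    proof -
      have "t + 1 - z \<in> \<int> \<longleftrightarrow> t - z \<in> \<int>" for z
        using Ints_trans[of "t + 1" t z] Ints_trans[of t "t + 1" z] by auto
      then show ?thesis using mark_Ints[OF B, of "t + 1" t] by (simp add: mE mE_def)
    qed
    show "finite P" by (simp add: P_def)
    show "p \<in> S \<and> q \<in> S" if "(p, q) \<in> P" for p q using PZ[OF that] ZS by blast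
    show "q - q' \<in> \<int>" if pq: "(p, q) \<in> P" "(p', q') \<in> P" "p - p' \<in> \<int>" for p q p' q'
    proof -
      have "p = p'" using Zint[OF _ _ pq(3)] PZ pq(1,2) Zsub by blast
      then have "q = q'" using pq(1,2) order unfolding P_def by auto
      then show ?thesis by simp
    qed
    show "double_point (curve E) s t \<longleftrightarrow> (\<exists>(p, q)\<in>P. s - p \<in> \<int> \<and> t - q \<in> \<int>)" if st: "s \<in> S" "t \<in> S" for s t
    proof -
      obtain s0 where s0: "s0 \<in> {fst I1..snd I1} \<union> {fst I2..snd I2}" "s - s0 \<in> \<int>" using inS[OF st(1)] by blast
      obtain t0 where t0: "t0 \<in> {fst I1..snd I1} \<union> {fst I2..snd I2}" "t - t0 \<in> \<int>" using inS[OF st(2)] by blast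
      have c: "curve E s = cE s0" "curve E t = cE t0"
        using periodic_Ints[OF per' s0(2)] periodic_Ints[OF per' t0(2)] by (simp_all add: cE)
      have i: "s - t \<in> \<int> \<longleftrightarrow> s0 = t0"
      proof
        assume "s - t \<in> \<int>"
        then have "s0 - t0 \<in> \<int>" using s0(2) t0(2) by (meson Ints_sym Ints_trans)
        then show "s0 = t0" using s0(1) t0(1) strands Zint by blast
      qed (use s0(2) t0(2) in \<open>meson Ints_sym Ints_trans\<close>)
      have j: "r - p \<in> \<int> \<longleftrightarrow> r0 = p" if "r0 \<in> {fst I1..snd I1} \<union> {fst I2..snd I2}" "r - r0 \<in> \<int>" "p \<in> Z" for r r0 p
      proof
        assume "r - p \<in> \<int>"
        then have "r0 - p \<in> \<int>" using that(2) by (meson Ints_sym Ints_trans)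
        then show "r0 = p" using that(1,3) strands Zsub Zint by blast
      qed (use that in auto)
      have "(\<exists>(p, q)\<in>P. s - p \<in> \<int> \<and> t - q \<in> \<int>) \<longleftrightarrow> (s0, t0) \<in> P"
      proof
        assume "\<exists>(p, q)\<in>P. s - p \<in> \<int> \<and> t - q \<in> \<int>"
        then obtain p q where pq: "(p, q) \<in> P" "s - p \<in> \<int>" "t - q \<in> \<int>" by blast
        then show "(s0, t0) \<in> P" using j[OF s0, of p] j[OF t0, of q] PZ[OF pq(1)] by simp
      next
        assume "(s0, t0) \<in> P"
        then show "\<exists>(p, q)\<in>P. s - p \<in> \<int> \<and> t - q \<in> \<int>" using s0(2) t0(2) by blast
      qed
      moreover have "(s0, t0) \<in> P \<Longrightarrow> s0 \<noteq> t0" using order unfolding P_def by auto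
      ultimately show ?thesis
        unfolding double_point_def c i using eq_iff[OF s0(1) t0(1)] by blast
    qed
    have vd: "vector_derivative (curve E) (at t) = (k / of_real \<epsilon>) * (kink' (t / \<epsilon>) + \<i> * of_real (push' (t / \<epsilon>)))"
      if "\<bar>t\<bar> < 6 * \<epsilon>" for t
    proof -
      have "round t = 0" using that eps by (intro round_unique') auto
      then have "b' t + g' (t - of_int (round t)) = (k / of_real \<epsilon>) * (kink' (t / \<epsilon>) + \<i> * of_real (push' (t / \<epsilon>)))"
        by (simp add: b'[OF that] g'_def algebra_simps add_divide_distrib)
      then show ?thesis using vector_derivative_at[OF bump(2)[of t]] unfolding cE by simp
    qed
    have cross: "cross2 (vector_derivative (curve E) (at (\<epsilon> * x))) (vector_derivative (curve E) (at (\<epsilon> * y))) \<noteq> 0 \<and>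
        cross2 (vector_derivative (curve E) (at (\<epsilon> * y))) (vector_derivative (curve E) (at (\<epsilon> * x))) \<noteq> 0"
      if x: "-5 < x" "x < -3" and y: "1 < y" "y < 2" "dip y = 50 / 51" for x y
    proof -
      have b: "\<bar>\<epsilon> * r\<bar> < 6 * \<epsilon>" if "\<bar>r\<bar> < 6" for r
      proof -
        have "\<bar>\<epsilon> * r\<bar> = \<epsilon> * \<bar>r\<bar>" using eps by (simp add: abs_mult)
        moreover have "\<epsilon> * \<bar>r\<bar> < \<epsilon> * 6" using that eps by (intro mult_strict_left_mono) auto
        ultimately show ?thesis by linarith
      qed
      have "\<bar>x\<bar> < 6" "\<bar>y\<bar> < 6" using x y by auto
      moreover have "\<epsilon> * x / \<epsilon> = x" "\<epsilon> * y / \<epsilon> = y" using eps by simp_all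
      ultimately have v: "vector_derivative (curve E) (at (\<epsilon> * x)) = (k / of_real \<epsilon>) * (kink' x + \<i> * of_real (push' x))"
        "vector_derivative (curve E) (at (\<epsilon> * y)) = (k / of_real \<epsilon>) * (kink' y + \<i> * of_real (push' y))"
        using vd[OF b, of x] vd[OF b, of y] by simp_all
      have kx: "kink' x + \<i> * of_real (push' x) = Complex 1 0"
        using x kink_derivative_pieces(7,8)[of x] push_outside(2)[of x] by (simp add: kink'_def complex_eq_iff)
      have ky: "kink' y + \<i> * of_real (push' y) = Complex 5 (- 1 + push' y)"
        using y kink_derivative_pieces(2)[of y] kink_abscissa'_middle[of y] by (simp add: kink'_def complex_eq_iff)
      \<comment> \<open>At a crossing \<open>51 / 50 * dip y\<close> is 1 and cancels the slope -1
        of the segment; what remains is a nonzero multiple of \<open>dip' y\<close>.\<close>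
      have "- 1 + push' y = - (51 / 50 * (5 / 2 - y) * dip' y)" unfolding push'_def y(3) by simp
      then have py: "- 1 + push' y \<noteq> 0" using dip'_nonzero[OF y(3)] y(2) by simp
      have c: "cross2 (Complex 1 0) (Complex 5 z) = z" "cross2 (Complex 5 z) (Complex 1 0) = - z" for z
        by (simp_all add: cross2_def)
      show ?thesis unfolding v kx ky cross2_mult c using py k0 eps by simp
    qed
    show "cross2 (vector_derivative (curve E) (at p)) (vector_derivative (curve E) (at q)) \<noteq> 0" if "(p, q) \<in> P" for p q
    proof -
      have "dip w1 = 50 / 51" "dip w2 = 50 / 51" unfolding dip_eq_iff by (simp_all add: w1_def w2_def)
      then show ?thesis using that cross[of a1 w1] cross[of a2 w2] w w' a' a(3) unfolding P_def by auto
    qed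
    show "mark E t = Plain \<longleftrightarrow> \<not> (\<exists>(p, q)\<in>P. t - p \<in> \<int>)" if "t \<in> S" for t
    proof -
      have "(\<exists>(p, q)\<in>P. t - p \<in> \<int>) \<longleftrightarrow> (\<exists>z\<in>Z. t - z \<in> \<int>)" unfolding P_def Z_def by auto
      then show ?thesis using mE_plain[of t] mE_real[of _ t] plainS[OF that] unfolding mE by fastforce
    qed
    show "(mark E p, mark E q) \<in> {(Over, Under), (Under, Over), (Virtual, Virtual)}" if "(p, q) \<in> P" for p q
      using that mEZ unfolding mE P_def by auto
  qed
  have "bigon_added Over B E"
    unfolding bigon_added_def
  proof (intro exI conjI)
    show "local_change [(fst I1, snd I1), (fst I2, snd I2)] B E"
      using TB TE out unfolding local_change_def Is_def by simp
    show "plain_on B ({fst I1..snd I1} \<union> {fst I2..snd I2})" using plainB unfolding plain_on_def by blast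
    show "fst I1 < \<epsilon> * a1" "\<epsilon> * a2 < snd I1" "\<epsilon> * w1 \<in> {fst I2<..<snd I2}" "\<epsilon> * w2 \<in> {fst I2<..<snd I2}"
      using ea ew by auto
    show "\<epsilon> * a1 < \<epsilon> * a2" "\<epsilon> * w1 \<noteq> \<epsilon> * w2" using order by auto
    show "curve E (\<epsilon> * a1) = curve E (\<epsilon> * w1)" "curve E (\<epsilon> * a2) = curve E (\<epsilon> * w2)"
      using meet[of "\<epsilon> * a1" "\<epsilon> * w1"] meet[of "\<epsilon> * a2" "\<epsilon> * w2"] ea ew unfolding cE by auto
    show "mark E (\<epsilon> * a1) = Over" "mark E (\<epsilon> * a2) = Over" using mEZ unfolding mE by auto
    show "plain_on E ({fst I1..snd I1} \<union> {fst I2..snd I2} - {\<epsilon> * a1, \<epsilon> * a2, \<epsilon> * w1, \<epsilon> * w2})"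
      unfolding plain_on_def
    proof
      fix t assume t: "t \<in> {fst I1..snd I1} \<union> {fst I2..snd I2} - {\<epsilon> * a1, \<epsilon> * a2, \<epsilon> * w1, \<epsilon> * w2}"
      then have "t - z \<notin> \<int>" if "z \<in> Z" for z using Zint[of t z] that strands Zsub unfolding Z_def by blast
      then show "mark E t = Plain" using mE_plain plainB t unfolding mE by auto
    qed
  qed
  \<comment> \<open>Both strands are put into one arc, from \<open>- 5 * \<epsilon>\<close> to
    \<open>2 * \<epsilon>\<close>. In \<open>B\<close> it has no real ends, as the marks of the kink
    are \<open>Plain\<close> or \<open>Virtual\<close>.\<close>
  moreover have "odd_number E = odd_number B + card (odd_points E Z)"
  proof (rule odd_number_insert[OF B vE])
    show "real_points B \<inter> closed_strand (- 5 * \<epsilon>, 2 * \<epsilon>) = {}"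
    proof -
      have "t \<notin> real_points B" if "t \<in> closed_strand (- 5 * \<epsilon>, 2 * \<epsilon>)" for t
      proof -
        obtain s where s: "s \<in> {fst (- 5 * \<epsilon>, 2 * \<epsilon>)..snd (- 5 * \<epsilon>, 2 * \<epsilon>)}" "t - s \<in> \<int>"
          using \<open>t \<in> closed_strand (- 5 * \<epsilon>, 2 * \<epsilon>)\<close> closed_strandE by blast
        then have "mark B s \<in> {Plain, Virtual}" unfolding mB using eps by (intro mC) auto
        then show ?thesis using mark_Ints[OF B s(2)] by (auto simp: real_points_def)
      qed
      then show ?thesis by blast
    qed
    show "curve E t = curve B t \<and> mark E t = mark B t" if t: "t \<notin> closed_strand (- 5 * \<epsilon>, 2 * \<epsilon>)" for t
    proof (rule out)
      show "t \<notin> (\<Union>I\<in>set Is. open_strand I)"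
      proof
        assume "t \<in> (\<Union>I\<in>set Is. open_strand I)"
        then have "t \<in> S" using osub by blast
        then obtain s where s: "s \<in> {fst I1..snd I1} \<union> {fst I2..snd I2}" "t - s \<in> \<int>" using inS by blast
        then have "s \<in> {- 5 * \<epsilon><..<2 * \<epsilon>}" using strands by blast
        then have "s \<in> closed_strand (- 5 * \<epsilon>, 2 * \<epsilon>)" by (intro closed_strandI) auto
        then show False using t closed_strand_Ints[OF _ Ints_sym[OF s(2)]] by blast
      qed
    qed
    show "Z \<subseteq> {- 5 * \<epsilon>..2 * \<epsilon>}" using Zsub by fastforce
    show "even (card Z)" using card_four[OF order] by (simp add: Z_def)
    show "reps (real_points E \<inter> closed_strand (- 5 * \<epsilon>, 2 * \<epsilon>)) Z"
    proof (rule repsI)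
      show "finite Z" by (simp add: Z_def)
      have "z \<in> real_points E" if "z \<in> Z" for z using mE_real[OF that, of z] by (auto simp: real_points_def mE)
      moreover have "z \<in> closed_strand (- 5 * \<epsilon>, 2 * \<epsilon>)" if "z \<in> Z" for z
        using that Zsub by (intro closed_strandI) auto
      ultimately show "Z \<subseteq> real_points E \<inter> closed_strand (- 5 * \<epsilon>, 2 * \<epsilon>)" by blast
      show "x = y" if "x \<in> Z" "y \<in> Z" "x - y \<in> \<int>" for x y using that Zint Zsub by blast
      show "\<exists>z\<in>Z. t - z \<in> \<int>" if t: "t \<in> real_points E \<inter> closed_strand (- 5 * \<epsilon>, 2 * \<epsilon>)" for t
      proof (rule ccontr)
        assume "\<not> (\<exists>z\<in>Z. t - z \<in> \<int>)"
        then have "mE t = mark B t" by (intro mE_plain) blast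
        obtain s where s: "s \<in> {fst (- 5 * \<epsilon>, 2 * \<epsilon>)..snd (- 5 * \<epsilon>, 2 * \<epsilon>)}" "t - s \<in> \<int>"
          using t closed_strandE by blast
        then have "mark B s \<in> {Plain, Virtual}" unfolding mB using eps by (intro mC) auto
        then show False using mark_Ints[OF B s(2)] t \<open>mE t = mark B t\<close> by (auto simp: real_points_def mE)
      qed
    qed
    show "\<exists>z'\<in>Z. double_point (curve E) z z'" if "z \<in> Z" for z
    proof -
      have "\<exists>z'\<in>Z. (z, z') \<in> P" using that unfolding Z_def P_def by blast
      then obtain z' where z': "z' \<in> Z" "(z, z') \<in> P" by blast
      then have "z \<noteq> z'" using order unfolding P_def by auto
      then have "z - z' \<notin> \<int>" using Zint Zsub z'(1) that by blast
      moreover have "cE z = cE z'"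
        using eq_iff[of z z'] z' that ea ew unfolding Z_def by auto
      ultimately show ?thesis using z'(1) unfolding double_point_def cE by blast
    qed
  qed
  moreover have "card (odd_points E Z) = 4"
  proof -
    have cl: "\<lceil>x - y\<rceil> = (if x \<le> y then 0 else 1)" if "x \<in> Z" "y \<in> Z" for x y
    proof -
      have "x \<in> {-5 * \<epsilon><..<2 * \<epsilon>}" "y \<in> {-5 * \<epsilon><..<2 * \<epsilon>}" using that Zsub by blast+
      then have "\<bar>x - y\<bar> < 1" unfolding greaterThanLessThan_iff abs_less_iff using eps by linarith
      then show ?thesis using ceiling_close[of x y] by (cases "x = y") (simp_all add: order_le_less)
    qed
    have sum: "height Z u = \<lceil>u - \<epsilon> * a1\<rceil> + \<lceil>u - \<epsilon> * a2\<rceil> + \<lceil>u - \<epsilon> * w1\<rceil> + \<lceil>u - \<epsilon> * w2\<rceil>" for u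
      unfolding height_def Z_def by (rule sum_four[OF order])
    have mem: "\<epsilon> * a1 \<in> Z" "\<epsilon> * a2 \<in> Z" "\<epsilon> * w1 \<in> Z" "\<epsilon> * w2 \<in> Z" by (simp_all add: Z_def)
    \<comment> \<open>In the order along the curve the heights are 0, 1, 2, 3. The chords join 0
      with 2 and 1 with 3, so all four ends are odd.\<close>
    have h: "height Z (\<epsilon> * a1) = 0" "height Z (\<epsilon> * a2) = 1" "height Z (\<epsilon> * w1) = 2" "height Z (\<epsilon> * w2) = 3"
      unfolding sum cl[OF mem(1) mem(1)] cl[OF mem(1) mem(2)] cl[OF mem(1) mem(3)] cl[OF mem(1) mem(4)]
        cl[OF mem(2) mem(1)] cl[OF mem(2) mem(2)] cl[OF mem(2) mem(3)] cl[OF mem(2) mem(4)]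
        cl[OF mem(3) mem(1)] cl[OF mem(3) mem(2)] cl[OF mem(3) mem(3)] cl[OF mem(3) mem(4)]
        cl[OF mem(4) mem(1)] cl[OF mem(4) mem(2)] cl[OF mem(4) mem(3)] cl[OF mem(4) mem(4)]
      using order by auto
    have dp: "double_point (curve E) p q" if "(p, q) \<in> P" for p q
    proof -
      have pq: "p \<in> Z" "q \<in> Z" using PZ[OF that] by auto
      have "p \<noteq> q" using order that unfolding P_def by auto
      then have "p - q \<notin> \<int>" using Zint Zsub pq by blast
      moreover have "cE p = cE q"
        using eq_iff[of p q] that pq ea ew unfolding Z_def by auto
      ultimately show ?thesis unfolding double_point_def cE by blast
    qed
    have "odd_points E Z = Z"
    proof -
      have "z \<in> odd_points E Z" if "z \<in> Z" for z
      proof -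
        have "\<exists>z'. (z, z') \<in> P \<and> even (height Z z - height Z z')"
          using that unfolding Z_def[of] P_def by (elim insertE emptyE) (auto simp: h[unfolded Z_def])
        then show ?thesis using that dp PZ unfolding odd_points_def by blast
      qed
      then show ?thesis unfolding odd_points_def by blast
    qed
    then show ?thesis using card_four[OF order] by (simp add: Z_def)
  qed
  ultimately show ?thesis using that isoB B vE by simp
qed

theorem theorem1p4:
  fixes D :: vdiag
  assumes "virtual_diagram D"
  shows "\<exists>D'. virtual_diagram D' \<and> same_virtual_knot D D' \<and>
           (\<forall>ms. move_sequence D ms D' \<longrightarrow> RII \<in> set ms)"
proof -
  obtain C \<epsilon> where ms: "move_sequence D [VRI] C" and eps: "0 < \<epsilon>" "\<epsilon> < 1 / 100"
    and C: "\<And>u. \<bar>u\<bar> \<le> 6 \<Longrightarrow> curve C (\<epsilon> * u) = kink u"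
    "\<And>t. \<bar>t\<bar> \<le> 1 / 2 \<Longrightarrow> 6 * \<epsilon> < \<bar>t\<bar> \<Longrightarrow> 6 < norm (curve C t)"
    "\<And>t. \<bar>t\<bar> \<le> 6 * \<epsilon> \<Longrightarrow> mark C t \<in> {Plain, Virtual}"
    "\<And>t. \<bar>t\<bar> \<le> 6 * \<epsilon> \<Longrightarrow> \<bar>t\<bar> \<noteq> 2 * \<epsilon> \<Longrightarrow> mark C t = Plain"
    using kink_move[OF assms] by metis
  have vC: "virtual_diagram C" using move_sequence_virtual[OF ms] by blast
  obtain B E where B: "isotopic C B" "virtual_diagram B" and E: "bigon_added Over B E" "virtual_diagram E"
    and odd: "odd_number E = odd_number B + 4"
    using bigon_move[OF vC eps C] by blast
  have msB: "move_sequence D [VRI] B" using ms B by (rule move_sequence.isotopy)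
  have "reidemeister_move RII B E" using E(1) by (simp add: reidemeister_move_def)
  then have "move_sequence D ([VRI] @ [RII]) E" using msB E(2) by (intro move_sequence.move)
  then have "same_virtual_knot D E" unfolding same_virtual_knot_def by blast
  \<comment> \<open>\<open>B\<close> is reached from \<open>D\<close> without RII, so
    \<open>E\<close> has four more odd ends than \<open>D\<close>, a difference that no sequence
    without RII can produce.\<close>
  moreover have "odd_number B = odd_number D" using move_sequence_odd_number[OF msB] by simp
  then have "RII \<in> set ms" if "move_sequence D ms E" for ms
    using move_sequence_odd_number[OF that] odd by fastforce
  ultimately show ?thesis using E(2) by blast
qed

end
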